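(* Let $\mathcal{A}$ be an abelian category, let $D^-(\mathcal{A})=K^-(\mathcal{A})/K^{-,\emptyset}(\mathcal{A})$ be the right bounded derived category of $\mathcal{A}$, and let $D^-_{\infty}(\mathcal{A})=K^-(\mathcal{A})/K^{-,b}(\mathcal{A})$. Denote by $G:D^-(\mathcal{A})\to D^-_{\infty}(\mathcal{A})$ the canonical quotient functor. Let $X,Y$ be objects of $D^-(\mathcal{A})$. Then, considering the inductive system indexed by $(n\in\mathbb{Z};\geq)$, with decreasing integers $n$, the natural map $$\varinjlim_{(n\in\mathbb{Z};\geq)}\mathrm{Hom}_{D^-(\mathcal{A})}(\sigma_{\leq n}X,\sigma_{\leq n}Y)\to \mathrm{Hom}_{D^-_{\infty}(\mathcal{A})}(GX,GY)$$ is an isomorphism.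
   Context: Complexes are cochain complexes. $K^-(\mathcal{A})$ is the homotopy category of complexes over $\mathcal{A}$ homotopy equivalent to right bounded complexes ($X^n=0$ for $n\gg 0$); $K^{-,b}(\mathcal{A})$ (resp. $K^{-,\emptyset}(\mathcal{A})$) is its full subcategory of complexes homotopy equivalent to right bounded complexes with bounded cohomology (resp. to right bounded exact complexes). Quotients are Verdier quotients. The intelligent truncation is $$\sigma_{\leq n}X=(\cdots\to X^{n-1}\xrightarrow{d^{n-1}}X^{n}\xrightarrow{d^n}\mathrm{Im}(d^{n})\to 0\to 0\to\cdots),$$ with $\mathrm{Im}(d^n)$ in degree $n+1$. It induces a functor $\sigma_{\leq n}:D^-(\mathcal{A})\to D^-(\mathcal{A})$, and $\sigma_{\leq n-1}\sigma_{\leq n}=\sigma_{\leq n-1}$. The transition maps of the inductive system are $\mathrm{Hom}_{D^-(\mathcal{A})}(\sigma_{\leq n}X,\sigma_{\leq n}Y)\to \mathrm{Hom}_{D^-(\mathcal{A})}(\sigma_{\leq n-1}X,\sigma_{\leq n-1}Y)$, $f\mapsto\sigma_{\leq n-1}f$. Let $i_n^X:\sigma_{\leq n}X\to X$ be the canonical inclusion; it becomes an isomorphism in $D^-_\infty(\mathcal{A})$. The natural map from the colimit is induced by the compatible maps sending $f:\sigma_{\leq n}X\to\sigma_{\leq n}Y$ to the composite $X\xrightarrow{(i_n^X)^{-1}}\sigma_{\leq n}X\xrightarrow{f}\sigma_{\leq n}Y\xrightarrow{i_n^Y}Y$ in $D^-_\infty(\mathcal{A})$. *)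

theory Defs
  imports Main "HOL-Algebra.Group"
begin

section \<open>Abelian categories\<close>

text \<open>Composition is written in the order of functions: \<open>Comp C g f\<close> is \<open>g\<close> after \<open>f\<close>.
  The operations are only meaningful on composable, respectively parallel, arrows of \<open>C\<close>.\<close>

record ('o, 'm) preadd_cat =
  Obj :: "'o set"
  Arr :: "'m set"
  Dom :: "'m \<Rightarrow> 'o"
  Cod :: "'m \<Rightarrow> 'o"
  Ident :: "'o \<Rightarrow> 'm"
  Comp :: "'m \<Rightarrow> 'm \<Rightarrow> 'm"
  Plus :: "'m \<Rightarrow> 'm \<Rightarrow> 'm"
  Zero :: "'o \<Rightarrow> 'o \<Rightarrow> 'm"

definition Hom :: "('o, 'm) preadd_cat \<Rightarrow> 'o \<Rightarrow> 'o \<Rightarrow> 'm set" where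
  "Hom C A B = {f \<in> Arr C. Dom C f = A \<and> Cod C f = B}"

definition hom_group :: "('o, 'm) preadd_cat \<Rightarrow> 'o \<Rightarrow> 'o \<Rightarrow> 'm monoid" where
  "hom_group C A B = \<lparr>carrier = Hom C A B, mult = Plus C, one = Zero C A B\<rparr>"

definition Neg :: "('o, 'm) preadd_cat \<Rightarrow> 'm \<Rightarrow> 'm" where
  "Neg C f = m_inv (hom_group C (Dom C f) (Cod C f)) f"

definition inverse_pair :: "('o, 'm) preadd_cat \<Rightarrow> 'm \<Rightarrow> 'm \<Rightarrow> bool" where
  "inverse_pair C f g \<longleftrightarrow>
     f \<in> Arr C \<and> g \<in> Arr C \<and> Dom C g = Cod C f \<and> Cod C g = Dom C f \<and>
     Comp C g f = Ident C (Dom C f) \<and> Comp C f g = Ident C (Cod C f)"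

definition inv_arr :: "('o, 'm) preadd_cat \<Rightarrow> 'm \<Rightarrow> 'm" where
  "inv_arr C f = (THE g. inverse_pair C f g)"

definition isomorphic :: "('o, 'm) preadd_cat \<Rightarrow> 'o \<Rightarrow> 'o \<Rightarrow> bool" where
  "isomorphic C A B \<longleftrightarrow> (\<exists>f g. inverse_pair C f g \<and> Dom C f = A \<and> Cod C f = B)"

definition monic :: "('o, 'm) preadd_cat \<Rightarrow> 'm \<Rightarrow> bool" where
  "monic C f \<longleftrightarrow> f \<in> Arr C \<and>
     (\<forall>g \<in> Arr C. \<forall>h \<in> Arr C. Cod C g = Dom C f \<and> Cod C h = Dom C f \<and> Dom C g = Dom C h \<and>
        Comp C f g = Comp C f h \<longrightarrow> g = h)"

definition epic :: "('o, 'm) preadd_cat \<Rightarrow> 'm \<Rightarrow> bool" where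
  "epic C f \<longleftrightarrow> f \<in> Arr C \<and>
     (\<forall>g \<in> Arr C. \<forall>h \<in> Arr C. Dom C g = Cod C f \<and> Dom C h = Cod C f \<and> Cod C g = Cod C h \<and>
        Comp C g f = Comp C h f \<longrightarrow> g = h)"

definition zero_object :: "('o, 'm) preadd_cat \<Rightarrow> 'o \<Rightarrow> bool" where
  "zero_object C Z \<longleftrightarrow> Z \<in> Obj C \<and>
     (\<forall>A \<in> Obj C. (\<exists>!f. f \<in> Hom C A Z) \<and> (\<exists>!f. f \<in> Hom C Z A))"

definition is_biproduct ::
  "('o, 'm) preadd_cat \<Rightarrow> 'o \<Rightarrow> 'o \<Rightarrow> 'o \<Rightarrow> 'm \<Rightarrow> 'm \<Rightarrow> 'm \<Rightarrow> 'm \<Rightarrow> bool" where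
  "is_biproduct C A B P i1 i2 p1 p2 \<longleftrightarrow>
     i1 \<in> Hom C A P \<and> i2 \<in> Hom C B P \<and> p1 \<in> Hom C P A \<and> p2 \<in> Hom C P B \<and>
     Comp C p1 i1 = Ident C A \<and> Comp C p2 i2 = Ident C B \<and>
     Comp C p1 i2 = Zero C B A \<and> Comp C p2 i1 = Zero C A B \<and>
     Plus C (Comp C i1 p1) (Comp C i2 p2) = Ident C P"

definition is_kernel :: "('o, 'm) preadd_cat \<Rightarrow> 'm \<Rightarrow> 'm \<Rightarrow> bool" where
  "is_kernel C f k \<longleftrightarrow> f \<in> Arr C \<and> k \<in> Arr C \<and> Cod C k = Dom C f \<and>
     Comp C f k = Zero C (Dom C k) (Cod C f) \<and>
     (\<forall>h \<in> Arr C. Cod C h = Dom C f \<and> Comp C f h = Zero C (Dom C h) (Cod C f) \<longrightarrow>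
        (\<exists>!u. u \<in> Hom C (Dom C h) (Dom C k) \<and> Comp C k u = h))"

definition is_cokernel :: "('o, 'm) preadd_cat \<Rightarrow> 'm \<Rightarrow> 'm \<Rightarrow> bool" where
  "is_cokernel C f p \<longleftrightarrow> f \<in> Arr C \<and> p \<in> Arr C \<and> Dom C p = Cod C f \<and>
     Comp C p f = Zero C (Dom C f) (Cod C p) \<and>
     (\<forall>h \<in> Arr C. Dom C h = Cod C f \<and> Comp C h f = Zero C (Dom C f) (Cod C h) \<longrightarrow>
        (\<exists>!u. u \<in> Hom C (Cod C p) (Cod C h) \<and> Comp C u p = h))"

locale category =
  fixes C :: "('o, 'm) preadd_cat"
  assumes Dom_Obj: "f \<in> Arr C \<Longrightarrow> Dom C f \<in> Obj C"
    and Cod_Obj: "f \<in> Arr C \<Longrightarrow> Cod C f \<in> Obj C"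
    and Ident_Hom: "A \<in> Obj C \<Longrightarrow> Ident C A \<in> Hom C A A"
    and Comp_Hom: "f \<in> Hom C A B \<Longrightarrow> g \<in> Hom C B D \<Longrightarrow> Comp C g f \<in> Hom C A D"
    and Comp_Ident_left: "f \<in> Hom C A B \<Longrightarrow> Comp C (Ident C B) f = f"
    and Comp_Ident_right: "f \<in> Hom C A B \<Longrightarrow> Comp C f (Ident C A) = f"
    and Comp_assoc: "f \<in> Hom C A B \<Longrightarrow> g \<in> Hom C B D \<Longrightarrow> h \<in> Hom C D E \<Longrightarrow>
      Comp C (Comp C h g) f = Comp C h (Comp C g f)"

locale preadditive_category = category +
  assumes hom_comm_group: "A \<in> Obj C \<Longrightarrow> B \<in> Obj C \<Longrightarrow> comm_group (hom_group C A B)"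
    and Comp_Plus_left: "f \<in> Hom C A B \<Longrightarrow> g \<in> Hom C B D \<Longrightarrow> h \<in> Hom C B D \<Longrightarrow>
      Comp C (Plus C g h) f = Plus C (Comp C g f) (Comp C h f)"
    and Comp_Plus_right: "f \<in> Hom C A B \<Longrightarrow> g \<in> Hom C A B \<Longrightarrow> h \<in> Hom C B D \<Longrightarrow>
      Comp C h (Plus C f g) = Plus C (Comp C h f) (Comp C h g)"

locale additive_category = preadditive_category +
  assumes zero_object_exists: "\<exists>Z. zero_object C Z"
    and biproduct_exists: "A \<in> Obj C \<Longrightarrow> B \<in> Obj C \<Longrightarrow>
      \<exists>P i1 i2 p1 p2. is_biproduct C A B P i1 i2 p1 p2"

locale abelian_category = additive_category +
  assumes kernel_exists: "f \<in> Arr C \<Longrightarrow> \<exists>k. is_kernel C f k"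
    and cokernel_exists: "f \<in> Arr C \<Longrightarrow> \<exists>p. is_cokernel C f p"
    and monic_is_kernel: "monic C k \<Longrightarrow> \<exists>f. is_kernel C f k"
    and epic_is_cokernel: "epic C p \<Longrightarrow> \<exists>f. is_cokernel C f p"

definition full_subcategory ::
  "('o, 'm) preadd_cat \<Rightarrow> 'o set \<Rightarrow> ('o, 'm) preadd_cat" where
  "full_subcategory C P =
     C\<lparr>Obj := Obj C \<inter> P, Arr := {f \<in> Arr C. Dom C f \<in> P \<and> Cod C f \<in> P}\<rparr>"

text \<open>The image is the kernel of the cokernel; \<open>im_mono C f\<close> is a chosen representative,
  depending on \<open>f\<close> only, and \<open>im_epi C f\<close> is the corestriction of \<open>f\<close> to it.\<close>

definition is_image :: "('o, 'm) preadd_cat \<Rightarrow> 'm \<Rightarrow> 'm \<Rightarrow> bool" where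
  "is_image C f m \<longleftrightarrow> (\<exists>p. is_cokernel C f p \<and> is_kernel C p m)"

definition im_mono :: "('o, 'm) preadd_cat \<Rightarrow> 'm \<Rightarrow> 'm" where
  "im_mono C f = (SOME m. is_image C f m)"

definition im_obj :: "('o, 'm) preadd_cat \<Rightarrow> 'm \<Rightarrow> 'o" where
  "im_obj C f = Dom C (im_mono C f)"

definition im_epi :: "('o, 'm) preadd_cat \<Rightarrow> 'm \<Rightarrow> 'm" where
  "im_epi C f = (THE e. e \<in> Hom C (Dom C f) (im_obj C f) \<and> Comp C (im_mono C f) e = f)"

text \<open>The arrow \<open>Im f \<rightarrow> Im f'\<close> induced by an arrow \<open>b\<close> between the codomains of \<open>f\<close> and \<open>f'\<close>
  (which is part of a commutative square from \<open>f\<close> to \<open>f'\<close>).\<close>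

definition im_map :: "('o, 'm) preadd_cat \<Rightarrow> 'm \<Rightarrow> 'm \<Rightarrow> 'm \<Rightarrow> 'm" where
  "im_map C f f' b = (THE u. u \<in> Hom C (im_obj C f) (im_obj C f') \<and>
     Comp C (im_mono C f') u = Comp C b (im_mono C f))"

definition zero_obj :: "('o, 'm) preadd_cat \<Rightarrow> 'o" where
  "zero_obj C = (SOME Z. zero_object C Z)"


section \<open>Localization by right fractions\<close>

text \<open>A roof from \<open>X\<close> to \<open>Y\<close> is a pair \<open>(s, f)\<close> with \<open>s : Z \<rightarrow> X\<close> in \<open>S\<close> and \<open>f : Z \<rightarrow> Y\<close>; it
  stands for the fraction \<open>f s\<^sup>-\<^sup>1\<close>. An arrow of the localization is a triple consisting of its
  domain, its codomain and an equivalence class of roofs. The operations on classes are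
  defined by all possible choices of representatives (and of completions to commutative
  squares); this is the usual construction when \<open>S\<close> is a multiplicative system admitting a
  calculus of right fractions.\<close>

type_synonym ('o, 'm) larrow = "'o \<times> 'o \<times> ('m \<times> 'm) set"

definition roofs :: "('o, 'm) preadd_cat \<Rightarrow> 'm set \<Rightarrow> 'o \<Rightarrow> 'o \<Rightarrow> ('m \<times> 'm) set" where
  "roofs C S X Y = {(s, f). s \<in> S \<inter> Arr C \<and> f \<in> Arr C \<and> Dom C s = Dom C f \<and>
     Cod C s = X \<and> Cod C f = Y}"

definition roof_eq :: "('o, 'm) preadd_cat \<Rightarrow> 'm set \<Rightarrow> 'm \<times> 'm \<Rightarrow> 'm \<times> 'm \<Rightarrow> bool" where
  "roof_eq C S r r' \<longleftrightarrow> (\<exists>a \<in> Arr C. \<exists>b \<in> Arr C. Dom C a = Dom C b \<and>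
     Cod C a = Dom C (fst r) \<and> Cod C b = Dom C (fst r') \<and>
     Comp C (fst r) a = Comp C (fst r') b \<and> Comp C (fst r) a \<in> S \<and>
     Comp C (snd r) a = Comp C (snd r') b)"

definition roof_class ::
  "('o, 'm) preadd_cat \<Rightarrow> 'm set \<Rightarrow> 'o \<Rightarrow> 'o \<Rightarrow> 'm \<times> 'm \<Rightarrow> ('m \<times> 'm) set" where
  "roof_class C S X Y r = {q \<in> roofs C S X Y. roof_eq C S r q}"

definition loc_comp ::
  "('o, 'm) preadd_cat \<Rightarrow> 'm set \<Rightarrow> ('o, 'm) larrow \<Rightarrow> ('o, 'm) larrow \<Rightarrow> ('o, 'm) larrow" where
  "loc_comp C S = (\<lambda>(_, Z, G) (X, _, F). (X, Z, {q \<in> roofs C S X Z.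
     \<exists>(s, f) \<in> F. \<exists>(t, g) \<in> G. \<exists>u \<in> S \<inter> Arr C. \<exists>h \<in> Arr C.
       Dom C u = Dom C h \<and> Cod C u = Dom C s \<and> Cod C h = Dom C t \<and>
       Comp C f u = Comp C t h \<and> roof_eq C S (Comp C s u, Comp C g h) q}))"

definition loc_plus ::
  "('o, 'm) preadd_cat \<Rightarrow> 'm set \<Rightarrow> ('o, 'm) larrow \<Rightarrow> ('o, 'm) larrow \<Rightarrow> ('o, 'm) larrow" where
  "loc_plus C S = (\<lambda>(X, Y, F) (_, _, G). (X, Y, {q \<in> roofs C S X Y.
     \<exists>s f g. (s, f) \<in> F \<and> (s, g) \<in> G \<and> roof_eq C S (s, Plus C f g) q}))"

definition localization ::
  "('o, 'm) preadd_cat \<Rightarrow> 'm set \<Rightarrow> ('o, ('o, 'm) larrow) preadd_cat" where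
  "localization C S = \<lparr>
     Obj = Obj C,
     Arr = {(X, Y, roof_class C S X Y r) | X Y r. X \<in> Obj C \<and> Y \<in> Obj C \<and> r \<in> roofs C S X Y},
     Dom = (\<lambda>(X, Y, F). X),
     Cod = (\<lambda>(X, Y, F). Y),
     Ident = (\<lambda>X. (X, X, roof_class C S X X (Ident C X, Ident C X))),
     Comp = loc_comp C S,
     Plus = loc_plus C S,
     Zero = (\<lambda>X Y. (X, Y, roof_class C S X Y (Ident C X, Zero C X Y)))\<rparr>"

definition loc_arrow :: "('o, 'm) preadd_cat \<Rightarrow> 'm set \<Rightarrow> 'm \<Rightarrow> ('o, 'm) larrow" where
  "loc_arrow C S f =
     (Dom C f, Cod C f, roof_class C S (Dom C f) (Cod C f) (Ident C (Dom C f), f))"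

record ('o, 'm, 'p, 'n) fctr =
  on_obj :: "'o \<Rightarrow> 'p"
  on_arr :: "'m \<Rightarrow> 'n"

text \<open>The functor from a localization of the source of \<open>F\<close> to the localization of \<open>C'\<close> at \<open>S'\<close>
  induced by a functor \<open>F\<close> to \<open>C'\<close> which maps the inverted arrows into \<open>S'\<close>.\<close>

definition loc_functor ::
  "('o, 'm, 'p, 'n) fctr \<Rightarrow> ('p, 'n) preadd_cat \<Rightarrow> 'n set \<Rightarrow>
   ('o, ('o, 'm) larrow, 'p, ('p, 'n) larrow) fctr" where
  "loc_functor F C' S' = \<lparr>
     on_obj = on_obj F,
     on_arr = (\<lambda>(X, Y, R). (on_obj F X, on_obj F Y,
       {q \<in> roofs C' S' (on_obj F X) (on_obj F Y).
          \<exists>(s, f) \<in> R. roof_eq C' S' (on_arr F s, on_arr F f) q}))\<rparr>"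


section \<open>Complexes and the homotopy category\<close>

record ('o, 'm) cochain =
  ob :: "int \<Rightarrow> 'o"
  df :: "int \<Rightarrow> 'm"

definition is_complex :: "('o, 'm) preadd_cat \<Rightarrow> ('o, 'm) cochain \<Rightarrow> bool" where
  "is_complex C X \<longleftrightarrow> (\<forall>n. df X n \<in> Hom C (ob X n) (ob X (n + 1)) \<and>
     Comp C (df X (n + 1)) (df X n) = Zero C (ob X n) (ob X (n + 2)))"

definition chain_map ::
  "('o, 'm) preadd_cat \<Rightarrow> ('o, 'm) cochain \<Rightarrow> ('o, 'm) cochain \<Rightarrow> (int \<Rightarrow> 'm) \<Rightarrow> bool" where
  "chain_map C X Y \<phi> \<longleftrightarrow> (\<forall>n. \<phi> n \<in> Hom C (ob X n) (ob Y n) \<and>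
     Comp C (\<phi> (n + 1)) (df X n) = Comp C (df Y n) (\<phi> n))"

definition homotopic ::
  "('o, 'm) preadd_cat \<Rightarrow> ('o, 'm) cochain \<Rightarrow> ('o, 'm) cochain \<Rightarrow>
   (int \<Rightarrow> 'm) \<Rightarrow> (int \<Rightarrow> 'm) \<Rightarrow> bool" where
  "homotopic C X Y \<phi> \<psi> \<longleftrightarrow> (\<exists>h. \<forall>n. h n \<in> Hom C (ob X n) (ob Y (n - 1)) \<and>
     \<phi> n = Plus C (\<psi> n) (Plus C (Comp C (df Y (n - 1)) (h n)) (Comp C (h (n + 1)) (df X n))))"

text \<open>An arrow of the homotopy category consists of domain, codomain and homotopy class.\<close>

type_synonym ('o, 'm) karrow =
  "('o, 'm) cochain \<times> ('o, 'm) cochain \<times> (int \<Rightarrow> 'm) set"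

definition htpy_arrow ::
  "('o, 'm) preadd_cat \<Rightarrow> ('o, 'm) cochain \<Rightarrow> ('o, 'm) cochain \<Rightarrow> (int \<Rightarrow> 'm) \<Rightarrow>
   ('o, 'm) karrow" where
  "htpy_arrow C X Y \<phi> = (X, Y, {\<psi>. chain_map C X Y \<psi> \<and> homotopic C X Y \<phi> \<psi>})"

definition K_cat ::
  "('o, 'm) preadd_cat \<Rightarrow> (('o, 'm) cochain, ('o, 'm) karrow) preadd_cat" where
  "K_cat C = \<lparr>
     Obj = {X. is_complex C X},
     Arr = {htpy_arrow C X Y \<phi> | X Y \<phi>. is_complex C X \<and> is_complex C Y \<and> chain_map C X Y \<phi>},
     Dom = (\<lambda>(X, Y, F). X),
     Cod = (\<lambda>(X, Y, F). Y),
     Ident = (\<lambda>X. htpy_arrow C X X (\<lambda>n. Ident C (ob X n))),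
     Comp = (\<lambda>(_, Z, G) (X, _, F). (X, Z, {\<theta>. chain_map C X Z \<theta> \<and>
       (\<exists>\<phi> \<in> F. \<exists>\<gamma> \<in> G. homotopic C X Z (\<lambda>n. Comp C (\<gamma> n) (\<phi> n)) \<theta>)})),
     Plus = (\<lambda>(X, Y, F) (_, _, G). (X, Y, {\<theta>. chain_map C X Y \<theta> \<and>
       (\<exists>\<phi> \<in> F. \<exists>\<gamma> \<in> G. homotopic C X Y (\<lambda>n. Plus C (\<phi> n) (\<gamma> n)) \<theta>)})),
     Zero = (\<lambda>X Y. htpy_arrow C X Y (\<lambda>n. Zero C (ob X n) (ob Y n)))\<rparr>"

text \<open>\<open>H\<close> is a cohomology object of \<open>X\<close> in degree \<open>n\<close>: it is the cokernel of the arrow \<open>u\<close> from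
  \<open>X\<^sup>n\<^sup>-\<^sup>1\<close> to the kernel of \<open>d\<^sup>n\<close> that is induced by \<open>d\<^sup>n\<^sup>-\<^sup>1\<close>.\<close>

definition is_cohomology ::
  "('o, 'm) preadd_cat \<Rightarrow> ('o, 'm) cochain \<Rightarrow> int \<Rightarrow> 'o \<Rightarrow> bool" where
  "is_cohomology C X n H \<longleftrightarrow> (\<exists>k u p. is_kernel C (df X n) k \<and>
     u \<in> Hom C (ob X (n - 1)) (Dom C k) \<and> Comp C k u = df X (n - 1) \<and>
     is_cokernel C u p \<and> Cod C p = H)"

definition cohomology_zero ::
  "('o, 'm) preadd_cat \<Rightarrow> ('o, 'm) cochain \<Rightarrow> int \<Rightarrow> bool" where
  "cohomology_zero C X n \<longleftrightarrow> (\<exists>H. is_cohomology C X n H \<and> zero_object C H)"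

definition right_bounded :: "('o, 'm) preadd_cat \<Rightarrow> ('o, 'm) cochain \<Rightarrow> bool" where
  "right_bounded C X \<longleftrightarrow> (\<exists>N. \<forall>n > N. zero_object C (ob X n))"

definition bounded_cohomology :: "('o, 'm) preadd_cat \<Rightarrow> ('o, 'm) cochain \<Rightarrow> bool" where
  "bounded_cohomology C X \<longleftrightarrow> (\<exists>M N. \<forall>n. n < M \<or> N < n \<longrightarrow> cohomology_zero C X n)"

definition exact_complex :: "('o, 'm) preadd_cat \<Rightarrow> ('o, 'm) cochain \<Rightarrow> bool" where
  "exact_complex C X \<longleftrightarrow> (\<forall>n. cohomology_zero C X n)"

text \<open>Homotopy equivalence is isomorphism in the homotopy category.\<close>

definition K_minus_obj :: "('o, 'm) preadd_cat \<Rightarrow> ('o, 'm) cochain set" where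
  "K_minus_obj C = {X. \<exists>Y. is_complex C Y \<and> right_bounded C Y \<and> isomorphic (K_cat C) X Y}"

definition K_minus_b_obj :: "('o, 'm) preadd_cat \<Rightarrow> ('o, 'm) cochain set" where
  "K_minus_b_obj C = {X. \<exists>Y. is_complex C Y \<and> right_bounded C Y \<and> bounded_cohomology C Y \<and>
     isomorphic (K_cat C) X Y}"

definition K_minus_empty_obj :: "('o, 'm) preadd_cat \<Rightarrow> ('o, 'm) cochain set" where
  "K_minus_empty_obj C = {X. \<exists>Y. is_complex C Y \<and> right_bounded C Y \<and> exact_complex C Y \<and>
     isomorphic (K_cat C) X Y}"

definition K_minus ::
  "('o, 'm) preadd_cat \<Rightarrow> (('o, 'm) cochain, ('o, 'm) karrow) preadd_cat" where
  "K_minus C = full_subcategory (K_cat C) (K_minus_obj C)"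


section \<open>Verdier quotients of the right bounded homotopy category\<close>

text \<open>\<open>Z\<close> is a mapping cone of \<open>\<phi> : X \<rightarrow> Y\<close>: \<open>Z\<^sup>n\<close> is a biproduct of \<open>X\<^sup>n\<^sup>+\<^sup>1\<close> and \<open>Y\<^sup>n\<close>, and the
  differential sends \<open>(x, y)\<close> to \<open>(- d x, \<phi> x + d y)\<close>.\<close>

definition is_mapping_cone ::
  "('o, 'm) preadd_cat \<Rightarrow> ('o, 'm) cochain \<Rightarrow> ('o, 'm) cochain \<Rightarrow> (int \<Rightarrow> 'm) \<Rightarrow>
   ('o, 'm) cochain \<Rightarrow> bool" where
  "is_mapping_cone C X Y \<phi> Z \<longleftrightarrow> is_complex C Z \<and>
     (\<exists>i1 i2 p1 p2. \<forall>n.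
        is_biproduct C (ob X (n + 1)) (ob Y n) (ob Z n) (i1 n) (i2 n) (p1 n) (p2 n) \<and>
        df Z n =
          Plus C (Comp C (i1 (n + 1)) (Comp C (Neg C (df X (n + 1))) (p1 n)))
            (Comp C (i2 (n + 1))
              (Plus C (Comp C (\<phi> (n + 1)) (p1 n)) (Comp C (df Y n) (p2 n)))))"

text \<open>The arrows inverted in the quotient by the full subcategory on \<open>N\<close>. Mapping cones are
  unique up to isomorphism in the homotopy category, and the \<open>N\<close> used below are closed under
  isomorphism, so the choices of \<open>\<phi>\<close> and \<open>Z\<close> are immaterial.\<close>

definition cone_in ::
  "('o, 'm) preadd_cat \<Rightarrow> ('o, 'm) cochain set \<Rightarrow> ('o, 'm) karrow set" where
  "cone_in C N = {(X, Y, F). (X, Y, F) \<in> Arr (K_minus C) \<and>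
     (\<exists>\<phi> \<in> F. \<exists>Z \<in> N. is_mapping_cone C X Y \<phi> Z)}"

type_synonym ('o, 'm) darrow = "(('o, 'm) cochain, ('o, 'm) karrow) larrow"

definition verdier_quotient ::
  "('o, 'm) preadd_cat \<Rightarrow> ('o, 'm) cochain set \<Rightarrow>
   (('o, 'm) cochain, ('o, 'm) darrow) preadd_cat" where
  "verdier_quotient C N = localization (K_minus C) (cone_in C N)"

definition D_minus ::
  "('o, 'm) preadd_cat \<Rightarrow> (('o, 'm) cochain, ('o, 'm) darrow) preadd_cat" where
  "D_minus C = verdier_quotient C (K_minus_empty_obj C)"

definition D_minus_inf ::
  "('o, 'm) preadd_cat \<Rightarrow> (('o, 'm) cochain, ('o, 'm) darrow) preadd_cat" where
  "D_minus_inf C = verdier_quotient C (K_minus_b_obj C)"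

text \<open>The canonical functor from \<open>D_minus C\<close> to \<open>D_minus_inf C\<close>, induced by the identity functor.\<close>

definition quot_G ::
  "('o, 'm) preadd_cat \<Rightarrow>
   (('o, 'm) cochain, ('o, 'm) darrow, ('o, 'm) cochain, ('o, 'm) darrow) fctr" where
  "quot_G C = loc_functor \<lparr>on_obj = (\<lambda>X. X), on_arr = (\<lambda>f. f)\<rparr>
     (K_minus C) (cone_in C (K_minus_b_obj C))"


section \<open>Intelligent truncation\<close>

definition trunc_ob :: "('o, 'm) preadd_cat \<Rightarrow> int \<Rightarrow> ('o, 'm) cochain \<Rightarrow> int \<Rightarrow> 'o" where
  "trunc_ob C n X i =
     (if i \<le> n then ob X i else if i = n + 1 then im_obj C (df X n) else zero_obj C)"

definition trunc :: "('o, 'm) preadd_cat \<Rightarrow> int \<Rightarrow> ('o, 'm) cochain \<Rightarrow> ('o, 'm) cochain" where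
  "trunc C n X = \<lparr>
     ob = trunc_ob C n X,
     df = (\<lambda>i. if i < n then df X i
               else if i = n then im_epi C (df X n)
               else Zero C (trunc_ob C n X i) (trunc_ob C n X (i + 1)))\<rparr>"

definition trunc_map ::
  "('o, 'm) preadd_cat \<Rightarrow> int \<Rightarrow> ('o, 'm) cochain \<Rightarrow> ('o, 'm) cochain \<Rightarrow> (int \<Rightarrow> 'm) \<Rightarrow>
   int \<Rightarrow> 'm" where
  "trunc_map C n X Y \<phi> = (\<lambda>i. if i \<le> n then \<phi> i
     else if i = n + 1 then im_map C (df X n) (df Y n) (\<phi> (n + 1))
     else Zero C (zero_obj C) (zero_obj C))"

definition trunc_incl :: "('o, 'm) preadd_cat \<Rightarrow> int \<Rightarrow> ('o, 'm) cochain \<Rightarrow> int \<Rightarrow> 'm" where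
  "trunc_incl C n X = (\<lambda>i. if i \<le> n then Ident C (ob X i)
     else if i = n + 1 then im_mono C (df X n)
     else Zero C (zero_obj C) (ob X i))"

definition trunc_K ::
  "('o, 'm) preadd_cat \<Rightarrow> int \<Rightarrow>
   (('o, 'm) cochain, ('o, 'm) karrow, ('o, 'm) cochain, ('o, 'm) karrow) fctr" where
  "trunc_K C n = \<lparr>
     on_obj = trunc C n,
     on_arr = (\<lambda>(X, Y, F). (trunc C n X, trunc C n Y,
       {\<psi>. chain_map C (trunc C n X) (trunc C n Y) \<psi> \<and>
          (\<exists>\<phi> \<in> F. homotopic C (trunc C n X) (trunc C n Y) (trunc_map C n X Y \<phi>) \<psi>)}))\<rparr>"

definition trunc_D ::
  "('o, 'm) preadd_cat \<Rightarrow> int \<Rightarrow>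
   (('o, 'm) cochain, ('o, 'm) darrow, ('o, 'm) cochain, ('o, 'm) darrow) fctr" where
  "trunc_D C n = loc_functor (trunc_K C n) (K_minus C) (cone_in C (K_minus_empty_obj C))"

text \<open>This is an equality on the nose because the chosen image depends on the differential only.
  It makes \<open>trunc_D C (n - 1)\<close> map \<open>Hom(\<sigma>\<^sub>n X, \<sigma>\<^sub>n Y)\<close> to \<open>Hom(\<sigma>\<^sub>n\<^sub>-\<^sub>1 X, \<sigma>\<^sub>n\<^sub>-\<^sub>1 Y)\<close>.\<close>

lemma trunc_trunc: "trunc C (n - 1) (trunc C n X) = trunc C (n - 1) X"
proof -
  have "trunc_ob C (n - 1) (trunc C n X) = trunc_ob C (n - 1) X"
    by (rule ext) (simp add: trunc_ob_def trunc_def)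
  then show ?thesis
    by (auto simp add: trunc_def)
qed


section \<open>Colimits of inductive systems of abelian groups indexed by decreasing integers\<close>

text \<open>The system consists of groups \<open>A n\<close> and maps \<open>t n\<close> from \<open>A n\<close> to \<open>A (n - 1)\<close>;
  \<open>steps t n k\<close> is the composite transition map from \<open>A n\<close> to \<open>A (n - k)\<close>.\<close>

primrec steps :: "(int \<Rightarrow> 'a \<Rightarrow> 'a) \<Rightarrow> int \<Rightarrow> nat \<Rightarrow> 'a \<Rightarrow> 'a" where
  "steps t n 0 x = x"
| "steps t n (Suc k) x = t (n - int k) (steps t n k x)"

definition colim_rel ::
  "(int \<Rightarrow> 'a monoid) \<Rightarrow> (int \<Rightarrow> 'a \<Rightarrow> 'a) \<Rightarrow> ((int \<times> 'a) \<times> (int \<times> 'a)) set" where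
  "colim_rel A t = {((n, x), (m, y)). x \<in> carrier (A n) \<and> y \<in> carrier (A m) \<and>
     (\<exists>k l. n - int k = m - int l \<and> steps t n k x = steps t m l y)}"

definition colim_group ::
  "(int \<Rightarrow> 'a monoid) \<Rightarrow> (int \<Rightarrow> 'a \<Rightarrow> 'a) \<Rightarrow> (int \<times> 'a) set monoid" where
  "colim_group A t = \<lparr>
     carrier = (SIGMA n : UNIV. carrier (A n)) // colim_rel A t,
     mult = (\<lambda>P Q. {q. \<exists>n x y. (n, x) \<in> P \<and> (n, y) \<in> Q \<and>
                        ((n, x \<otimes>\<^bsub>A n\<^esub> y), q) \<in> colim_rel A t}),
     one = {q. \<exists>n. ((n, \<one>\<^bsub>A n\<^esub>), q) \<in> colim_rel A t}\<rparr>"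


section \<open>The natural map\<close>

definition trunc_hom_system ::
  "('o, 'm) preadd_cat \<Rightarrow> ('o, 'm) cochain \<Rightarrow> ('o, 'm) cochain \<Rightarrow>
   int \<Rightarrow> ('o, 'm) darrow monoid" where
  "trunc_hom_system C X Y = (\<lambda>n. hom_group (D_minus C) (trunc C n X) (trunc C n Y))"

definition trunc_transition ::
  "('o, 'm) preadd_cat \<Rightarrow> int \<Rightarrow> ('o, 'm) darrow \<Rightarrow> ('o, 'm) darrow" where
  "trunc_transition C = (\<lambda>n. on_arr (trunc_D C (n - 1)))"

definition incl_inf ::
  "('o, 'm) preadd_cat \<Rightarrow> int \<Rightarrow> ('o, 'm) cochain \<Rightarrow> ('o, 'm) darrow" where
  "incl_inf C n X = loc_arrow (K_minus C) (cone_in C (K_minus_b_obj C))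
     (htpy_arrow C (trunc C n X) X (trunc_incl C n X))"

definition natural_component ::
  "('o, 'm) preadd_cat \<Rightarrow> ('o, 'm) cochain \<Rightarrow> ('o, 'm) cochain \<Rightarrow> int \<Rightarrow>
   ('o, 'm) darrow \<Rightarrow> ('o, 'm) darrow" where
  "natural_component C X Y n f =
     Comp (D_minus_inf C) (incl_inf C n Y)
       (Comp (D_minus_inf C) (on_arr (quot_G C) f)
         (inv_arr (D_minus_inf C) (incl_inf C n X)))"

text \<open>\<open>P\<close> is a class in the colimit, on which the components take one and the same value.\<close>

definition natural_map ::
  "('o, 'm) preadd_cat \<Rightarrow> ('o, 'm) cochain \<Rightarrow> ('o, 'm) cochain \<Rightarrow>
   (int \<times> ('o, 'm) darrow) set \<Rightarrow> ('o, 'm) darrow" where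
  "natural_map C X Y P = the_elem ((\<lambda>(n, f). natural_component C X Y n f) ` P)"

end

theory Submission
  imports Defs
begin

text \<open>
  An arrow of either quotient is a right fraction \<open>f s\<^sup>-\<^sup>1\<close> of arrows of the homotopy
  category, where \<open>s\<close> is a quasi-isomorphism in all degrees, respectively in all
  sufficiently small degrees. The component of the natural map at \<open>n\<close> sends \<open>f s\<^sup>-\<^sup>1\<close>
  to \<open>(i\<^sub>n f) (i\<^sub>n s)\<^sup>-\<^sup>1\<close>, where \<open>i\<^sub>n\<close> denotes the inclusions of the truncations
  \<open>\<sigma>\<^sub>n X\<close> and \<open>\<sigma>\<^sub>n Y\<close>. If \<open>s\<close> is a quasi-isomorphism in degrees at most \<open>n\<close>,
  then \<open>\<sigma>\<^sub>n s\<close> is one in all degrees, so a fraction \<open>f s\<^sup>-\<^sup>1\<close> from \<open>X\<close> to \<open>Y\<close>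
  is the image of \<open>(\<sigma>\<^sub>n f) (\<sigma>\<^sub>n s)\<^sup>-\<^sup>1\<close>; this is surjectivity. For injectivity,
  apply \<open>\<sigma>\<^sub>m\<close> with \<open>m\<close> small to an equality of the roofs \<open>(i\<^sub>n s, i\<^sub>n f)\<close> and
  \<open>(i\<^sub>n t, i\<^sub>n g)\<close>: as \<open>\<sigma>\<^sub>m i\<^sub>n\<close> is an identity for \<open>m < n\<close>, it becomes an equality
  of \<open>(\<sigma>\<^sub>m f) (\<sigma>\<^sub>m s)\<^sup>-\<^sup>1\<close> and \<open>(\<sigma>\<^sub>m g) (\<sigma>\<^sub>m t)\<^sup>-\<^sup>1\<close>.
\<close>

text \<open>Both quotients invert arrows whose mapping cones lie in a subcategory given only up to
  homotopy equivalence, a condition that says nothing about single degrees. It is therefore made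
  degreewise: \<open>qis_at\<close> in degree \<open>n\<close> is exactness of the cone in degree
  \<open>n\<close>, phrased with generalized elements. Arrows of both quotients then have
  denominators in one class \<open>qis_class F\<close>, with \<open>F\<close> the filter
  \<open>top\<close> or \<open>at_bot\<close>, and the calculus of right fractions is established
  once for both.

  For \<open>at_bot\<close> the threshold depends on the arrow, and this is what the colimit
  absorbs: a fraction, or an equality of two fractions, involves finitely many arrows of the
  homotopy category, so one sufficiently low truncation turns the relevant denominators into
  quasi-isomorphisms in all degrees. Truncation is strictly functorial on complexes and chain maps,
  so it can be applied directly to roofs and to the arrows that witness their equivalence.\<close>

hide_const (open) Order.top

section \<open>A ring representation of preadditive categories\<close>

text \<open>A \<open>'m univ_elt\<close> picks an element from every abelian group structure on subsets of \<open>'m\<close>. These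
  form an abelian group in the sense of type classes, whose additive endomorphisms contain a
  faithful copy of the arrows of every preadditive category with arrows in \<open>'m\<close>. Equations between
  arrows thereby become equations in a type of class \<open>ring\<close>, without any side conditions.\<close>

typedef 'm univ_elt =
  "{v :: 'm monoid \<Rightarrow> 'm. \<forall>G. if comm_group G then v G \<in> carrier G else v G = undefined}"
  morphisms component Abs_univ_elt
proof
  show "(\<lambda>G. if comm_group G then \<one>\<^bsub>G\<^esub> else undefined) \<in>
    {v :: 'm monoid \<Rightarrow> 'm. \<forall>G. if comm_group G then v G \<in> carrier G else v G = undefined}"
    by (auto simp: comm_group_def comm_monoid_def monoid.one_closed)
qed

setup_lifting type_definition_univ_elt

lemma component_in: "comm_group G \<Longrightarrow> component v G \<in> carrier G"
  using component[of v] by (auto split: if_splits)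

lemma comm_group_basics:
  assumes "comm_group G"
  shows "monoid G" "group G" "comm_monoid G"
  using assms by (auto simp: comm_group_def group_def)

instantiation univ_elt :: (type) ab_group_add
begin

lift_definition zero_univ_elt :: "'m univ_elt" is
  "\<lambda>G. if comm_group G then \<one>\<^bsub>G\<^esub> else undefined"
  by (auto simp: comm_group_basics monoid.one_closed)

lift_definition plus_univ_elt :: "'m univ_elt \<Rightarrow> 'm univ_elt \<Rightarrow> 'm univ_elt" is
  "\<lambda>v w G. if comm_group G then v G \<otimes>\<^bsub>G\<^esub> w G else undefined"
  by (auto simp: comm_group_basics monoid.m_closed split: if_splits)

lift_definition uminus_univ_elt :: "'m univ_elt \<Rightarrow> 'm univ_elt" is
  "\<lambda>v G. if comm_group G then inv\<^bsub>G\<^esub> (v G) else undefined"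
  by (auto simp: comm_group_basics group.inv_closed split: if_splits)

definition minus_univ_elt :: "'m univ_elt \<Rightarrow> 'm univ_elt \<Rightarrow> 'm univ_elt" where
  "minus_univ_elt v w = v + - w"

instance
proof
  fix a b c :: "'m univ_elt"
  show "a + b + c = a + (b + c)"
    by (transfer, rule ext) (auto simp: comm_group_basics monoid.m_assoc split: if_splits)
  show "a + b = b + a"
    by (transfer, rule ext) (auto simp: comm_group_basics comm_monoid.m_comm split: if_splits)
  show "0 + a = a"
    by (transfer, rule ext) (auto simp: comm_group_basics monoid.l_one split: if_splits)
  show "- a + a = 0"
    by (transfer, rule ext) (auto simp: comm_group_basics group.l_inv split: if_splits)
  show "a - b = a + - b"
    by (simp add: minus_univ_elt_def)
qed

end

typedef 'm univ_endo = "{\<phi> :: 'm univ_elt \<Rightarrow> 'm univ_elt. \<forall>v w. \<phi> (v + w) = \<phi> v + \<phi> w}"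
  morphisms apply_endo Abs_univ_endo
  by (rule exI[of _ "\<lambda>v. v"]) simp

setup_lifting type_definition_univ_endo

instantiation univ_endo :: (type) ring
begin

lift_definition zero_univ_endo :: "'m univ_endo" is "\<lambda>v. 0" by simp
lift_definition plus_univ_endo :: "'m univ_endo \<Rightarrow> 'm univ_endo \<Rightarrow> 'm univ_endo" is
  "\<lambda>\<phi> \<psi> v. \<phi> v + \<psi> v" by (simp add: algebra_simps)
lift_definition minus_univ_endo :: "'m univ_endo \<Rightarrow> 'm univ_endo \<Rightarrow> 'm univ_endo" is
  "\<lambda>\<phi> \<psi> v. \<phi> v - \<psi> v" by (simp add: algebra_simps)
lift_definition uminus_univ_endo :: "'m univ_endo \<Rightarrow> 'm univ_endo" is
  "\<lambda>\<phi> v. - \<phi> v" by simp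
lift_definition times_univ_endo :: "'m univ_endo \<Rightarrow> 'm univ_endo \<Rightarrow> 'm univ_endo" is
  "\<lambda>\<phi> \<psi> v. \<phi> (\<psi> v)" by simp

instance
  by standard (transfer; simp add: algebra_simps)+

end

section \<open>Typing rules for composition, identities, sums and negatives\<close>

context category
begin

abbreviation (input) arr where "arr f \<equiv> f \<in> Arr C"
abbreviation (input) dom where "dom \<equiv> Dom C"
abbreviation (input) cod where "cod \<equiv> Cod C"

lemma Hom_iff: "f \<in> Hom C A B \<longleftrightarrow> arr f \<and> dom f = A \<and> cod f = B"
  by (simp add: Hom_def)

lemma HomI: "arr f \<Longrightarrow> f \<in> Hom C (dom f) (cod f)"
  by (simp add: Hom_def)

lemma
  assumes "arr f" and "arr g" and "dom g = cod f"
  shows Comp_Arr [simp]: "arr (Comp C g f)"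
    and Dom_Comp [simp]: "dom (Comp C g f) = dom f"
    and Cod_Comp [simp]: "cod (Comp C g f) = cod g"
  using Comp_Hom[of f "dom f" "cod f" g "cod g"] assms by (auto simp: Hom_def)

lemma Ident_Arr [simp]:
  "A \<in> Obj C \<Longrightarrow> arr (Ident C A)"
  "A \<in> Obj C \<Longrightarrow> dom (Ident C A) = A"
  "A \<in> Obj C \<Longrightarrow> cod (Ident C A) = A"
  using Ident_Hom by (auto simp: Hom_def)

lemma Comp_Ident [simp]:
  "arr f \<Longrightarrow> cod f = B \<Longrightarrow> Comp C (Ident C B) f = f"
  "arr f \<Longrightarrow> dom f = A \<Longrightarrow> Comp C f (Ident C A) = f"
  using Comp_Ident_left Comp_Ident_right by (auto simp: Hom_def)

lemma Comp_assoc':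
  "arr f \<Longrightarrow> arr g \<Longrightarrow> arr h \<Longrightarrow> dom g = cod f \<Longrightarrow> dom h = cod g \<Longrightarrow>
    Comp C (Comp C h g) f = Comp C h (Comp C g f)"
  using Comp_assoc[of f "dom f" "cod f" g "cod g" h "cod h"] by (simp add: Hom_def)

lemmas [simp] = Dom_Obj Cod_Obj

end

context preadditive_category
begin

lemma
  assumes "A \<in> Obj C" and "B \<in> Obj C"
  shows Zero_Arr [simp]: "arr (Zero C A B)"
    and Dom_Zero [simp]: "dom (Zero C A B) = A"
    and Cod_Zero [simp]: "cod (Zero C A B) = B"
  using monoid.one_closed[OF comm_group_basics(1)[OF hom_comm_group[OF assms]]]
  by (auto simp: hom_group_def Hom_def)

lemma
  assumes "arr f" and "arr g" and "dom g = dom f" and "cod g = cod f"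
  shows Plus_Arr [simp]: "arr (Plus C f g)"
    and Dom_Plus [simp]: "dom (Plus C f g) = dom f"
    and Cod_Plus [simp]: "cod (Plus C f g) = cod f"
  using monoid.m_closed[OF comm_group_basics(1)[OF hom_comm_group[of "dom f" "cod f"]], of f g]
    assms by (auto simp: hom_group_def Hom_def)

lemma
  assumes "arr f"
  shows Neg_Arr [simp]: "arr (Neg C f)"
    and Dom_Neg [simp]: "dom (Neg C f) = dom f"
    and Cod_Neg [simp]: "cod (Neg C f) = cod f"
    and Plus_Neg: "Plus C (Neg C f) f = Zero C (dom f) (cod f)"
  using group.inv_closed[OF comm_group_basics(2)[OF hom_comm_group[of "dom f" "cod f"]], of f]
    group.l_inv[OF comm_group_basics(2)[OF hom_comm_group[of "dom f" "cod f"]], of f]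
    assms by (auto simp: hom_group_def Hom_def Neg_def)

text \<open>The arrow \<open>f : A \<rightarrow> B\<close> acts by \<open>Hom(Z, A) \<rightarrow> Hom(Z, B)\<close>; the object \<open>Z\<close> is recovered from
  the group \<open>Hom(Z, B)\<close> as the domain of its neutral element.\<close>

definition action :: "'b \<Rightarrow> 'b univ_elt \<Rightarrow> 'b monoid \<Rightarrow> 'b" where
  "action f v = (\<lambda>G. let Z = dom (one G) in
     if Z \<in> Obj C \<and> G = hom_group C Z (cod f) then Comp C f (component v (hom_group C Z (dom f)))
     else if comm_group G then one G else undefined)"

definition rep :: "'b \<Rightarrow> 'b univ_endo" where
  "rep f = Abs_univ_endo (\<lambda>v. Abs_univ_elt (action f v))"

lemma component_Hom:
  assumes "A \<in> Obj C" and "B \<in> Obj C"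
  shows "arr (component v (hom_group C A B))"
    "dom (component v (hom_group C A B)) = A"
    "cod (component v (hom_group C A B)) = B"
  using component_in[OF hom_comm_group[OF assms], of v] by (auto simp: hom_group_def Hom_def)

lemma one_hom_group [simp]: "one (hom_group C A B) = Zero C A B"
  by (simp add: hom_group_def)

lemma mult_hom_group [simp]: "mult (hom_group C A B) f g = Plus C f g"
  by (simp add: hom_group_def)

lemma component_action:
  assumes "arr f"
  shows "component (Abs_univ_elt (action f v)) = action f v"
proof (rule Abs_univ_elt_inverse)
  have "if comm_group G then action f v G \<in> carrier G else action f v G = undefined" for G
  proof (cases "dom (one G) \<in> Obj C \<and> G = hom_group C (dom (one G)) (cod f)")
    case True
    define Z where "Z = dom (one G)"
    have Z: "Z \<in> Obj C" "G = hom_group C Z (cod f)" using True by (auto simp: Z_def)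
    have "comm_group G" using hom_comm_group Z assms by auto
    moreover have "action f v G = Comp C f (component v (hom_group C Z (dom f)))"
      using True by (simp add: action_def Z_def Let_def)
    moreover have "\<dots> \<in> carrier G"
      using Z assms component_Hom[of Z "dom f" v] by (simp add: hom_group_def Hom_def)
    ultimately show ?thesis by simp
  next
    case False
    then show ?thesis
      by (auto simp: action_def Let_def comm_group_basics monoid.one_closed)
  qed
  then show "action f v \<in> {v. \<forall>G. if comm_group G then v G \<in> carrier G else v G = undefined}"
    by blast
qed

lemma component_plus:
  "component (v + w) G = (if comm_group G then mult G (component v G) (component w G) else
    undefined)"
  by (simp add: plus_univ_elt.rep_eq)

text \<open>Distributivity of composition over a sum in its right factor makes the action additive,
  so it is a legitimate element of \<open>univ_endo\<close> and the abstraction can be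
  undone.\<close>

lemma apply_rep:
  assumes "arr f"
  shows "component (apply_endo (rep f) v) = action f v"
proof -
  have "Abs_univ_elt (action f (v + w)) = Abs_univ_elt (action f v) + Abs_univ_elt (action f w)"
    for v w
  proof (subst component_inject[symmetric], rule ext)
    fix G :: "'b monoid"
    show "component (Abs_univ_elt (action f (v + w))) G =
      component (Abs_univ_elt (action f v) + Abs_univ_elt (action f w)) G"
    proof (cases "dom (one G) \<in> Obj C \<and> G = hom_group C (dom (one G)) (cod f)")
      case True
      define Z where "Z = dom (one G)"
      have Z: "Z \<in> Obj C" "G = hom_group C Z (cod f)" using True by (auto simp: Z_def)
      have "comm_group G" using hom_comm_group Z assms by auto
      moreover have "action f v G = Comp C f (component v (hom_group C Z (dom f)))" for v
        using True by (simp add: action_def Z_def Let_def)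
      moreover have "comm_group (hom_group C Z (dom f))"
        using hom_comm_group Z assms by auto
      ultimately show ?thesis
        using Z assms component_Hom[of Z "dom f"] Comp_Plus_right[of _ Z "dom f" _ f "cod f"]
        by (simp add: component_plus component_action Hom_def)
    next
      case False
      then show ?thesis
        unfolding component_action[OF assms] component_plus
        by (auto simp: action_def Let_def comm_group_basics monoid.l_one monoid.one_closed)
    qed
  qed
  then show ?thesis
    by (simp add: rep_def Abs_univ_endo_inverse component_action assms)
qed

lemma univ_endo_eqI:
  "(\<And>v G. component (apply_endo \<phi> v) G = component (apply_endo \<psi> v) G) \<Longrightarrow> \<phi> = \<psi>"
  by (metis apply_endo_inject component_inject ext)

lemma rep_Comp [simp]:
  assumes "arr f" and "arr g" and "dom g = cod f"
  shows "rep (Comp C g f) = rep g * rep f"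
proof (rule univ_endo_eqI)
  fix v and G :: "'b monoid"
  show "component (apply_endo (rep (Comp C g f)) v) G = component (apply_endo (rep g * rep f) v) G"
    using assms
    by (auto simp: apply_rep times_univ_endo.rep_eq action_def Let_def Comp_assoc' component_Hom)
qed

lemma rep_Plus [simp]:
  assumes "arr f" and "arr g" and "dom g = dom f" and "cod g = cod f"
  shows "rep (Plus C f g) = rep f + rep g"
proof (rule univ_endo_eqI)
  fix v and G :: "'b monoid"
  show "component (apply_endo (rep (Plus C f g)) v) G = component (apply_endo (rep f + rep g) v) G"
  proof (cases "dom (one G) \<in> Obj C \<and> G = hom_group C (dom (one G)) (cod f)")
    case True
    then obtain Z where Z: "Z \<in> Obj C" "G = hom_group C Z (cod f)" by blast
    then show ?thesis
      using assms hom_comm_group Comp_Plus_left[of _ Z "dom f" f "cod f" g]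
      by (simp add: apply_rep plus_univ_endo.rep_eq component_plus action_def component_Hom Hom_def)
  next
    case False
    then show ?thesis using assms
      by (auto simp: apply_rep plus_univ_endo.rep_eq component_plus action_def Let_def
          comm_group_basics monoid.l_one monoid.one_closed)
  qed
qed

text \<open>Faithfulness is a Yoneda argument: acting on an element whose component at the
  endomorphism group of the domain is the identity returns the arrow itself, in the component at
  \<open>hom_group C A B\<close>.\<close>

lemma rep_eqI:
  assumes "arr f" and "arr g" and "dom f = dom g" and "cod f = cod g"
    and eq: "rep f = rep g"
  shows "f = g"
proof -
  define A B where "A = dom f" and "B = cod f"
  have AB: "A \<in> Obj C" "B \<in> Obj C" "dom g = A" "cod g = B" "dom f = A" "cod f = B"
    using assms by (auto simp: A_def B_def)
  define v where "v = Abs_univ_elt (\<lambda>G. if G = hom_group C A A then Ident C A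
    else if comm_group G then one G else undefined)"
  have "component v = (\<lambda>G. if G = hom_group C A A then Ident C A
    else if comm_group G then one G else undefined)"
    unfolding v_def
    using AB hom_comm_group[of A A]
    by (intro Abs_univ_elt_inverse)
      (auto simp: comm_group_basics monoid.one_closed, auto simp: hom_group_def Hom_def)
  then have "action f v (hom_group C A B) = f" "action g v (hom_group C A B) = g"
    using AB assms by (auto simp: action_def)
  then show ?thesis
    using eq apply_rep[of f v] apply_rep[of g v] assms by simp
qed

lemma rep_Zero [simp]:
  assumes "A \<in> Obj C" and "B \<in> Obj C"
  shows "rep (Zero C A B) = 0"
proof -
  have "Plus C (Zero C A B) (Zero C A B) = Zero C A B"
    using monoid.l_one[OF comm_group_basics(1)[OF hom_comm_group[OF assms]], of "Zero C A B"] assms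
    by (simp add: hom_group_def Hom_def)
  then have "rep (Zero C A B) + rep (Zero C A B) = rep (Zero C A B)"
    using rep_Plus[of "Zero C A B" "Zero C A B"] assms by simp
  then show ?thesis by simp
qed

lemma rep_Neg [simp]:
  assumes "arr f"
  shows "rep (Neg C f) = - rep f"
proof -
  have "rep (Neg C f) + rep f = 0"
    using arg_cong[OF Plus_Neg[OF assms], of rep] assms by simp
  then show ?thesis by (simp add: eq_neg_iff_add_eq_0)
qed

text \<open>An identity is not represented by a unit of the ring but by the projection that keeps
  the components at the groups \<open>hom_group C Z B\<close> and makes the others neutral. Hence
  identities are cancelled by rules with typing premises, here and, for right-nested products, in
  \<open>rep_Ident_assoc\<close>.\<close>

lemma rep_Ident [simp]:
  "arr f \<Longrightarrow> cod f = B \<Longrightarrow> rep (Ident C B) * rep f = rep f"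
  "arr f \<Longrightarrow> dom f = A \<Longrightarrow> rep f * rep (Ident C A) = rep f"
  using rep_Comp[of f "Ident C B"] rep_Comp[of "Ident C A" f] by auto

lemma rep_Ident_assoc [simp]:
  "arr f \<Longrightarrow> cod f = B \<Longrightarrow> rep (Ident C B) * (rep f * z) = rep f * z"
  "arr f \<Longrightarrow> dom f = A \<Longrightarrow> rep f * (rep (Ident C A) * z) = rep f * z"
  using rep_Ident[of f] by (metis mult.assoc)+

lemma rep_eq_iff:
  "arr f \<Longrightarrow> arr g \<Longrightarrow> dom f = dom g \<Longrightarrow> cod f = cod g \<Longrightarrow>
    f = g \<longleftrightarrow> rep f = rep g"
  using rep_eqI by blast

end

section \<open>Abelian categories\<close>

context preadditive_category
begin

lemma zero_object_unique:
  "zero_object C Z \<Longrightarrow> f \<in> Hom C A Z \<Longrightarrow> g \<in> Hom C A Z \<Longrightarrow> f = g"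
  "zero_object C Z \<Longrightarrow> f \<in> Hom C Z A \<Longrightarrow> g \<in> Hom C Z A \<Longrightarrow> f = g"
  unfolding zero_object_def by (metis Hom_iff Dom_Obj Cod_Obj)+

lemma zero_object_Obj [simp]: "zero_object C Z \<Longrightarrow> Z \<in> Obj C"
  by (simp add: zero_object_def)

lemma rep_zero_object:
  assumes "zero_object C Z" and "arr f"
  shows "dom f = Z \<Longrightarrow> rep f = 0" and "cod f = Z \<Longrightarrow> rep f = 0"
proof -
  assume "dom f = Z"
  then have "f = Zero C Z (cod f)"
    using assms by (intro zero_object_unique(2)[OF assms(1)]) (auto simp: Hom_iff)
  then show "rep f = 0" using assms by (metis rep_Zero zero_object_Obj Cod_Obj)
next
  assume "cod f = Z"
  then have "f = Zero C (dom f) Z"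
    using assms by (intro zero_object_unique(1)[OF assms(1)]) (auto simp: Hom_iff)
  then show "rep f = 0" using assms by (metis rep_Zero zero_object_Obj Dom_Obj)
qed

lemma eq_Zero_iff: "arr f \<Longrightarrow> f = Zero C (dom f) (cod f) \<longleftrightarrow> rep f = 0"
  using rep_eq_iff[of f "Zero C (dom f) (cod f)"] by simp

lemma zero_objectI:
  assumes "Z \<in> Obj C" and "rep (Ident C Z) = 0"
  shows "zero_object C Z"
proof -
  have "f = Zero C A Z" if "f \<in> Hom C A Z" for f A
    using that assms rep_Ident(1)[of f Z] by (intro rep_eqI) (auto simp: Hom_iff)
  moreover have "f = Zero C Z A" if "f \<in> Hom C Z A" for f A
    using that assms rep_Ident(2)[of f Z] by (intro rep_eqI) (auto simp: Hom_iff)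
  ultimately show ?thesis
    using assms(1) unfolding zero_object_def
    by (metis Hom_iff Zero_Arr Dom_Zero Cod_Zero)
qed

section \<open>Monics, epics, kernels and cokernels in terms of vanishing products\<close>

lemma monicD:
  assumes "monic C m" and "arr g" and "cod g = dom m" and "rep m * rep g = 0"
  shows "rep g = 0"
proof -
  have m: "arr m" using assms(1) by (simp add: monic_def)
  have "Comp C m g = Comp C m (Zero C (dom g) (cod g))"
    using assms m by (intro rep_eqI) auto
  then have "g = Zero C (dom g) (cod g)"
    using assms m unfolding monic_def by (metis Zero_Arr Dom_Zero Cod_Zero Dom_Obj Cod_Obj)
  then show ?thesis using assms(2) eq_Zero_iff by simp
qed

lemma monicI:
  assumes m: "arr m"
    and "\<And>g. arr g \<Longrightarrow> cod g = dom m \<Longrightarrow> rep m * rep g = 0 \<Longrightarrow> rep g = 0"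
  shows "monic C m"
  unfolding monic_def
proof (intro conjI ballI impI m; elim conjE)
  fix g h assume gh: "arr g" "arr h" "cod g = dom m" "cod h = dom m"
    "dom g = dom h" "Comp C m g = Comp C m h"
  have "rep m * rep (Plus C g (Neg C h)) = 0"
    using gh m by (simp add: algebra_simps flip: rep_Comp)
  then have "rep (Plus C g (Neg C h)) = 0"
    using gh m assms(2)[of "Plus C g (Neg C h)"] by simp
  then show "g = h" using gh by (intro rep_eqI) auto
qed

lemma monic_cancel:
  assumes "monic C m" and "arr g" and "arr h" and "cod g = dom m"
    and "cod h = dom m" and "dom g = dom h" and "rep m * rep g = rep m * rep h"
  shows "rep g = rep h"
  using monicD[OF assms(1), of "Plus C g (Neg C h)"] assms by (simp add: algebra_simps)

lemma epicD:
  assumes "epic C e" and "arr g" and "dom g = cod e" and "rep g * rep e = 0"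
  shows "rep g = 0"
proof -
  have e: "arr e" using assms(1) by (simp add: epic_def)
  have "Comp C g e = Comp C (Zero C (dom g) (cod g)) e"
    using assms e by (intro rep_eqI) auto
  then have "g = Zero C (dom g) (cod g)"
    using assms e unfolding epic_def by (metis Zero_Arr Dom_Zero Cod_Zero Dom_Obj Cod_Obj)
  then show ?thesis using assms(2) eq_Zero_iff by simp
qed

lemma epicI:
  assumes e: "arr e"
    and "\<And>g. arr g \<Longrightarrow> dom g = cod e \<Longrightarrow> rep g * rep e = 0 \<Longrightarrow> rep g = 0"
  shows "epic C e"
  unfolding epic_def
proof (intro conjI ballI impI e; elim conjE)
  fix g h assume gh: "arr g" "arr h" "dom g = cod e" "dom h = cod e"
    "cod g = cod h" "Comp C g e = Comp C h e"
  have "rep (Plus C g (Neg C h)) * rep e = 0"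
    using gh e by (simp add: algebra_simps flip: rep_Comp)
  then have "rep (Plus C g (Neg C h)) = 0"
    using gh e assms(2)[of "Plus C g (Neg C h)"] by simp
  then show "g = h" using gh by (intro rep_eqI) auto
qed

lemma epic_Arr [simp]: "epic C e \<Longrightarrow> arr e" and monic_Arr [simp]: "monic C e \<Longrightarrow> arr e"
  by (simp_all add: epic_def monic_def)

lemma epic_Ident [simp]: "A \<in> Obj C \<Longrightarrow> epic C (Ident C A)"
  by (rule epicI) auto

lemma epic_Comp:
  assumes "epic C e" and "epic C e'" and "dom e' = cod e"
  shows "epic C (Comp C e' e)"
proof (rule epicI)
  fix g assume g: "arr g" "dom g = cod (Comp C e' e)" "rep g * rep (Comp C e' e) = 0"
  then have "rep (Comp C g e') * rep e = 0" using assms by (simp add: mult.assoc)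
  then have "rep (Comp C g e') = 0" using assms g epicD[of e "Comp C g e'"] by simp
  then show "rep g = 0" using assms g epicD[of e' g] by simp
qed (use assms in simp)

lemma epic_factor:
  assumes "epic C f" and "arr e'" and "arr u" "cod u = dom e'" "f = Comp C e' u"
  shows "epic C e'"
proof (rule epicI)
  fix g assume g: "arr g" "dom g = cod e'" "rep g * rep e' = 0"
  then have "rep g * rep f = 0" using assms by (simp add: mult.assoc[symmetric])
  then show "rep g = 0" using assms g epicD[of f g] by simp
qed (use assms in simp)

lemma kernelD:
  assumes "is_kernel C f k"
  shows "arr f" and "arr k" and "cod k = dom f" and "rep f * rep k = 0" and "monic C k"
proof -
  show *: "arr f" "arr k" "cod k = dom f" using assms by (auto simp: is_kernel_def)
  have "Comp C f k = Zero C (dom k) (cod f)" using assms by (simp add: is_kernel_def)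
  from arg_cong[OF this, of rep] show 0: "rep f * rep k = 0" using * by simp
  show "monic C k"
  proof (rule monicI[OF *(2)])
    fix g assume g: "arr g" "cod g = dom k" "rep k * rep g = 0"
    define z where "z = Zero C (dom g) (cod g)"
    \<comment> \<open>Both \<open>g\<close> and the zero arrow \<open>z\<close> are factorizations
      of this zero arrow through \<open>k\<close>, so the uniqueness part of the universal property
      identifies them.\<close>
    define h where "h = Zero C (dom g) (cod k)"
    have "arr h" "cod h = dom f" "Comp C f h = Zero C (dom h) (cod f)"
      using g * by (auto simp: h_def intro!: rep_eqI)
    then have "\<exists>!u. u \<in> Hom C (dom h) (dom k) \<and> Comp C k u = h"
      using assms unfolding is_kernel_def by blast
    moreover have "g \<in> Hom C (dom h) (dom k) \<and> Comp C k g = h"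
      using g * by (auto simp: h_def Hom_iff intro!: rep_eqI)
    moreover have "z \<in> Hom C (dom h) (dom k) \<and> Comp C k z = h"
      using g * by (auto simp: h_def z_def Hom_iff intro!: rep_eqI)
    ultimately have "g = z" by blast
    moreover have "rep z = 0" using g * by (simp add: z_def)
    ultimately show "rep g = 0" by simp
  qed
qed

lemma kernel_factor:
  assumes "is_kernel C f k" and "arr h" and "cod h = dom f" and "rep f * rep h = 0"
  obtains u where "arr u" "dom u = dom h" "cod u = dom k" "rep k * rep u = rep h"
proof -
  have "arr f" using kernelD[OF assms(1)] by simp
  then have "Comp C f h = Zero C (dom h) (cod f)" using assms by (intro rep_eqI) auto
  then obtain u where "u \<in> Hom C (dom h) (dom k)" "Comp C k u = h"
    using assms unfolding is_kernel_def by blast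
  then show thesis using kernelD[OF assms(1)] by (intro that[of u]) (auto simp: Hom_iff)
qed

lemma cokernelD:
  assumes "is_cokernel C f p"
  shows "arr f" and "arr p" and "dom p = cod f" and "rep p * rep f = 0" and "epic C p"
proof -
  show *: "arr f" "arr p" "dom p = cod f" using assms by (auto simp: is_cokernel_def)
  have "Comp C p f = Zero C (dom f) (cod p)" using assms by (simp add: is_cokernel_def)
  from arg_cong[OF this, of rep] show 0: "rep p * rep f = 0" using * by simp
  show "epic C p"
  proof (rule epicI[OF *(2)])
    fix g assume g: "arr g" "dom g = cod p" "rep g * rep p = 0"
    define z where "z = Zero C (dom g) (cod g)"
    define h where "h = Zero C (dom p) (cod g)"
    have "arr h" "dom h = cod f" "Comp C h f = Zero C (dom f) (cod h)"
      using g * by (auto simp: h_def intro!: rep_eqI)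
    then have "\<exists>!u. u \<in> Hom C (cod p) (cod h) \<and> Comp C u p = h"
      using assms unfolding is_cokernel_def by blast
    moreover have "g \<in> Hom C (cod p) (cod h) \<and> Comp C g p = h"
      using g * by (auto simp: h_def Hom_iff intro!: rep_eqI)
    moreover have "z \<in> Hom C (cod p) (cod h) \<and> Comp C z p = h"
      using g * by (auto simp: h_def z_def Hom_iff intro!: rep_eqI)
    ultimately have "g = z" by blast
    moreover have "rep z = 0" using g * by (simp add: z_def)
    ultimately show "rep g = 0" by simp
  qed
qed

lemma cokernel_factor:
  assumes "is_cokernel C f p" and "arr h" and "dom h = cod f" and "rep h * rep f = 0"
  obtains u where "arr u" "dom u = cod p" "cod u = cod h" "rep u * rep p = rep h"
proof -
  have "arr f" using cokernelD[OF assms(1)] by simp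
  then have "Comp C h f = Zero C (dom f) (cod h)" using assms by (intro rep_eqI) auto
  then obtain u where "u \<in> Hom C (cod p) (cod h)" "Comp C u p = h"
    using assms unfolding is_cokernel_def by blast
  then show thesis using cokernelD[OF assms(1)] by (intro that[of u]) (auto simp: Hom_iff)
qed

text \<open>Translates the vanishing of a cohomology object, which is defined as a cokernel, into
  surjectivity of the arrow onto the cycles.\<close>

lemma cokernel_of_epic:
  assumes "is_cokernel C f p"
  shows "epic C f \<longleftrightarrow> zero_object C (cod p)"
proof
  note p = cokernelD[OF assms]
  assume "epic C f"
  then have "rep p = 0" using epicD p by blast
  then have "rep (Ident C (cod p)) * rep p = 0" by simp
  then have "rep (Ident C (cod p)) = 0" using epicD[OF p(5)] p by simp
  then show "zero_object C (cod p)" using p by (intro zero_objectI) auto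
next
  note p = cokernelD[OF assms]
  assume z: "zero_object C (cod p)"
  show "epic C f"
  proof (rule epicI[OF p(1)])
    fix g assume "arr g" "dom g = cod f" "rep g * rep f = 0"
    then obtain u where "rep u * rep p = rep g" using cokernel_factor[OF assms] by blast
    then show "rep g = 0" using rep_zero_object(2)[OF z] p by (metis mult_zero_right)
  qed
qed

end

section \<open>Biproducts and the chosen zero object\<close>

context preadditive_category
begin

lemma biproductD:
  assumes "is_biproduct C A B P i1 i2 p1 p2"
  shows "arr i1" "arr i2" "arr p1" "arr p2"
      "dom i1 = A" "dom i2 = B" "dom p1 = P" "dom p2 = P"
      "cod i1 = P" "cod i2 = P" "cod p1 = A" "cod p2 = B"
      "A \<in> Obj C" "B \<in> Obj C" "P \<in> Obj C"
      "rep p1 * rep i1 = rep (Ident C A)" "rep p2 * rep i2 = rep (Ident C B)"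
      "rep p1 * rep i2 = 0" "rep p2 * rep i1 = 0"
      "rep p1 * (rep i1 * z) = rep (Ident C A) * z" "rep p2 * (rep i2 * z) = rep (Ident C B) * z"
      "rep p1 * (rep i2 * z) = 0" "rep p2 * (rep i1 * z) = 0"
proof -
  show *: "arr i1" "arr i2" "arr p1" "arr p2"
      "dom i1 = A" "dom i2 = B" "dom p1 = P" "dom p2 = P"
      "cod i1 = P" "cod i2 = P" "cod p1 = A" "cod p2 = B"
    using assms by (auto simp: is_biproduct_def Hom_iff)
  show o: "A \<in> Obj C" "B \<in> Obj C" "P \<in> Obj C"
    using Dom_Obj[OF *(1)] Dom_Obj[OF *(2)] Dom_Obj[OF *(3)] * by auto
  have "Comp C p1 i1 = Ident C A" "Comp C p2 i2 = Ident C B"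
    "Comp C p1 i2 = Zero C B A" "Comp C p2 i1 = Zero C A B"
    using assms by (auto simp: is_biproduct_def)
  from this[THEN arg_cong[of _ _ rep]]
  show "rep p1 * rep i1 = rep (Ident C A)" "rep p2 * rep i2 = rep (Ident C B)"
      "rep p1 * rep i2 = 0" "rep p2 * rep i1 = 0"
    using * o by simp_all
  then show "rep p1 * (rep i1 * z) = rep (Ident C A) * z"
    "rep p2 * (rep i2 * z) = rep (Ident C B) * z"
      "rep p1 * (rep i2 * z) = 0" "rep p2 * (rep i1 * z) = 0"
    by (simp_all flip: mult.assoc)
qed

lemma biproduct_eqI:
  assumes b: "is_biproduct C A B P i1 i2 p1 p2" and "arr x" and "arr y"
    and "cod x = P" and "cod y = P"
    and "rep p1 * rep x = rep p1 * rep y" and "rep p2 * rep x = rep p2 * rep y"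
  shows "rep x = rep y"
proof -
  note * = biproductD[OF b]
  have "Plus C (Comp C i1 p1) (Comp C i2 p2) = Ident C P" using b by (simp add: is_biproduct_def)
  from arg_cong[OF this, of rep] have i: "rep i1 * rep p1 + rep i2 * rep p2 = rep (Ident C P)"
    using * by simp
  have "rep z = rep i1 * (rep p1 * rep z) + rep i2 * (rep p2 * rep z)" if "arr z" "cod z = P" for z
    using that arg_cong[OF i, of "\<lambda>y. y * rep z"] by (simp add: distrib_right mult.assoc)
  from this[of x] this[of y] show ?thesis using assms by simp
qed

end

context additive_category
begin

lemma zero_object_zero_obj [simp]: "zero_object C (zero_obj C)"
  using zero_object_exists unfolding zero_obj_def by (rule someI_ex)

lemma zero_obj_Obj [simp]: "zero_obj C \<in> Obj C"
  by (rule zero_object_Obj) simp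

end

section \<open>Pullbacks of epics, and images\<close>

context abelian_category
begin

text \<open>The pullback is the kernel \<open>k\<close> of \<open>r = a p1 - e p2\<close>. On the
  second summand \<open>r\<close> is \<open>- e\<close>, so \<open>r\<close> is epic and thus the
  cokernel of some \<open>f\<close>, which factors through \<open>k\<close>. If \<open>g\<close>
  kills \<open>q = p1 k\<close>, then \<open>g p1\<close> kills \<open>f\<close> and equals
  \<open>w r\<close> for some \<open>w\<close>; restriction to the second summand gives
  \<open>w e = 0\<close>, hence \<open>w = 0\<close>, and restriction to the first gives
  \<open>g = 0\<close>. This is what allows generalized elements to be lifted along epics after a
  change of cover.\<close>

lemma pullback_epic:
  assumes e: "epic C e" and a: "arr a" and "cod a = cod e"
  obtains q b where "epic C q" "cod q = dom a" "arr b" "dom b = dom q"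
    "cod b = dom e" "rep e * rep b = rep a * rep q"
proof -
  define A B where "A = dom a" and "B = dom e"
  have AB [simp]: "A \<in> Obj C" "B \<in> Obj C" "dom a = A" "dom e = B" "arr e"
    using assms by (auto simp: A_def B_def)
  note [simp] = a \<open>cod a = cod e\<close>
  obtain P i1 i2 p1 p2 where b: "is_biproduct C A B P i1 i2 p1 p2"
    using biproduct_exists[of A B] by auto
  note [simp] = biproductD[OF b]
  define r where "r = Plus C (Comp C a p1) (Neg C (Comp C e p2))"
  have r [simp]: "arr r" "dom r = P" "cod r = cod e" by (simp_all add: r_def)
  have rr: "rep r = rep a * rep p1 - rep e * rep p2" by (simp add: r_def)
  have "epic C r"
  proof (rule epicI)
    fix g assume g: "arr g" "dom g = cod r" "rep g * rep r = 0"
    have "rep g * rep r * rep i2 = - (rep g * rep e)"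
      by (simp add: rr algebra_simps)
    then have "rep g * rep e = 0" using g by simp
    then show "rep g = 0" using epicD[OF e] g by simp
  qed simp
  then obtain f where f: "is_cokernel C f r" using epic_is_cokernel by blast
  note fD = cokernelD[OF f]
  obtain k where k: "is_kernel C r k" using kernel_exists[of r] by auto
  note kD = kernelD[OF k]
  obtain u where u: "arr u" "dom u = dom f" "cod u = dom k" "rep k * rep u = rep f"
    using kernel_factor[OF k, of f] fD by auto
  define q b where "q = Comp C p1 k" and "b = Comp C p2 k"
  have qb: "arr q" "arr b" "dom b = dom q" "cod b = B" "cod q = A"
    using kD by (simp_all add: q_def b_def)
  have "rep e * rep b = rep a * rep q"
    using kD(4) kD by (simp add: q_def b_def rr algebra_simps)
  moreover have "epic C q"
  proof (rule epicI[OF qb(1)])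
    fix g assume g: "arr g" "dom g = cod q" "rep g * rep q = 0"
    have "rep (Comp C g p1) * rep f = rep g * rep q * rep u"
      using g(1,2) qb kD fD u(1-3) by (simp add: q_def mult.assoc flip: u(4))
    then have "rep (Comp C g p1) * rep f = 0" by (simp only: g(3) mult_zero_left)
    then obtain w where w: "arr w" "dom w = cod r" "rep w * rep r = rep (Comp C g p1)"
      using cokernel_factor[OF f, of "Comp C g p1"] g qb fD by auto
    have "rep w * rep r * rep i2 = - (rep w * rep e)" by (simp add: rr algebra_simps)
    then have "rep w * rep e = 0" using w g qb by (simp add: mult.assoc)
    then have "rep w = 0" using epicD[OF e] w by simp
    then have "rep g * rep p1 * rep i1 = 0" using w g qb by simp
    then show "rep g = 0" using g qb by (simp add: mult.assoc)
  qed
  ultimately show thesis using qb by (intro that[of q b]) simp_all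
qed

lemma is_image_im_mono:
  assumes "arr d"
  shows "is_image C d (im_mono C d)"
proof -
  obtain p where p: "is_cokernel C d p" using cokernel_exists[OF assms] by blast
  then obtain k where "is_kernel C p k" using kernel_exists cokernelD(2) by blast
  with p have "\<exists>m. is_image C d m" by (auto simp: is_image_def)
  then show ?thesis unfolding im_mono_def by (rule someI_ex)
qed

lemma im_mono:
  assumes "arr d"
  shows im_mono_Arr [simp]: "arr (im_mono C d)" "dom (im_mono C d) = im_obj C d"
      "cod (im_mono C d) = cod d" "im_obj C d \<in> Obj C"
    and monic_im_mono: "monic C (im_mono C d)"
proof -
  obtain p where p: "is_cokernel C d p" "is_kernel C p (im_mono C d)"
    using is_image_im_mono[OF assms] by (auto simp: is_image_def)
  show "arr (im_mono C d)" "dom (im_mono C d) = im_obj C d"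
    "cod (im_mono C d) = cod d" "monic C (im_mono C d)" "im_obj C d \<in> Obj C"
    using kernelD[OF p(2)] cokernelD[OF p(1)] by (auto simp: im_obj_def)
qed

text \<open>The cokernel hidden in the choice of \<open>im_mono\<close> is unknown, but it factors
  through any given cokernel \<open>p\<close> of \<open>d\<close>; whatever \<open>p\<close> kills
  is killed by it too.\<close>

lemma im_mono_factor:
  assumes "arr d" and "is_cokernel C d p" and "arr h" and "cod h = cod d"
    and "rep p * rep h = 0"
  obtains u where "arr u" "dom u = dom h" "cod u = im_obj C d"
    "rep (im_mono C d) * rep u = rep h"
proof -
  obtain p' where p': "is_cokernel C d p'" "is_kernel C p' (im_mono C d)"
    using is_image_im_mono[OF assms(1)] by (auto simp: is_image_def)
  note p'D = cokernelD[OF p'(1)] and pD = cokernelD[OF assms(2)]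
  obtain w where "arr w" "dom w = cod p" "rep w * rep p = rep p'"
    using cokernel_factor[OF assms(2) p'D(2)] p'D by auto
  then have "rep p' * rep h = 0" using assms by (metis mult.assoc mult_zero_right)
  then show thesis
    using kernel_factor[OF p'(2) assms(3)] assms p'D by (metis im_obj_def that)
qed

text \<open>For the epic part, let \<open>k\<close> be the kernel of an arrow \<open>g\<close> that
  kills the corestriction. Then \<open>mk\<close>, the image arrow after \<open>k\<close>, is monic
  and so the kernel of some \<open>r\<close>. As \<open>d\<close> factors through \<open>mk\<close>,
  \<open>r\<close> kills \<open>d\<close> and hence the whole image. So the image arrow factors
  through \<open>mk\<close>, which splits \<open>k\<close> and forces \<open>g = 0\<close>.\<close>

lemma im_epi:
  assumes d: "arr d"
  shows im_epi_Arr [simp]: "arr (im_epi C d)" "dom (im_epi C d) = dom d"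
      "cod (im_epi C d) = im_obj C d"
    and rep_im [simp]: "rep (im_mono C d) * rep (im_epi C d) = rep d"
    and epic_im_epi: "epic C (im_epi C d)"
proof -
  obtain p where p: "is_cokernel C d p" using cokernel_exists[OF assms] by blast
  note pD = cokernelD[OF p] and m = im_mono[OF d]
  obtain u where u: "arr u" "dom u = dom d" "cod u = im_obj C d"
    "rep (im_mono C d) * rep u = rep d"
    using im_mono_factor[OF d p d] pD by auto
  have "im_epi C d = u"
    unfolding im_epi_def
  proof (rule the_equality)
    show "u \<in> Hom C (dom d) (im_obj C d) \<and> Comp C (im_mono C d) u = d"
      using u m d by (auto simp: Hom_iff intro!: rep_eqI)
    fix e assume "e \<in> Hom C (dom d) (im_obj C d) \<and> Comp C (im_mono C d) e = d"
    then have e: "arr e" "dom e = dom d" "cod e = im_obj C d" "Comp C (im_mono C d) e = d"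
      by (auto simp: Hom_iff)
    have "rep (im_mono C d) * rep e = rep d" using e m by (simp flip: rep_Comp)
    then show "e = u" using u e d by (intro rep_eqI monic_cancel[OF m(5)]) auto
  qed
  with u show e: "arr (im_epi C d)" "dom (im_epi C d) = dom d" "cod (im_epi C d) = im_obj C d"
    and im: "rep (im_mono C d) * rep (im_epi C d) = rep d"
    by simp_all
  show "epic C (im_epi C d)"
  proof (rule epicI[OF e(1)])
    fix g assume g: "arr g" "dom g = cod (im_epi C d)" "rep g * rep (im_epi C d) = 0"
    obtain k where k: "is_kernel C g k" using kernel_exists g by blast
    note kD = kernelD[OF k]
    obtain e' where e': "arr e'" "dom e' = dom d" "cod e' = dom k"
      "rep k * rep e' = rep (im_epi C d)"
      using kernel_factor[OF k, of "im_epi C d"] g e by auto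
    define mk where "mk = Comp C (im_mono C d) k"
    have mk: "arr mk" "dom mk = dom k" "cod mk = cod d"
      using kD m g e by (auto simp: mk_def)
    have "monic C mk"
    proof (rule monicI[OF mk(1)])
      fix h assume h: "arr h" "cod h = dom mk" "rep mk * rep h = 0"
      have "rep (Comp C k h) = 0"
        using h kD m g e mk by (intro monicD[OF m(5), of "Comp C k h"]) (simp_all add: mk_def
          mult.assoc)
      then show "rep h = 0" using h kD mk by (intro monicD[OF kD(5)]) auto
    qed
    then obtain r where r: "is_kernel C r mk" using monic_is_kernel by blast
    note rD = kernelD[OF r]
    have "rep r * rep d = rep r * (rep (im_mono C d) * (rep k * rep e'))"
      using e' im by simp
    also have "\<dots> = rep r * rep mk * rep e'"
      using kD m g e mk by (simp add: mk_def mult.assoc)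
    finally have "rep r * rep d = 0" using rD by simp
    then obtain r' where r': "arr r'" "rep r' * rep p = rep r"
      using cokernel_factor[OF p, of r] rD mk by auto
    obtain p' where p': "is_cokernel C d p'" "is_kernel C p' (im_mono C d)"
      using is_image_im_mono[OF assms(1)] by (auto simp: is_image_def)
    obtain w where w: "rep w * rep p' = rep p"
      using cokernel_factor[OF p'(1) pD(2)] pD by auto
    have "rep r * rep (im_mono C d) = rep r' * (rep w * (rep p' * rep (im_mono C d)))"
      using r' w by (simp add: mult.assoc flip: mult.assoc)
    then have "rep r * rep (im_mono C d) = 0" using kernelD(4)[OF p'(2)] by simp
    then obtain v where v: "arr v" "dom v = im_obj C d" "cod v = dom k"
      "rep mk * rep v = rep (im_mono C d)"
      using kernel_factor[OF r, of "im_mono C d"] rD m mk by auto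
    have "rep (Comp C k v) = rep (Ident C (im_obj C d))"
      using v kD m g e mk by (intro monic_cancel[OF m(5)]) (simp_all add: mk_def mult.assoc)
    then have "rep g = rep g * (rep k * rep v)" using g e v kD by simp
    then show "rep g = 0" using kD(4) by (simp flip: mult.assoc)
  qed
qed

lemma im_map_unique:
  assumes "arr d" and "arr d'" and "arr b" and "dom b = cod d"
    and "cod b = cod d'" and "arr u" "dom u = im_obj C d" "cod u = im_obj C d'"
    "rep (im_mono C d') * rep u = rep b * rep (im_mono C d)"
  shows "im_map C d d' b = u"
  unfolding im_map_def
proof (rule the_equality)
  note m = im_mono[OF assms(1)] im_epi[OF assms(1)] and m' = im_mono[OF assms(2)]
  show "u \<in> Hom C (im_obj C d) (im_obj C d') \<and> Comp C (im_mono C d') u = Comp C b (im_mono C d)"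
    using m m' assms by (auto simp: Hom_iff intro!: rep_eqI)
  fix e assume "e \<in> Hom C (im_obj C d) (im_obj C d') \<and>
    Comp C (im_mono C d') e = Comp C b (im_mono C d)"
  then have e: "arr e" "dom e = im_obj C d" "cod e = im_obj C d'"
    "Comp C (im_mono C d') e = Comp C b (im_mono C d)"
    by (auto simp: Hom_iff)
  have "rep (im_mono C d') * rep e = rep b * rep (im_mono C d)"
    using e m m' assms by (simp flip: rep_Comp)
  then show "e = u" using e assms by (intro rep_eqI monic_cancel[OF m'(5)]) auto
qed

lemma im_map:
  assumes "arr d" and "arr d'" and "arr b" and "dom b = cod d"
    and "cod b = cod d'" and "arr a" and "dom a = dom d" and "cod a = dom d'"
    and comm: "rep b * rep d = rep d' * rep a"
  shows "arr (im_map C d d' b)" "dom (im_map C d d' b) = im_obj C d"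
    "cod (im_map C d d' b) = im_obj C d'"
    "rep (im_mono C d') * rep (im_map C d d' b) = rep b * rep (im_mono C d)"
proof -
  note m = im_mono[OF assms(1)] im_epi[OF assms(1)] and m' = im_mono[OF assms(2)]
  obtain p where p: "is_cokernel C d' p" using cokernel_exists[OF assms(2)] by blast
  note pD = cokernelD[OF p]
  \<comment> \<open>To factor \<open>b\<close> after the image arrow through the image of
    \<open>d'\<close> it must be killed by the cokernel \<open>p\<close>. Since
    \<open>im_epi C d\<close> is epic, this may be tested on \<open>b d = d' a\<close>.\<close>
  have "rep (Comp C p (Comp C b (im_mono C d))) * rep (im_epi C d) = rep p * (rep b * rep d)"
    using assms m pD by (simp add: mult.assoc)
  also have "\<dots> = rep p * rep d' * rep a" by (simp add: comm mult.assoc)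
  finally have "rep (Comp C p (Comp C b (im_mono C d))) * rep (im_epi C d) = 0" using pD by simp
  then have "rep (Comp C p (Comp C b (im_mono C d))) = 0"
    using assms m pD by (intro epicD[OF m(10)]) auto
  then obtain u where u: "arr u" "dom u = im_obj C d" "cod u = im_obj C d'"
    "rep (im_mono C d') * rep u = rep b * rep (im_mono C d)"
    using im_mono_factor[OF assms(2) p, of "Comp C b (im_mono C d)"] assms m pD by auto
  then show "arr (im_map C d d' b)" "dom (im_map C d d' b) = im_obj C d"
    "cod (im_map C d d' b) = im_obj C d'"
    "rep (im_mono C d') * rep (im_map C d d' b) = rep b * rep (im_mono C d)"
    using im_map_unique[OF assms(1-5) u] by simp_all
qed

end

section \<open>Complexes up to homotopy\<close>

context preadditive_category
begin

text \<open>The premise \<open>m = n + 1\<close>, in place of a literal successor, lets the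
  simplifier match pairs of degrees such as \<open>n - 1\<close> and \<open>n\<close>; the variants
  with a trailing factor \<open>z\<close> rewrite inside right-nested products.
  \<open>chain_mapD\<close> and \<open>cone_splittingD\<close> follow the same pattern.\<close>

lemma complexD:
  assumes "is_complex C X"
  shows "arr (df X n)" "dom (df X n) = ob X n" "cod (df X n) = ob X (n + 1)" "ob X n \<in> Obj C"
    "m = n + 1 \<Longrightarrow> rep (df X m) * rep (df X n) = 0"
    "m = n + 1 \<Longrightarrow> rep (df X m) * (rep (df X n) * z) = 0"
proof -
  have *: "arr (df X n)" "dom (df X n) = ob X n" "cod (df X n) = ob X (n + 1)"
    "Comp C (df X (n + 1)) (df X n) = Zero C (ob X n) (ob X (n + 2))" for n
    using assms by (auto simp: is_complex_def Hom_iff)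
  have o: "ob X n \<in> Obj C" for n using Dom_Obj[OF *(1), of n] * by simp
  have "rep (df X (n + 1)) * rep (df X n) = rep (Zero C (ob X n) (ob X (n + 2)))"
    using *(1-3) by (simp flip: rep_Comp *(4))
  then have "rep (df X (n + 1)) * rep (df X n) = 0" using o by simp
  then show "m = n + 1 \<Longrightarrow> rep (df X m) * rep (df X n) = 0"
    "m = n + 1 \<Longrightarrow> rep (df X m) * (rep (df X n) * z) = 0"
    by (simp_all flip: mult.assoc)
  show "arr (df X n)" "dom (df X n) = ob X n" "cod (df X n) = ob X (n + 1)" "ob X n \<in> Obj C"
    using * o by auto
qed

lemma is_complexI:
  assumes "\<And>n. df X n \<in> Hom C (ob X n) (ob X (n + 1))"
    and "\<And>n. rep (df X (n + 1)) * rep (df X n) = 0"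
  shows "is_complex C X"
proof -
  have *: "arr (df X n)" "dom (df X n) = ob X n" "cod (df X n) = ob X (n + 1)" for n
    using assms by (auto simp: Hom_iff)
  have o: "ob X n \<in> Obj C" for n using Dom_Obj[OF *(1), of n] * by simp
  show ?thesis
    unfolding is_complex_def using * o assms by (auto intro!: rep_eqI simp: add.assoc)
qed

lemma chain_mapD:
  assumes "chain_map C X Y \<phi>" and "is_complex C X" and "is_complex C Y"
  shows "arr (\<phi> n)" "dom (\<phi> n) = ob X n" "cod (\<phi> n) = ob Y n"
    "m = n + 1 \<Longrightarrow> rep (\<phi> m) * rep (df X n) = rep (df Y n) * rep (\<phi> n)"
    "m = n + 1 \<Longrightarrow> rep (\<phi> m) * (rep (df X n) * z) = rep (df Y n) * (rep (\<phi> n) * z)"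
proof -
  have *: "arr (\<phi> n)" "dom (\<phi> n) = ob X n" "cod (\<phi> n) = ob Y n"
    "Comp C (\<phi> (n + 1)) (df X n) = Comp C (df Y n) (\<phi> n)" for n
    using assms by (auto simp: chain_map_def Hom_iff)
  have "rep (\<phi> (n + 1)) * rep (df X n) = rep (df Y n) * rep (\<phi> n)"
    using * complexD[OF assms(2)] complexD[OF assms(3)] by (simp flip: rep_Comp)
  then show "m = n + 1 \<Longrightarrow> rep (\<phi> m) * rep (df X n) = rep (df Y n) * rep (\<phi> n)"
    "m = n + 1 \<Longrightarrow> rep (\<phi> m) * (rep (df X n) * z) = rep (df Y n) * (rep (\<phi> n) * z)"
    by (simp_all flip: mult.assoc)
qed (use assms in \<open>auto simp: chain_map_def Hom_iff\<close>)

lemma chain_mapI: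
  assumes "is_complex C X" and "is_complex C Y" and "\<And>n. \<phi> n \<in> Hom C (ob X n) (ob Y n)"
    and "\<And>n. rep (\<phi> (n + 1)) * rep (df X n) = rep (df Y n) * rep (\<phi> n)"
  shows "chain_map C X Y \<phi>"
  unfolding chain_map_def
  using assms complexD[OF assms(1)] complexD[OF assms(2)] by (auto intro!: rep_eqI simp: Hom_iff)

text \<open>\<open>homotopic\<close> with the homotopy named and its equation moved into the ring,
  where it can be multiplied and rearranged freely.\<close>

definition htpy where
  "htpy X Y \<phi> \<psi> h \<longleftrightarrow> (\<forall>n. h n \<in> Hom C (ob X n) (ob Y (n - 1)) \<and>
     rep (\<phi> n) = rep (\<psi> n) + (rep (df Y (n - 1)) * rep (h n) + rep (h (n + 1)) * rep (df X n)))"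

lemma htpyD:
  assumes "htpy X Y \<phi> \<psi> h"
  shows "arr (h n)" "dom (h n) = ob X n" "cod (h n) = ob Y (n - 1)"
    "rep (\<phi> n) = rep (\<psi> n) + (rep (df Y (n - 1)) * rep (h n) + rep (h (n + 1)) * rep (df X n))"
  using assms unfolding htpy_def Hom_iff by blast+

lemma homotopicI:
  assumes "is_complex C X" and "is_complex C Y"
    and "\<And>n. \<phi> n \<in> Hom C (ob X n) (ob Y n)" and "\<And>n. \<psi> n \<in> Hom C (ob X n) (ob Y n)"
    and "\<And>n. h n \<in> Hom C (ob X n) (ob Y (n - 1))"
    and "\<And>n. rep (\<phi> n) = rep (\<psi> n) + (rep (df Y (n - 1)) * rep (h n) + rep (h (n + 1)) * rep (df
      X n))"
  shows "homotopic C X Y \<phi> \<psi>"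
  unfolding homotopic_def
  using assms complexD[OF assms(1)] complexD[OF assms(2)]
  by (intro exI[of _ h] allI conjI) (auto intro!: rep_eqI simp: Hom_iff)

lemma homotopicE:
  assumes "homotopic C X Y \<phi> \<psi>" and "is_complex C X" and "is_complex C Y" and "chain_map C X Y \<psi>"
  obtains h where "htpy X Y \<phi> \<psi> h"
proof -
  obtain h where h: "\<And>n. h n \<in> Hom C (ob X n) (ob Y (n - 1))"
    "\<And>n. \<phi> n = Plus C (\<psi> n) (Plus C (Comp C (df Y (n - 1)) (h n)) (Comp C (h (n + 1)) (df X n)))"
    using assms(1) unfolding homotopic_def by blast
  have "rep (\<phi> n) = rep (\<psi> n) + (rep (df Y (n - 1)) * rep (h n) + rep (h (n + 1)) * rep (df X
    n))" for n
    by (subst h(2)) (use h(1) complexD[OF assms(2)] complexD[OF assms(3)]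
      chain_mapD[OF assms(4,2,3)]
      in \<open>auto simp: Hom_iff\<close>)
  then show thesis using that[of h] h(1) by (simp add: htpy_def)
qed

lemma chain_map_Hom: "chain_map C X Y \<phi> \<Longrightarrow> \<phi> n \<in> Hom C (ob X n) (ob Y n)"
  by (simp add: chain_map_def)

lemma homotopic_refl:
  assumes "is_complex C X" "is_complex C Y" "chain_map C X Y \<phi>"
  shows "homotopic C X Y \<phi> \<phi>"
  using complexD[OF assms(1)] complexD[OF assms(2)] chain_mapD(1-3)[OF assms(3,1,2)]
  by (intro homotopicI[OF assms(1,2), where h = "\<lambda>n. Zero C (ob X n) (ob Y (n - 1))"]) (auto
    simp: Hom_iff)

lemma homotopic_sym:
  assumes "is_complex C X" "is_complex C Y" "chain_map C X Y \<phi>" "chain_map C X Y \<psi>"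
    and "homotopic C X Y \<phi> \<psi>"
  shows "homotopic C X Y \<psi> \<phi>"
proof -
  obtain h where "htpy X Y \<phi> \<psi> h"
    by (rule homotopicE[OF assms(5,1,2,4)])
  note h = htpyD[OF this]
  show ?thesis
    using complexD[OF assms(1)] complexD[OF assms(2)] chain_mapD(1-3)[OF assms(3,1,2)]
      chain_mapD(1-3)[OF assms(4,1,2)] h
    by (intro homotopicI[OF assms(1,2), where h = "\<lambda>n. Neg C (h n)"]) (auto simp: Hom_iff)
qed

lemma homotopic_trans:
  assumes "is_complex C X" "is_complex C Y" "chain_map C X Y \<phi>" "chain_map C X Y \<psi>"
    "chain_map C X Y \<theta>"
    and "homotopic C X Y \<phi> \<psi>" "homotopic C X Y \<psi> \<theta>"
  shows "homotopic C X Y \<phi> \<theta>"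
proof -
  obtain h where "htpy X Y \<phi> \<psi> h"
    by (rule homotopicE[OF assms(6,1,2,4)])
  note h = htpyD[OF this]
  obtain k where "htpy X Y \<psi> \<theta> k"
    by (rule homotopicE[OF assms(7,1,2,5)])
  note k = htpyD[OF this]
  show ?thesis
    using h k complexD[OF assms(1)] complexD[OF assms(2)] chain_mapD(1-3)[OF assms(3,1,2)]
      chain_mapD(1-3)[OF assms(5,1,2)]
    by (intro homotopicI[OF assms(1,2), where h = "\<lambda>n. Plus C (h n) (k n)"])
      (auto simp: Hom_iff algebra_simps)
qed

lemma chain_map_Comp:
  assumes "is_complex C X" "is_complex C Y" "is_complex C Z" "chain_map C X Y \<phi>" "chain_map C Y Z \<gamma>"
  shows "chain_map C X Z (\<lambda>n. Comp C (\<gamma> n) (\<phi> n))"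
  using chain_mapD[OF assms(4,1,2)] chain_mapD[OF assms(5,2,3)] assms
  by (intro chain_mapI) (auto simp: Hom_iff mult.assoc)

lemma chain_map_Plus:
  assumes "is_complex C X" "is_complex C Y" "chain_map C X Y \<phi>" "chain_map C X Y \<gamma>"
  shows "chain_map C X Y (\<lambda>n. Plus C (\<phi> n) (\<gamma> n))"
  using chain_mapD[OF assms(3,1,2)] chain_mapD[OF assms(4,1,2)] assms
  by (intro chain_mapI) (auto simp: Hom_iff algebra_simps)

lemma chain_map_Neg:
  assumes "is_complex C X" "is_complex C Y" "chain_map C X Y \<phi>"
  shows "chain_map C X Y (\<lambda>n. Neg C (\<phi> n))"
  using chain_mapD[OF assms(3,1,2)] assms
  by (intro chain_mapI) (auto simp: Hom_iff)

lemma chain_map_Ident: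
  assumes "is_complex C X"
  shows "chain_map C X X (\<lambda>n. Ident C (ob X n))"
  using complexD[OF assms] assms by (intro chain_mapI) (auto simp: Hom_iff)

lemma chain_map_Zero:
  assumes "is_complex C X" "is_complex C Y"
  shows "chain_map C X Y (\<lambda>n. Zero C (ob X n) (ob Y n))"
  using complexD[OF assms(1)] complexD[OF assms(2)] assms by (intro chain_mapI) (auto simp: Hom_iff)

lemma homotopic_Comp:
  assumes X: "is_complex C X" "is_complex C Y" "is_complex C Z" "chain_map C X Y \<phi>"
    "chain_map C Y Z \<gamma>"
    "chain_map C X Y \<phi>'" "chain_map C Y Z \<gamma>'"
    and "homotopic C X Y \<phi> \<phi>'" "homotopic C Y Z \<gamma> \<gamma>'"
  shows "homotopic C X Z (\<lambda>n. Comp C (\<gamma> n) (\<phi> n)) (\<lambda>n. Comp C (\<gamma>' n) (\<phi>' n))"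
proof -
  obtain h where "htpy X Y \<phi> \<phi>' h"
    by (rule homotopicE[OF assms(8) X(1,2,6)])
  note h = htpyD[OF this]
  obtain k where "htpy Y Z \<gamma> \<gamma>' k"
    by (rule homotopicE[OF assms(9) X(2,3,7)])
  note k = htpyD[OF this]
  note [simp] = h(1-3) k(1-3) complexD[OF X(1)] complexD[OF X(2)] complexD[OF X(3)]
    chain_mapD[OF X(4,1,2)] chain_mapD[OF X(5,2,3)] chain_mapD[OF X(6,1,2)] chain_mapD[OF X(7,2,3)]
  show ?thesis
  \<comment> \<open>The homotopy comes from \<open>\<gamma> \<phi> - \<gamma>' \<phi>' = (\<gamma> -
    \<gamma>') \<phi> + \<gamma>' (\<phi> - \<phi>')\<close>.\<close>
  proof (rule homotopicI[OF X(1,3), where h = "\<lambda>n. Plus C (Comp C (\<gamma>' (n - 1)) (h n)) (Comp C (k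
    n) (\<phi> n))"])
    fix n
    have "rep (\<gamma> n) * rep (\<phi> n) = rep (\<gamma>' n) * rep (\<phi> n) +
      (rep (df Z (n - 1)) * rep (k n) + rep (k (n + 1)) * rep (df Y n)) * rep (\<phi> n)"
      by (subst k(4)) (simp only: distrib_right)
    moreover have "rep (\<gamma>' n) * rep (\<phi> n) = rep (\<gamma>' n) * rep (\<phi>' n) +
      rep (\<gamma>' n) * (rep (df Y (n - 1)) * rep (h n) + rep (h (n + 1)) * rep (df X n))"
      by (subst h(4)) (simp only: distrib_left)
    ultimately show "rep (Comp C (\<gamma> n) (\<phi> n)) = rep (Comp C (\<gamma>' n) (\<phi>' n)) +
         (rep (df Z (n - 1)) * rep (Plus C (Comp C (\<gamma>' (n - 1)) (h n)) (Comp C (k n) (\<phi> n))) +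
          rep (Plus C (Comp C (\<gamma>' (n + 1 - 1)) (h (n + 1))) (Comp C (k (n + 1)) (\<phi> (n + 1)))) *
          rep (df X n))"
      by (simp add: algebra_simps)
  qed (auto simp: Hom_iff)
qed

lemma homotopic_Plus:
  assumes X: "is_complex C X" "is_complex C Y" "chain_map C X Y \<phi>" "chain_map C X Y \<gamma>"
    "chain_map C X Y \<phi>'" "chain_map C X Y \<gamma>'"
    and "homotopic C X Y \<phi> \<phi>'" "homotopic C X Y \<gamma> \<gamma>'"
  shows "homotopic C X Y (\<lambda>n. Plus C (\<phi> n) (\<gamma> n)) (\<lambda>n. Plus C (\<phi>' n) (\<gamma>' n))"
proof -
  obtain h where "htpy X Y \<phi> \<phi>' h"
    by (rule homotopicE[OF assms(7) X(1,2,5)])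
  note h = htpyD[OF this]
  obtain k where "htpy X Y \<gamma> \<gamma>' k"
    by (rule homotopicE[OF assms(8) X(1,2,6)])
  note k = htpyD[OF this]
  note [simp] = h(1-3) k(1-3) complexD[OF X(1)] complexD[OF X(2)]
    chain_mapD(1-3)[OF X(3,1,2)] chain_mapD(1-3)[OF X(4,1,2)] chain_mapD(1-3)[OF X(5,1,2)]
      chain_mapD(1-3)[OF X(6,1,2)]
  show ?thesis
    by (rule homotopicI[OF X(1,2), where h = "\<lambda>n. Plus C (h n) (k n)"])
      (simp_all add: Hom_iff h(4) k(4) algebra_simps)
qed

lemma htpy_arrow_eq_iff:
  assumes "is_complex C X" "is_complex C Y" "chain_map C X Y \<phi>" "chain_map C X Y \<psi>"
  shows "htpy_arrow C X Y \<phi> = htpy_arrow C X Y \<psi> \<longleftrightarrow> homotopic C X Y \<phi> \<psi>"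
proof
  assume "htpy_arrow C X Y \<phi> = htpy_arrow C X Y \<psi>"
  then show "homotopic C X Y \<phi> \<psi>"
    using homotopic_refl[OF assms(1,2,4)] assms by (auto simp: htpy_arrow_def)
next
  assume "homotopic C X Y \<phi> \<psi>"
  then show "htpy_arrow C X Y \<phi> = htpy_arrow C X Y \<psi>"
    unfolding htpy_arrow_def using assms homotopic_sym homotopic_trans by blast
qed

lemma htpy_arrow_eqD:
  assumes "htpy_arrow C X Y \<phi> = htpy_arrow C X' Y' \<psi>"
  shows "X = X'" "Y = Y'"
  using assms by (auto simp: htpy_arrow_def)

section \<open>The homotopy category and its right bounded part are preadditive\<close>

lemma Dom_htpy [simp]: "Dom (K_cat C) (htpy_arrow C X Y \<phi>) = X"
  and Cod_htpy [simp]: "Cod (K_cat C) (htpy_arrow C X Y \<phi>) = Y"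
  by (simp_all add: K_cat_def htpy_arrow_def)

lemma Obj_K: "Obj (K_cat C) = {X. is_complex C X}"
  by (simp add: K_cat_def)

lemma Arr_K: "Arr (K_cat C) = {htpy_arrow C X Y \<phi> | X Y \<phi>. is_complex C X \<and> is_complex C Y \<and>
  chain_map C X Y \<phi>}"
  by (simp add: K_cat_def)

lemma Hom_K:
  "Hom (K_cat C) X Y = {htpy_arrow C X Y \<phi> | \<phi>. is_complex C X \<and> is_complex C Y \<and>
    chain_map C X Y \<phi>}"
  by (auto simp: Hom_def Arr_K)

lemma Ident_K: "Ident (K_cat C) X = htpy_arrow C X X (\<lambda>n. Ident C (ob X n))"
  and Zero_K: "Zero (K_cat C) X Y = htpy_arrow C X Y (\<lambda>n. Zero C (ob X n) (ob Y n))"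
  by (simp_all add: K_cat_def)

text \<open>Composition of classes ranges over all pairs of representatives; compatibility with
  homotopy collapses this union to the class of a single composite. The same holds for sums in
  \<open>Plus_htpy\<close>.\<close>

lemma Comp_htpy:
  assumes X: "is_complex C X" "is_complex C Y" "is_complex C Z" "chain_map C X Y \<phi>"
    "chain_map C Y Z \<gamma>"
  shows "Comp (K_cat C) (htpy_arrow C Y Z \<gamma>) (htpy_arrow C X Y \<phi>) =
    htpy_arrow C X Z (\<lambda>n. Comp C (\<gamma> n) (\<phi> n))"
proof -
  have "(\<exists>\<phi>'\<in>{\<psi>. chain_map C X Y \<psi> \<and> homotopic C X Y \<phi> \<psi>}.
      \<exists>\<gamma>'\<in>{\<psi>. chain_map C Y Z \<psi> \<and> homotopic C Y Z \<gamma> \<psi>}.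
        homotopic C X Z (\<lambda>n. Comp C (\<gamma>' n) (\<phi>' n)) \<theta>) \<longleftrightarrow>
    homotopic C X Z (\<lambda>n. Comp C (\<gamma> n) (\<phi> n)) \<theta>" (is "?L \<theta> \<longleftrightarrow> ?R \<theta>")
    if t: "chain_map C X Z \<theta>" for \<theta>
  proof
    assume "?R \<theta>"
    then show "?L \<theta>"
      using X homotopic_refl by blast
  next
    assume "?L \<theta>"
    then obtain \<phi>' \<gamma>' where a: "chain_map C X Y \<phi>'" "homotopic C X Y \<phi> \<phi>'" "chain_map C Y Z \<gamma>'"
      "homotopic C Y Z \<gamma> \<gamma>'" "homotopic C X Z (\<lambda>n. Comp C (\<gamma>' n) (\<phi>' n)) \<theta>"
      by auto
    then show "?R \<theta>"
      using homotopic_Comp[OF X a(1,3,2,4)] t chain_map_Comp[OF X] chain_map_Comp[OF X(1-3) a(1,3)]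
      by (intro homotopic_trans[OF X(1,3) _ _ _ _ a(5)])
  qed
  then show ?thesis by (auto simp: K_cat_def htpy_arrow_def)
qed

lemma Plus_htpy:
  assumes X: "is_complex C X" "is_complex C Y" "chain_map C X Y \<phi>" "chain_map C X Y \<gamma>"
  shows "Plus (K_cat C) (htpy_arrow C X Y \<phi>) (htpy_arrow C X Y \<gamma>) =
    htpy_arrow C X Y (\<lambda>n. Plus C (\<phi> n) (\<gamma> n))"
proof -
  have "(\<exists>\<phi>'\<in>{\<psi>. chain_map C X Y \<psi> \<and> homotopic C X Y \<phi> \<psi>}.
      \<exists>\<gamma>'\<in>{\<psi>. chain_map C X Y \<psi> \<and> homotopic C X Y \<gamma> \<psi>}.
        homotopic C X Y (\<lambda>n. Plus C (\<phi>' n) (\<gamma>' n)) \<theta>) \<longleftrightarrow>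
    homotopic C X Y (\<lambda>n. Plus C (\<phi> n) (\<gamma> n)) \<theta>" (is "?L \<theta> \<longleftrightarrow> ?R \<theta>")
    if t: "chain_map C X Y \<theta>" for \<theta>
  proof
    assume "?R \<theta>"
    then show "?L \<theta>"
      using X homotopic_refl by blast
  next
    assume "?L \<theta>"
    then obtain \<phi>' \<gamma>' where a: "chain_map C X Y \<phi>'" "homotopic C X Y \<phi> \<phi>'" "chain_map C X Y \<gamma>'"
      "homotopic C X Y \<gamma> \<gamma>'" "homotopic C X Y (\<lambda>n. Plus C (\<phi>' n) (\<gamma>' n)) \<theta>"
      by auto
    then show "?R \<theta>"
      using homotopic_Plus[OF X a(1,3,2,4)] t chain_map_Plus[OF X] chain_map_Plus[OF X(1,2) a(1,3)]
      by (intro homotopic_trans[OF X(1,2) _ _ _ _ a(5)])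
  qed
  then show ?thesis by (auto simp: K_cat_def htpy_arrow_def)
qed

lemma homotopicI_eq:
  assumes "is_complex C X" "is_complex C Y" "chain_map C X Y \<phi>" "chain_map C X Y \<psi>"
    and "\<And>n. rep (\<phi> n) = rep (\<psi> n)"
  shows "homotopic C X Y \<phi> \<psi>"
proof -
  have "\<phi> n = \<psi> n" for n
    using assms chain_mapD[OF assms(3,1,2)] chain_mapD[OF assms(4,1,2)] by (intro rep_eqI) auto
  then have "\<phi> = \<psi>" by blast
  then show ?thesis using homotopic_refl assms by blast
qed

lemma preadditive_K: "preadditive_category (K_cat C)"
proof (intro preadditive_category.intro category.intro preadditive_category_axioms.intro)
  fix f assume "f \<in> Arr (K_cat C)"
  then show "Dom (K_cat C) f \<in> Obj (K_cat C)" "Cod (K_cat C) f \<in> Obj (K_cat C)"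
    by (auto simp: Arr_K Obj_K)
next
  fix A assume "A \<in> Obj (K_cat C)"
  then show "Ident (K_cat C) A \<in> Hom (K_cat C) A A"
    by (auto simp: Obj_K Hom_K Ident_K chain_map_Ident)
next
  fix f A B g D assume "f \<in> Hom (K_cat C) A B" "g \<in> Hom (K_cat C) B D"
  then show "Comp (K_cat C) g f \<in> Hom (K_cat C) A D"
    using chain_map_Comp by (fastforce simp: Hom_K Comp_htpy)
next
  fix f A B assume "f \<in> Hom (K_cat C) A B"
  then obtain \<phi> where f: "f = htpy_arrow C A B \<phi>" "is_complex C A" "is_complex C B"
    "chain_map C A B \<phi>"
    by (auto simp: Hom_K)
  note [simp] = chain_mapD[OF f(4,2,3)]
  show "Comp (K_cat C) (Ident (K_cat C) B) f = f"
    using f by (simp add: Ident_K Comp_htpy chain_map_Ident)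
  show "Comp (K_cat C) f (Ident (K_cat C) A) = f"
    using f by (simp add: Ident_K Comp_htpy chain_map_Ident)
next
  fix f A B g D h E
  assume "f \<in> Hom (K_cat C) A B" "g \<in> Hom (K_cat C) B D" "h \<in> Hom (K_cat C) D E"
  then obtain \<phi> \<gamma> \<eta> where f: "f = htpy_arrow C A B \<phi>" "is_complex C A" "is_complex C B"
    "chain_map C A B \<phi>"
    and g: "g = htpy_arrow C B D \<gamma>" "is_complex C D" "chain_map C B D \<gamma>"
    and h: "h = htpy_arrow C D E \<eta>" "is_complex C E" "chain_map C D E \<eta>"
    by (auto simp: Hom_K)
  note [simp] = chain_mapD[OF f(4,2,3)] chain_mapD[OF g(3) f(3) g(2)] chain_mapD[OF h(3) g(2) h(2)]
  show "Comp (K_cat C) (Comp (K_cat C) h g) f = Comp (K_cat C) h (Comp (K_cat C) g f)"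
    using f g h by (simp add: Comp_htpy chain_map_Comp Comp_assoc')
next
  fix A B assume "A \<in> Obj (K_cat C)" "B \<in> Obj (K_cat C)"
  then have AB: "is_complex C A" "is_complex C B" by (auto simp: Obj_K)
  note [simp] = complexD[OF AB(1)] complexD[OF AB(2)]
  have c: "carrier (hom_group (K_cat C) A B) = {htpy_arrow C A B \<phi> | \<phi>. chain_map C A B \<phi>}"
    using AB by (auto simp: hom_group_def Hom_K)
  have m: "mult (hom_group (K_cat C) A B) (htpy_arrow C A B \<phi>) (htpy_arrow C A B \<psi>) =
    htpy_arrow C A B (\<lambda>n. Plus C (\<phi> n) (\<psi> n))" if "chain_map C A B \<phi>" "chain_map C A B \<psi>" for \<phi> \<psi>
    using AB that by (simp add: hom_group_def Plus_htpy)
  have o: "one (hom_group (K_cat C) A B) = htpy_arrow C A B (\<lambda>n. Zero C (ob A n) (ob B n))"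
    by (simp add: hom_group_def Zero_K)
  note cm = chain_map_Plus[OF AB] chain_map_Zero[OF AB] chain_map_Neg[OF AB]
  note D = chain_mapD(1-3)[OF _ AB]
  show "comm_group (hom_group (K_cat C) A B)"
  proof (rule comm_groupI)
    fix x y assume "x \<in> carrier (hom_group (K_cat C) A B)" "y \<in> carrier (hom_group (K_cat C) A B)"
    then obtain \<phi> \<psi> where xy: "x = htpy_arrow C A B \<phi>" "y = htpy_arrow C A B \<psi>"
      "chain_map C A B \<phi>" "chain_map C A B \<psi>"
      by (auto simp: c)
    show "x \<otimes>\<^bsub>hom_group (K_cat C) A B\<^esub> y \<in> carrier (hom_group (K_cat C) A B)"
      using xy cm by (auto simp: m c)
    show "x \<otimes>\<^bsub>hom_group (K_cat C) A B\<^esub> y = y \<otimes>\<^bsub>hom_group (K_cat C) A B\<^esub> x"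
      using xy D[OF xy(3)] D[OF xy(4)] AB cm
      by (auto simp: m htpy_arrow_eq_iff algebra_simps intro!: homotopicI_eq)
    fix z assume "z \<in> carrier (hom_group (K_cat C) A B)"
    then obtain \<theta> where z: "z = htpy_arrow C A B \<theta>" "chain_map C A B \<theta>"
      by (auto simp: c)
    show "x \<otimes>\<^bsub>hom_group (K_cat C) A B\<^esub> y \<otimes>\<^bsub>hom_group (K_cat C) A B\<^esub> z =
       x \<otimes>\<^bsub>hom_group (K_cat C) A B\<^esub> (y \<otimes>\<^bsub>hom_group (K_cat C) A B\<^esub> z)"
      using xy z D[OF xy(3)] D[OF xy(4)] D[OF z(2)] AB cm
      by (auto simp: m htpy_arrow_eq_iff algebra_simps intro!: homotopicI_eq)
  next
    show "\<one>\<^bsub>hom_group (K_cat C) A B\<^esub> \<in> carrier (hom_group (K_cat C) A B)"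
      using cm by (auto simp: o c)
    fix x assume "x \<in> carrier (hom_group (K_cat C) A B)"
    then obtain \<phi> where x: "x = htpy_arrow C A B \<phi>" "chain_map C A B \<phi>"
      by (auto simp: c)
    show "\<one>\<^bsub>hom_group (K_cat C) A B\<^esub> \<otimes>\<^bsub>hom_group (K_cat C) A B\<^esub> x = x"
      using x D[OF x(2)] AB cm by (auto simp: m o htpy_arrow_eq_iff algebra_simps intro!:
        homotopicI_eq)
    show "\<exists>y\<in>carrier (hom_group (K_cat C) A B). y \<otimes>\<^bsub>hom_group (K_cat C) A B\<^esub> x = \<one>\<^bsub>hom_group
      (K_cat C) A B\<^esub>"
      using x D[OF x(2)] AB cm
      by (intro bexI[of _ "htpy_arrow C A B (\<lambda>n. Neg C (\<phi> n))"])
        (auto simp: m o c htpy_arrow_eq_iff algebra_simps intro!: homotopicI_eq)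
  qed
next
  fix f A B g D h
  assume "f \<in> Hom (K_cat C) A B" "g \<in> Hom (K_cat C) B D" "h \<in> Hom (K_cat C) B D"
  then obtain \<phi> \<gamma> \<eta> where f: "f = htpy_arrow C A B \<phi>" "is_complex C A" "is_complex C B"
    "chain_map C A B \<phi>"
    and g: "g = htpy_arrow C B D \<gamma>" "is_complex C D" "chain_map C B D \<gamma>"
    and h: "h = htpy_arrow C B D \<eta>" "chain_map C B D \<eta>"
    by (auto simp: Hom_K)
  note [simp] = chain_mapD(1-3)[OF f(4,2,3)] chain_mapD(1-3)[OF g(3) f(3) g(2)]
    chain_mapD(1-3)[OF h(2) f(3) g(2)]
  show "Comp (K_cat C) (Plus (K_cat C) g h) f = Plus (K_cat C) (Comp (K_cat C) g f) (Comp (K_cat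
    C) h f)"
    using f g h
    by (auto simp: Comp_htpy Plus_htpy chain_map_Comp chain_map_Plus htpy_arrow_eq_iff
      algebra_simps intro!: homotopicI_eq)
next
  fix f A B g D h
  assume "f \<in> Hom (K_cat C) A B" "g \<in> Hom (K_cat C) A B" "h \<in> Hom (K_cat C) B D"
  then obtain \<phi> \<gamma> \<eta> where f: "f = htpy_arrow C A B \<phi>" "is_complex C A" "is_complex C B"
    "chain_map C A B \<phi>"
    and g: "g = htpy_arrow C A B \<gamma>" "chain_map C A B \<gamma>"
    and h: "h = htpy_arrow C B D \<eta>" "is_complex C D" "chain_map C B D \<eta>"
    by (auto simp: Hom_K)
  note [simp] = chain_mapD(1-3)[OF f(4,2,3)] chain_mapD(1-3)[OF g(2) f(2,3)]
    chain_mapD(1-3)[OF h(3) f(3) h(2)]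
  show "Comp (K_cat C) h (Plus (K_cat C) f g) = Plus (K_cat C) (Comp (K_cat C) h f) (Comp (K_cat
    C) h g)"
    using f g h
    by (auto simp: Comp_htpy Plus_htpy chain_map_Comp chain_map_Plus htpy_arrow_eq_iff
      algebra_simps intro!: homotopicI_eq)
qed

lemma preadditive_full_subcategory: "preadditive_category (full_subcategory C P)"
proof -
  have "hom_group (full_subcategory C P) A B = hom_group C A B" if "A \<in> P" "B \<in> P" for A B
    using that by (auto simp: hom_group_def full_subcategory_def Hom_def)
  then have "A \<in> Obj (full_subcategory C P) \<Longrightarrow> B \<in> Obj (full_subcategory C P) \<Longrightarrow>
      comm_group (hom_group (full_subcategory C P) A B)" for A B
    by (auto simp: hom_comm_group full_subcategory_def)
  then show ?thesis
    by (intro preadditive_category.intro category.intro preadditive_category_axioms.intro)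
      (auto simp: full_subcategory_def Hom_def Comp_assoc' intro: Comp_Plus_left Comp_Plus_right
        simp: Hom_iff)
qed

lemma preadditive_K_minus: "preadditive_category (K_minus C)"
  unfolding K_minus_def by (rule preadditive_category.preadditive_full_subcategory[OF
    preadditive_K])

lemma K_minus_simps:
  "Obj (K_minus C) = {X. is_complex C X \<and> X \<in> K_minus_obj C}"
  "Dom (K_minus C) = Dom (K_cat C)" "Cod (K_minus C) = Cod (K_cat C)"
  "Comp (K_minus C) = Comp (K_cat C)" "Plus (K_minus C) = Plus (K_cat C)"
  "Ident (K_minus C) = Ident (K_cat C)" "Zero (K_minus C) = Zero (K_cat C)"
  "Arr (K_minus C) = {htpy_arrow C X Y \<phi> | X Y \<phi>. is_complex C X \<and> is_complex C Y \<and>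
    X \<in> K_minus_obj C \<and>
     Y \<in> K_minus_obj C \<and> chain_map C X Y \<phi>}"
  by (auto simp: K_minus_def full_subcategory_def Obj_K Arr_K) (metis Dom_htpy Cod_htpy)+

end

section \<open>Exactness and quasi-isomorphisms by generalized elements\<close>

context abelian_category
begin

text \<open>Arrows \<open>a : A \<rightarrow> X\<^sup>n\<close> serve as elements of \<open>X\<^sup>n\<close>; passing to a finer cover of \<open>A\<close> by an epic
  arrow \<open>e\<close> replaces the choice of preimages.\<close>

definition boundary :: "('a, 'b) cochain \<Rightarrow> int \<Rightarrow> 'a \<Rightarrow> 'b \<Rightarrow> bool" where
  "boundary X n A a \<longleftrightarrow> (\<exists>A' e b. epic C e \<and> e \<in> Hom C A' A \<and> b \<in> Hom C A' (ob X (n - 1)) \<and>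
     rep a * rep e = rep (df X (n - 1)) * rep b)"

definition exact_at :: "('a, 'b) cochain \<Rightarrow> int \<Rightarrow> bool" where
  "exact_at X n \<longleftrightarrow>
     (\<forall>A a. a \<in> Hom C A (ob X n) \<and> rep (df X n) * rep a = 0 \<longrightarrow> boundary X n A a)"

text \<open>Boundaries, and exactness, of the mapping cone of \<open>\<phi>\<close> in degree \<open>n\<close>, with the sign of \<open>x\<close>
  reversed.\<close>

definition cone_boundary ::
  "('a, 'b) cochain \<Rightarrow> ('a, 'b) cochain \<Rightarrow> (int \<Rightarrow> 'b) \<Rightarrow> int \<Rightarrow> 'a \<Rightarrow> 'b \<Rightarrow> 'b \<Rightarrow> bool" where
  "cone_boundary X Y \<phi> n A x y \<longleftrightarrow> (\<exists>A' e x' y'. epic C e \<and> e \<in> Hom C A' A \<and>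
     x' \<in> Hom C A' (ob X n) \<and> y' \<in> Hom C A' (ob Y (n - 1)) \<and> rep x * rep e = rep (df X n) * rep x' \<and>
     rep y * rep e = rep (\<phi> n) * rep x' + rep (df Y (n - 1)) * rep y')"

definition qis_at :: "('a, 'b) cochain \<Rightarrow> ('a, 'b) cochain \<Rightarrow> (int \<Rightarrow> 'b) \<Rightarrow> int \<Rightarrow> bool" where
  "qis_at X Y \<phi> n \<longleftrightarrow> (\<forall>A x y. x \<in> Hom C A (ob X (n + 1)) \<and> y \<in> Hom C A (ob Y n) \<and>
     rep (df X (n + 1)) * rep x = 0 \<and> rep (\<phi> (n + 1)) * rep x = rep (df Y n) * rep y \<longrightarrow>
     cone_boundary X Y \<phi> n A x y)"

lemma exact_atE:
  assumes "exact_at X n" and "a \<in> Hom C A (ob X n)" and "rep (df X n) * rep a = 0"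
  obtains A' e b where "epic C e" "dom e = A'" "cod e = A" "arr b" "dom b = A'"
    "cod b = ob X (n - 1)" "rep a * rep e = rep (df X (n - 1)) * rep b"
  using assms unfolding exact_at_def boundary_def Hom_iff by blast

lemma qis_atE:
  assumes "qis_at X Y \<phi> n" and "x \<in> Hom C A (ob X (n + 1))" and "y \<in> Hom C A (ob Y n)"
    and "rep (df X (n + 1)) * rep x = 0" and "rep (\<phi> (n + 1)) * rep x = rep (df Y n) * rep y"
  obtains A' e x' y' where "epic C e" "dom e = A'" "cod e = A"
    "arr x'" "dom x' = A'" "cod x' = ob X n" "arr y'" "dom y' = A'" "cod y' = ob Y (n - 1)"
    "rep x * rep e = rep (df X n) * rep x'"
    "rep y * rep e = rep (\<phi> n) * rep x' + rep (df Y (n - 1)) * rep y'"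
  using assms unfolding qis_at_def cone_boundary_def Hom_iff by blast

lemma exact_atI:
  assumes "\<And>A a. arr a \<Longrightarrow> dom a = A \<Longrightarrow> cod a = ob X n \<Longrightarrow> A \<in> Obj C \<Longrightarrow>
    rep (df X n) * rep a = 0 \<Longrightarrow> boundary X n A a"
  shows "exact_at X n"
  using assms Dom_Obj unfolding exact_at_def Hom_iff by metis

lemma qis_atI:
  assumes "\<And>A x y. arr x \<Longrightarrow> dom x = A \<Longrightarrow> cod x = ob X (n + 1) \<Longrightarrow> arr y \<Longrightarrow>
     dom y = A \<Longrightarrow> cod y = ob Y n \<Longrightarrow> A \<in> Obj C \<Longrightarrow> rep (df X (n + 1)) * rep x = 0 \<Longrightarrow>
     rep (\<phi> (n + 1)) * rep x = rep (df Y n) * rep y \<Longrightarrow> cone_boundary X Y \<phi> n A x y"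
  shows "qis_at X Y \<phi> n"
  using assms Dom_Obj unfolding qis_at_def Hom_iff by metis

lemma boundaryI:
  assumes "epic C e" and "dom e = A'" and "cod e = A" and "b \<in> Hom C A' (ob X (n - 1))"
    and "rep a * rep e = rep (df X (n - 1)) * rep b"
  shows "boundary X n A a"
  using assms unfolding boundary_def Hom_iff by (metis epic_Arr)

lemma cone_boundaryI:
  assumes "epic C e" and "dom e = A'" and "cod e = A" and "x' \<in> Hom C A' (ob X n)"
    and "y' \<in> Hom C A' (ob Y (n - 1))" and "rep x * rep e = rep (df X n) * rep x'"
    and "rep y * rep e = rep (\<phi> n) * rep x' + rep (df Y (n - 1)) * rep y'"
  shows "cone_boundary X Y \<phi> n A x y"
  using assms unfolding cone_boundary_def Hom_iff by (metis epic_Arr)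

text \<open>If the cohomology vanishes, the arrow \<open>u\<close> to the cycles is epic, and a
  cycle becomes a boundary on the pullback of \<open>u\<close>. Conversely, exactness is applied to
  the generic cycle, the kernel arrow \<open>k\<close> itself: the resulting cover \<open>e\<close>
  factors through \<open>u\<close>, which is therefore epic.\<close>

lemma cohomology_zero_iff:
  assumes X: "is_complex C X"
  shows "cohomology_zero C X n \<longleftrightarrow> exact_at X n"
proof
  note [simp] = complexD[OF X]
  assume "cohomology_zero C X n"
  then obtain k u p where k: "is_kernel C (df X n) k"
     and u: "u \<in> Hom C (ob X (n - 1)) (dom k)" "Comp C k u = df X (n - 1)"
     and p: "is_cokernel C u p" "zero_object C (cod p)"
    unfolding cohomology_zero_def is_cohomology_def by blast
  note kD = kernelD[OF k]
  have uD: "arr u" "dom u = ob X (n - 1)" "cod u = dom k" using u by (auto simp: Hom_iff)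
  have ku: "rep k * rep u = rep (df X (n - 1))" using u(2) uD kD by (simp flip: rep_Comp)
  have e: "epic C u" using p cokernel_of_epic by blast
  show "exact_at X n"
  proof (rule exact_atI)
    fix A a assume a: "arr a" "dom a = A" "cod a = ob X n" "rep (df X n) * rep a = 0"
    obtain a' where a': "arr a'" "dom a' = A" "cod a' = dom k" "rep k * rep a' = rep a"
      using kernel_factor[OF k a(1)] a by auto
    obtain q b where q: "epic C q" "cod q = dom a'" "arr b" "dom b = dom q"
      "cod b = dom u" "rep u * rep b = rep a' * rep q"
      using pullback_epic[OF e a'(1)] a' uD by auto
    have "rep a * rep q = rep (df X (n - 1)) * rep b"
      using q(6) by (simp add: mult.assoc flip: a'(4) ku)
    then show "boundary X n A a"
      using q a' uD unfolding boundary_def Hom_iff by (metis epic_Arr)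
  qed
next
  note [simp] = complexD[OF X]
  assume ex: "exact_at X n"
  obtain k where k: "is_kernel C (df X n) k" using kernel_exists[of "df X n"] by auto
  note kD = kernelD[OF k]
  obtain u where u: "arr u" "dom u = ob X (n - 1)" "cod u = dom k"
    "rep k * rep u = rep (df X (n - 1))"
    using kernel_factor[OF k, of "df X (n - 1)"] by auto
  have kk: "k \<in> Hom C (dom k) (ob X n)" using kD by (simp add: Hom_iff)
  obtain A' e b where e: "epic C e" "dom e = A'" "cod e = dom k" "arr b" "dom b = A'"
    "cod b = ob X (n - 1)" "rep k * rep e = rep (df X (n - 1)) * rep b"
    by (rule exact_atE[OF ex kk kD(4)]) blast
  have "rep e = rep (Comp C u b)"
    using kD e u by (intro monic_cancel[OF kD(5)]) (simp_all flip: mult.assoc)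
  then have ec: "e = Comp C u b" using e u by (intro rep_eqI) auto
  have "epic C u" by (rule epic_factor[OF e(1) u(1) e(4) _ ec]) (use e u in simp)
  moreover obtain p where p: "is_cokernel C u p" using cokernel_exists u by blast
  ultimately have "zero_object C (cod p)" using cokernel_of_epic by blast
  moreover have "Comp C k u = df X (n - 1)" using u kD by (intro rep_eqI) auto
  ultimately show "cohomology_zero C X n"
    unfolding cohomology_zero_def is_cohomology_def Hom_iff using k u p by blast
qed

lemma exact_at_zero_object:
  assumes X: "is_complex C X" and z: "zero_object C (ob X n)"
  shows "exact_at X n"
proof (rule exact_atI)
  note [simp] = complexD[OF X]
  fix A a assume a: "arr a" "dom a = A" "cod a = ob X n" "A \<in> Obj C"
  then show "boundary X n A a"
    using rep_zero_object(2)[OF z a(1)]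
    by (intro boundaryI[of "Ident C A" A A "Zero C A (ob X (n - 1))"]) (simp_all add: Hom_iff)
qed

text \<open>On a cycle \<open>a\<close> the homotopy reads \<open>a = g f a - d h a\<close>, since
  the term with \<open>d a\<close> vanishes. So a preimage of \<open>f a\<close> under the
  differential of \<open>Y\<close>, on some cover, gives one of \<open>a\<close>.\<close>

lemma exact_at_retract:
  assumes X: "is_complex C X" "is_complex C Y" and f: "chain_map C X Y f" and g: "chain_map C Y X g"
    and gf: "homotopic C X X (\<lambda>n. Comp C (g n) (f n)) (\<lambda>n. Ident C (ob X n))"
    and ex: "exact_at Y n"
  shows "exact_at X n"
proof (rule exact_atI)
  note [simp] = complexD[OF X(1)] complexD[OF X(2)] chain_mapD[OF f X] chain_mapD[OF g X(2,1)]
  obtain h where "htpy X X (\<lambda>n. Comp C (g n) (f n)) (\<lambda>n. Ident C (ob X n)) h"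
    by (rule homotopicE[OF gf X(1,1) chain_map_Ident[OF X(1)]])
  note h = htpyD[OF this]
  fix A a assume a: "arr a" "dom a = A" "cod a = ob X n" "rep (df X n) * rep a = 0"
  have "rep (g n) * (rep (f n) * rep a) = rep a + (rep (df X (n - 1)) * (rep (h n) * rep a))"
    using arg_cong[OF h(4)[of n], of "\<lambda>y. y * rep a"] a by (simp add: distrib_right mult.assoc)
  then have ga: "rep a = rep (g n) * (rep (f n) * rep a) - (rep (df X (n - 1)) * (rep (h n) * rep
    a))"
    by simp
  have "rep (df Y n) * rep (Comp C (f n) a) = rep (f (n + 1)) * (rep (df X n) * rep a)"
    using a(1-3) by simp
  then have 0: "rep (df Y n) * rep (Comp C (f n) a) = 0" using a(4) by (simp only: mult_zero_right)
  have 1: "Comp C (f n) a \<in> Hom C A (ob Y n)" using a by (simp add: Hom_iff)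
  obtain A' e b where e: "epic C e" "dom e = A'" "cod e = A" "arr b" "dom b = A'"
    "cod b = ob Y (n - 1)" "rep (Comp C (f n) a) * rep e = rep (df Y (n - 1)) * rep b"
    by (rule exact_atE[OF ex 1 0]) blast
  define b' where "b' = Plus C (Comp C (g (n - 1)) b) (Neg C (Comp C (h n) (Comp C a e)))"
  have "rep (f n) * (rep a * rep e) = rep (df Y (n - 1)) * rep b" using e(7) a
    by (simp add: mult.assoc)
  then have "rep a * rep e = rep (df X (n - 1)) * rep b'"
    using e a h(1-3) chain_mapD(5)[OF g X(2,1), of n "n - 1" "rep b"]
    by (subst ga) (simp add: b'_def algebra_simps)
  moreover have "b' \<in> Hom C A' (ob X (n - 1))" using e a h(1-3) by (simp add: b'_def Hom_iff)
  ultimately show "boundary X n A a"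
    using e unfolding boundary_def Hom_iff by (metis epic_Arr)
qed

text \<open>The cones of homotopic maps are isomorphic by a shear. On elements it replaces
  \<open>y\<close> by \<open>y + h x\<close> on the way in and \<open>y'\<close> by
  \<open>y' + h x'\<close> on the way out.\<close>

lemma qis_at_homotopic:
  assumes X: "is_complex C X" "is_complex C Y" and f: "chain_map C X Y \<phi>" and g: "chain_map C X Y \<psi>"
    and fg: "homotopic C X Y \<phi> \<psi>" and q: "qis_at X Y \<phi> n"
  shows "qis_at X Y \<psi> n"
proof (rule qis_atI)
  note [simp] = complexD[OF X(1)] complexD[OF X(2)] chain_mapD(1-3)[OF f X] chain_mapD[OF g X]
  obtain h where "htpy X Y \<phi> \<psi> h"
    by (rule homotopicE[OF fg X g])
  note h = htpyD[OF this]
  fix A x y assume a: "arr x" "dom x = A" "cod x = ob X (n + 1)" "arr y" "dom y = A"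
    "cod y = ob Y n" "rep (df X (n + 1)) * rep x = 0"
      "rep (\<psi> (n + 1)) * rep x = rep (df Y n) * rep y"
  have 1: "rep (\<phi> (n + 1)) * rep x = rep (df Y n) * rep (Plus C y (Comp C (h (n + 1)) x))"
    using a h(1-3) by (simp add: h(4)[of "n + 1"] distrib_right distrib_left mult.assoc)
  have 2: "Plus C y (Comp C (h (n + 1)) x) \<in> Hom C A (ob Y n)" "x \<in> Hom C A (ob X (n + 1))"
    using a h(1-3) by (auto simp: Hom_iff)
  obtain A' e x' y' where e: "epic C e" "dom e = A'" "cod e = A"
    "arr x'" "dom x' = A'" "cod x' = ob X n" "arr y'" "dom y' = A'" "cod y' = ob Y (n - 1)"
    "rep x * rep e = rep (df X n) * rep x'"
    "rep (Plus C y (Comp C (h (n + 1)) x)) * rep e = rep (\<phi> n) * rep x' + rep (df Y (n - 1)) *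
      rep y'"
    by (rule qis_atE[OF q 2(2,1) a(7) 1]) blast
  have "rep y * rep e = rep (\<psi> n) * rep x' + rep (df Y (n - 1)) * rep (Plus C y' (Comp C (h n) x'))"
    using e(11) a(1-6) h(1-3) e(1-10)
    by (simp add: h(4)[of n] distrib_right distrib_left mult.assoc)
  moreover have "Plus C y' (Comp C (h n) x') \<in> Hom C A' (ob Y (n - 1))"
    using a h(1-3) e by (auto simp: Hom_iff)
  ultimately show "cone_boundary X Y \<psi> n A x y"
    using e unfolding cone_boundary_def Hom_iff by (metis epic_Arr)
qed

lemma qis_at_Ident:
  assumes X: "is_complex C X"
  shows "qis_at X X (\<lambda>n. Ident C (ob X n)) n"
proof (rule qis_atI)
  note [simp] = complexD[OF X]
  fix A x y assume "arr x" "dom x = A" "cod x = ob X (n + 1)" "arr y" "dom y = A"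
    "cod y = ob X n" "A \<in> Obj C" "rep (Ident C (ob X (n + 1))) * rep x = rep (df X n) * rep y"
  then show "cone_boundary X X (\<lambda>n. Ident C (ob X n)) n A x y"
    by (intro cone_boundaryI[of "Ident C A" A A y _ _ "Zero C A (ob X (n - 1))"])
      (simp_all add: Hom_iff mult.assoc)
qed

text \<open>The condition for \<open>\<gamma>\<close> at the pair \<open>(\<phi> x, z)\<close>
  yields \<open>y'\<close> on a cover \<open>e\<close>; the condition for \<open>\<phi>\<close> at
  \<open>(x e, y')\<close> then yields the required \<open>x''\<close> on a further cover, and the
  two covers are composed.\<close>

lemma qis_at_Comp:
  assumes X: "is_complex C X" "is_complex C Y" "is_complex C Z"
    and f: "chain_map C X Y \<phi>" and g: "chain_map C Y Z \<gamma>"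
    and qf: "qis_at X Y \<phi> n" and qg: "qis_at Y Z \<gamma> n"
  shows "qis_at X Z (\<lambda>n. Comp C (\<gamma> n) (\<phi> n)) n"
proof (rule qis_atI)
  note [simp] = complexD[OF X(1)] complexD[OF X(2)] complexD[OF X(3)] chain_mapD[OF f X(1,2)]
    chain_mapD[OF g X(2,3)]
  fix A x z assume a: "arr x" "dom x = A" "cod x = ob X (n + 1)" "arr z" "dom z = A"
    "cod z = ob Z n" "rep (df X (n + 1)) * rep x = 0"
    "rep (Comp C (\<gamma> (n + 1)) (\<phi> (n + 1))) * rep x = rep (df Z n) * rep z"
  have "rep (df Y (n + 1)) * rep (Comp C (\<phi> (n + 1)) x) = rep (\<phi> (n + 1 + 1)) * (rep (df X (n +
    1)) * rep x)"
    using a(1-6) by simp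
  then have 0: "rep (df Y (n + 1)) * rep (Comp C (\<phi> (n + 1)) x) = 0"
    by (simp only: a(7) mult_zero_right)
  have 3: "Comp C (\<phi> (n + 1)) x \<in> Hom C A (ob Y (n + 1))" "z \<in> Hom C A (ob Z n)"
    "rep (\<gamma> (n + 1)) * rep (Comp C (\<phi> (n + 1)) x) = rep (df Z n) * rep z"
    using a by (simp_all add: Hom_iff mult.assoc)
  obtain A' e y' z' where e: "epic C e" "dom e = A'" "cod e = A"
    "arr y'" "dom y' = A'" "cod y' = ob Y n" "arr z'" "dom z' = A'" "cod z' = ob Z (n - 1)"
    "rep (Comp C (\<phi> (n + 1)) x) * rep e = rep (df Y n) * rep y'"
    "rep z * rep e = rep (\<gamma> n) * rep y' + rep (df Z (n - 1)) * rep z'"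
    by (rule qis_atE[OF qg 3(1,2) 0 3(3)]) blast
  have 1: "rep (\<phi> (n + 1)) * rep (Comp C x e) = rep (df Y n) * rep y'"
    using e a by (simp add: mult.assoc)
  have 2: "rep (df X (n + 1)) * rep (Comp C x e) = 0"
    using e a by (simp flip: mult.assoc)
  have 4: "Comp C x e \<in> Hom C A' (ob X (n + 1))" "y' \<in> Hom C A' (ob Y n)"
    using e a by (simp_all add: Hom_iff)
  obtain A'' e' x'' y'' where e': "epic C e'" "dom e' = A''" "cod e' = A'"
    "arr x''" "dom x'' = A''" "cod x'' = ob X n" "arr y''" "dom y'' = A''" "cod y'' = ob Y (n - 1)"
    "rep (Comp C x e) * rep e' = rep (df X n) * rep x''"
    "rep y' * rep e' = rep (\<phi> n) * rep x'' + rep (df Y (n - 1)) * rep y''"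
    by (rule qis_atE[OF qf 4 2 1]) blast
  have "rep z * rep (Comp C e e') = (rep z * rep e) * rep e'"
    using e(1-9) e'(1-9) by (simp add: mult.assoc)
  also have "\<dots> = rep (\<gamma> n) * (rep y' * rep e') + rep (df Z (n - 1)) * rep z' * rep e'"
    by (simp add: e(11) algebra_simps)
  also have "\<dots> = rep (Comp C (\<gamma> n) (\<phi> n)) * rep x'' +
      rep (df Z (n - 1)) * rep (Plus C (Comp C (\<gamma> (n - 1)) y'') (Comp C z' e'))"
    using e(1-9) e' by (simp add: e'(11) algebra_simps)
  finally have "rep z * rep (Comp C e e') = rep (Comp C (\<gamma> n) (\<phi> n)) * rep x'' +
      rep (df Z (n - 1)) * rep (Plus C (Comp C (\<gamma> (n - 1)) y'') (Comp C z' e'))" .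
  moreover have "rep x * rep (Comp C e e') = rep (df X n) * rep x''"
    using e' e a by (simp add: mult.assoc)
  moreover have "epic C (Comp C e e')" using e e' epic_Comp by auto
  moreover have "Plus C (Comp C (\<gamma> (n - 1)) y'') (Comp C z' e') \<in> Hom C A'' (ob Z (n - 1))"
    "Comp C e e' \<in> Hom C A'' A" "x'' \<in> Hom C A'' (ob X n)"
    using e e' by (simp_all add: Hom_iff)
  ultimately show "cone_boundary X Z (\<lambda>n. Comp C (\<gamma> n) (\<phi> n)) n A x z"
    unfolding cone_boundary_def by blast
qed

end

section \<open>Mapping cones\<close>

context additive_category
begin

definition cone_splitting where
  "cone_splitting X Y \<phi> Z i1 i2 p1 p2 \<longleftrightarrow> is_complex C Z \<and>
     (\<forall>n. is_biproduct C (ob X (n + 1)) (ob Y n) (ob Z n) (i1 n) (i2 n) (p1 n) (p2 n)) \<and>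
     (\<forall>n. rep (df Z n) =
        rep (i2 (n + 1)) * (rep (\<phi> (n + 1)) * rep (p1 n) + rep (df Y n) * rep (p2 n)) -
        rep (i1 (n + 1)) * (rep (df X (n + 1)) * rep (p1 n)))"

lemma cone_splittingD:
  assumes c: "cone_splitting X Y \<phi> Z i1 i2 p1 p2"
    and X: "is_complex C X" "is_complex C Y" and f: "chain_map C X Y \<phi>"
  shows "is_complex C Z"
    "is_biproduct C (ob X (n + 1)) (ob Y n) (ob Z n) (i1 n) (i2 n) (p1 n) (p2 n)"
    "rep (df Z n) = rep (i2 (n + 1)) * (rep (\<phi> (n + 1)) * rep (p1 n) + rep (df Y n) * rep (p2 n)) -
       rep (i1 (n + 1)) * (rep (df X (n + 1)) * rep (p1 n))"
    "m = n + 1 \<Longrightarrow> rep (p1 m) * rep (df Z n) = - (rep (df X m) * rep (p1 n))"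
    "m = n + 1 \<Longrightarrow> rep (p2 m) * rep (df Z n) = rep (\<phi> m) * rep (p1 n) + rep (df Y n) * rep (p2 n)"
    "m = n + 1 \<Longrightarrow> rep (p1 m) * (rep (df Z n) * z) = - (rep (df X m) * (rep (p1 n) * z))"
    "m = n + 1 \<Longrightarrow> rep (p2 m) * (rep (df Z n) * z) =
       rep (\<phi> m) * (rep (p1 n) * z) + rep (df Y n) * (rep (p2 n) * z)"
proof -
  note [simp] = complexD[OF X(1)] complexD[OF X(2)] chain_mapD[OF f X]
  show "is_complex C Z"
    and b: "is_biproduct C (ob X (n + 1)) (ob Y n) (ob Z n) (i1 n) (i2 n) (p1 n) (p2 n)"
    and r: "rep (df Z n) = rep (i2 (n + 1)) * (rep (\<phi> (n + 1)) * rep (p1 n) + rep (df Y n) * rep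
      (p2 n)) -
       rep (i1 (n + 1)) * (rep (df X (n + 1)) * rep (p1 n))" for n
    using c unfolding cone_splitting_def by blast+
  note [simp] = biproductD[OF b]
  show p: "m = n + 1 \<Longrightarrow> rep (p1 m) * rep (df Z n) = - (rep (df X m) * rep (p1 n))"
    "m = n + 1 \<Longrightarrow> rep (p2 m) * rep (df Z n) = rep (\<phi> m) * rep (p1 n) + rep (df Y n) * rep (p2 n)"
    by (simp_all add: r algebra_simps)
  show "m = n + 1 \<Longrightarrow> rep (p1 m) * (rep (df Z n) * z) = - (rep (df X m) * (rep (p1 n) * z))"
    "m = n + 1 \<Longrightarrow> rep (p2 m) * (rep (df Z n) * z) =
       rep (\<phi> m) * (rep (p1 n) * z) + rep (df Y n) * (rep (p2 n) * z)"
    using p by (simp_all add: distrib_right flip: mult.assoc)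
qed

lemma mapping_coneE:
  assumes "is_mapping_cone C X Y \<phi> Z" and X: "is_complex C X" "is_complex C Y"
    and f: "chain_map C X Y \<phi>"
  obtains i1 i2 p1 p2 where "cone_splitting X Y \<phi> Z i1 i2 p1 p2"
proof -
  note [simp] = complexD[OF X(1)] complexD[OF X(2)] chain_mapD[OF f X]
  obtain i1 i2 p1 p2 where b: "\<And>n. is_biproduct C (ob X (n + 1)) (ob Y n) (ob Z n) (i1 n) (i2 n)
    (p1 n) (p2 n)"
    and d: "\<And>n. df Z n =
          Plus C (Comp C (i1 (n + 1)) (Comp C (Neg C (df X (n + 1))) (p1 n)))
            (Comp C (i2 (n + 1))
              (Plus C (Comp C (\<phi> (n + 1)) (p1 n)) (Comp C (df Y n) (p2 n))))"
    using assms(1) unfolding is_mapping_cone_def by blast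
  note [simp] = biproductD[OF b]
  have "cone_splitting X Y \<phi> Z i1 i2 p1 p2"
    using assms(1) b unfolding cone_splitting_def by (simp add: is_mapping_cone_def d)
  then show thesis by (rule that)
qed

lemma mapping_cone_exists:
  assumes X: "is_complex C X" "is_complex C Y" and f: "chain_map C X Y \<phi>"
  obtains Z where "is_mapping_cone C X Y \<phi> Z"
proof -
  note [simp] = complexD[OF X(1)] complexD[OF X(2)] chain_mapD[OF f X]
  have "\<forall>n. \<exists>P i1 i2 p1 p2. is_biproduct C (ob X (n + 1)) (ob Y n) P i1 i2 p1 p2"
    by (intro allI biproduct_exists) auto
  then obtain P i1 i2 p1 p2 where b: "\<And>n. is_biproduct C (ob X (n + 1)) (ob Y n) (P n) (i1 n) (i2
    n) (p1 n) (p2 n)"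
    by metis
  note [simp] = biproductD[OF b]
  define Z where "Z = \<lparr>ob = P, df = (\<lambda>n. Plus C (Comp C (i1 (n + 1)) (Comp C (Neg C (df X (n +
    1))) (p1 n)))
            (Comp C (i2 (n + 1))
              (Plus C (Comp C (\<phi> (n + 1)) (p1 n)) (Comp C (df Y n) (p2 n)))))\<rparr>"
  have "is_complex C Z"
    by (rule is_complexI) (simp_all add: Z_def Hom_iff algebra_simps)
  then have "is_mapping_cone C X Y \<phi> Z"
    unfolding is_mapping_cone_def using b
    by (intro conjI exI[of _ i1] exI[of _ i2] exI[of _ p1] exI[of _ p2]) (auto simp: Z_def)
  then show thesis by (rule that)
qed

end

context abelian_category
begin

text \<open>A pair \<open>(x, y)\<close> as in \<open>qis_at\<close> corresponds to the element
  \<open>i2 y - i1 x\<close> of the cone. The two components of the differential turn the premises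
  of \<open>qis_at\<close> into the cycle condition and \<open>cone_boundary\<close> into the
  boundary condition.\<close>

lemma exact_at_cone_iff:
  assumes Z: "is_mapping_cone C X Y \<phi> Z" and X: "is_complex C X" "is_complex C Y"
    and f: "chain_map C X Y \<phi>"
  shows "exact_at Z n \<longleftrightarrow> qis_at X Y \<phi> n"
proof -
  obtain i1 i2 p1 p2 where c: "cone_splitting X Y \<phi> Z i1 i2 p1 p2"
    by (rule mapping_coneE[OF Z X f])
  note D = cone_splittingD[OF c X f]
  note cZ = D(1) and b = D(2) and r = D(3) and p = D(4-7)
  note [simp] = complexD[OF X(1)] complexD[OF X(2)] complexD[OF cZ] chain_mapD[OF f X]
    biproductD[OF b]
  note b' = biproductD(7,8,11,12)[OF b[of "n - 1"], simplified]
  note [simp] = b'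
  show ?thesis
  proof
    assume ex: "exact_at Z n"
    show "qis_at X Y \<phi> n"
    proof (rule qis_atI)
      fix A x y assume a: "arr x" "dom x = A" "cod x = ob X (n + 1)" "arr y" "dom y = A"
        "cod y = ob Y n" "rep (df X (n + 1)) * rep x = 0"
          "rep (\<phi> (n + 1)) * rep x = rep (df Y n) * rep y"
      define z where "z = Plus C (Comp C (i2 n) y) (Neg C (Comp C (i1 n) x))"
      have z: "z \<in> Hom C A (ob Z n)" using a by (simp add: z_def Hom_iff)
      have "rep (df Z n) * rep z = 0"
        using a by (simp add: z_def r algebra_simps)
      then obtain A' e b where e: "epic C e" "dom e = A'" "cod e = A" "arr b" "dom b = A'"
        "cod b = ob Z (n - 1)" "rep z * rep e = rep (df Z (n - 1)) * rep b"
        using exact_atE[OF ex z] by blast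
      have "rep (p1 n) * (rep z * rep e) = - (rep x * rep e)"
        "rep (p2 n) * (rep z * rep e) = rep y * rep e"
        using a by (simp_all add: z_def algebra_simps)
      then have "rep x * rep e = rep (df X n) * (rep (p1 (n - 1)) * rep b)"
        "rep y * rep e = rep (\<phi> n) * (rep (p1 (n - 1)) * rep b) + rep (df Y (n - 1)) * (rep (p2
          (n - 1)) * rep b)"
        by (simp_all add: e(7) p)
      then show "cone_boundary X Y \<phi> n A x y"
        using e by (intro cone_boundaryI[of e A' A "Comp C (p1 (n - 1)) b" _ _ "Comp C (p2 (n -
          1)) b"])
          (simp_all add: Hom_iff)
    qed
  next
    assume q: "qis_at X Y \<phi> n"
    show "exact_at Z n"
    proof (rule exact_atI)
      fix A z assume a: "arr z" "dom z = A" "cod z = ob Z n" "rep (df Z n) * rep z = 0"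
      \<comment> \<open>This pair corresponds to \<open>- z\<close>; the overall sign is undone by
        the negation in \<open>w\<close> below.\<close>
      define x y where "x = Comp C (p1 n) z" and "y = Neg C (Comp C (p2 n) z)"
      have xy: "x \<in> Hom C A (ob X (n + 1))" "y \<in> Hom C A (ob Y n)"
        using a by (simp_all add: x_def y_def Hom_iff)
      have "rep (df X (n + 1)) * rep x = - (rep (p1 (n + 1)) * (rep (df Z n) * rep z))"
        using a(1-3) by (simp add: x_def p)
      then have 1: "rep (df X (n + 1)) * rep x = 0" by (simp only: a(4)) simp
      have "rep (\<phi> (n + 1)) * rep x - rep (df Y n) * rep y = rep (p2 (n + 1)) * (rep (df Z n) *
        rep z)"
        using a(1-3) by (simp add: x_def y_def p)
      then have 2: "rep (\<phi> (n + 1)) * rep x = rep (df Y n) * rep y" by (simp only: a(4)) simp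
      obtain A' e x' y' where e: "epic C e" "dom e = A'" "cod e = A"
        "arr x'" "dom x' = A'" "cod x' = ob X n" "arr y'" "dom y' = A'" "cod y' = ob Y (n - 1)"
        "rep x * rep e = rep (df X n) * rep x'"
        "rep y * rep e = rep (\<phi> n) * rep x' + rep (df Y (n - 1)) * rep y'"
        by (rule qis_atE[OF q xy 1 2]) blast
      define w where "w = Neg C (Plus C (Comp C (i1 (n - 1)) x') (Comp C (i2 (n - 1)) y'))"
      note b'' = biproductD[OF b[of "n - 1"], simplified]
      have w: "arr w" "dom w = A'" "cod w = ob Z (n - 1)" using e b'' by (simp_all add: w_def)
      have "rep (Comp C z e) = rep (Comp C (df Z (n - 1)) w)"
      proof (rule biproduct_eqI[OF b[of n]])
        have "rep (p1 n) * rep (Comp C (df Z (n - 1)) w) = rep (df X n) * rep x'"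
          using w e b'' by (simp add: p w_def distrib_left right_diff_distrib)
        also have "\<dots> = rep (p1 n) * rep (Comp C z e)"
          using e a by (simp add: x_def mult.assoc flip: e(10))
        finally show "rep (p1 n) * rep (Comp C z e) = rep (p1 n) * rep (Comp C (df Z (n - 1)) w)" ..
        have "rep (p2 n) * rep (Comp C (df Z (n - 1)) w) = - (rep y * rep e)"
          using w e(1-9) b'' by (simp add: p w_def e(11) distrib_left right_diff_distrib)
        also have "\<dots> = rep (p2 n) * rep (Comp C z e)"
          using e(1-9) a(1-3) by (simp add: y_def mult.assoc)
        finally show "rep (p2 n) * rep (Comp C z e) = rep (p2 n) * rep (Comp C (df Z (n - 1)) w)" ..
      qed (use w e a in simp_all)
      then have "rep z * rep e = rep (df Z (n - 1)) * rep w" using a e w by simp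
      then show "boundary Z n A z"
        using e w unfolding boundary_def Hom_iff by (metis epic_Arr)
    qed
  qed
qed

end

section \<open>Truncation\<close>

lemma ob_trunc:
  "i \<le> n \<Longrightarrow> ob (trunc C n X) i = ob X i"
  "i = n + 1 \<Longrightarrow> ob (trunc C n X) i = im_obj C (df X n)"
  "n + 1 < i \<Longrightarrow> ob (trunc C n X) i = zero_obj C"
  by (simp_all add: trunc_def trunc_ob_def)

lemma df_trunc:
  "i < n \<Longrightarrow> df (trunc C n X) i = df X i"
  "df (trunc C n X) n = im_epi C (df X n)"
  "n < i \<Longrightarrow> df (trunc C n X) i = Zero C (ob (trunc C n X) i) (ob (trunc C n X) (i + 1))"
  by (simp_all add: trunc_def)

lemma trunc_incl_eq:
  "i \<le> n \<Longrightarrow> trunc_incl C n X i = Ident C (ob X i)"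
  "i = n + 1 \<Longrightarrow> trunc_incl C n X i = im_mono C (df X n)"
  "n + 1 < i \<Longrightarrow> trunc_incl C n X i = Zero C (zero_obj C) (ob X i)"
  by (simp_all add: trunc_incl_def)

text \<open>Strictness of \<open>k < n\<close> matters. The differential of the truncation in degree
  \<open>n\<close> is \<open>im_epi C (df X n)\<close>, whose image is chosen anew, so for
  \<open>k = n\<close> the two sides need not be the same complex. Below \<open>n\<close> the
  differentials, and hence the chosen images, are literally those of \<open>X\<close>.\<close>

lemma trunc_trunc_less:
  assumes "k < n"
  shows "trunc C k (trunc C n X) = trunc C k X"
proof -
  have "trunc_ob C k (trunc C n X) = trunc_ob C k X"
    using assms by (intro ext) (simp add: trunc_ob_def trunc_def)
  then show ?thesis
    using assms by (auto simp: trunc_def)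
qed

lemma (in category) isomorphic_refl: "A \<in> Obj C \<Longrightarrow> isomorphic C A A"
  unfolding isomorphic_def inverse_pair_def by (intro exI[of _ "Ident C A"]) simp

lemma (in preadditive_category) right_bounded_K_minus:
  assumes "is_complex C X" and "right_bounded C X"
  shows "X \<in> K_minus_obj C"
proof -
  interpret K: preadditive_category "K_cat C" by (rule preadditive_K)
  show ?thesis unfolding K_minus_obj_def using assms K.isomorphic_refl[of X] by (auto simp: Obj_K)
qed

context abelian_category
begin

section \<open>The truncation of a complex and its inclusion\<close>

context
  fixes X assumes X: "is_complex C X"
begin

lemma trunc_ob_Obj: "ob (trunc C n X) i \<in> Obj C"
  using complexD[OF X] by (cases "i \<le> n"; cases "i = n + 1") (simp_all add: ob_trunc)

lemma df_trunc_Arr: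
  "arr (df (trunc C n X) i)" "dom (df (trunc C n X) i) = ob (trunc C n X) i"
  "cod (df (trunc C n X) i) = ob (trunc C n X) (i + 1)"
proof -
  note [simp] = complexD[OF X] trunc_ob_Obj
  consider "i < n" | "i = n" | "n < i" by linarith
  then have "arr (df (trunc C n X) i) \<and> dom (df (trunc C n X) i) = ob (trunc C n X) i \<and>
    cod (df (trunc C n X) i) = ob (trunc C n X) (i + 1)"
    by cases (simp_all add: df_trunc ob_trunc)
  then show "arr (df (trunc C n X) i)" "dom (df (trunc C n X) i) = ob (trunc C n X) i"
    "cod (df (trunc C n X) i) = ob (trunc C n X) (i + 1)"
    by auto
qed

lemma trunc_incl:
  "arr (trunc_incl C n X i)" "dom (trunc_incl C n X i) = ob (trunc C n X) i"
  "cod (trunc_incl C n X i) = ob X i" "monic C (trunc_incl C n X i)"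
proof -
  note [simp] = complexD[OF X]
  have "monic C (trunc_incl C n X i) \<and> dom (trunc_incl C n X i) = ob (trunc C n X) i \<and>
    cod (trunc_incl C n X i) = ob X i"
  proof -
    consider "i \<le> n" | "i = n + 1" | "n + 1 < i" by linarith
    then show ?thesis
    proof cases
      case 1
      then show ?thesis by (auto simp: trunc_incl_eq ob_trunc intro!: monicI)
    next
      case 2
      then show ?thesis by (auto simp: trunc_incl_eq ob_trunc monic_im_mono)
    next
      case 3
      have "monic C (Zero C (zero_obj C) (ob X i))"
        by (rule monicI) (auto simp: rep_zero_object(2)[OF zero_object_zero_obj])
      with 3 show ?thesis by (simp add: trunc_incl_eq ob_trunc)
    qed
  qed
  then show "arr (trunc_incl C n X i)" "dom (trunc_incl C n X i) = ob (trunc C n X) i"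
    "cod (trunc_incl C n X i) = ob X i" "monic C (trunc_incl C n X i)"
    by auto
qed

lemma rep_trunc_incl_high: "n + 1 < i \<Longrightarrow> rep (trunc_incl C n X i) = 0"
  using complexD[OF X] by (simp add: trunc_incl_eq)

text \<open>Identities between arrows into a truncation are checked after composition with the inclusion,
  which is natural and commutes with the differentials.\<close>

lemma trunc_incl_cancel:
  assumes "arr u" and "arr v" and "dom u = dom v"
    and "cod u = ob (trunc C n X) i" and "cod v = ob (trunc C n X) i"
    and "rep (trunc_incl C n X i) * rep u = rep (trunc_incl C n X i) * rep v"
  shows "rep u = rep v"
  using assms trunc_incl by (intro monic_cancel[OF trunc_incl(4)]) auto

lemma trunc_incl_comm:
  "m = i + 1 \<Longrightarrow> rep (trunc_incl C n X m) * rep (df (trunc C n X) i) = rep (df X i) * rep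
    (trunc_incl C n X i)"
  "m = i + 1 \<Longrightarrow> rep (trunc_incl C n X m) * (rep (df (trunc C n X) i) * z) = rep (df X i) * (rep
    (trunc_incl C n X i) * z)"
proof -
  note [simp] = complexD[OF X]
  \<comment> \<open>Needed in the case \<open>i = n + 1\<close>, where the truncation has
    differential zero: the next differential of \<open>X\<close> kills the image of
    \<open>df X n\<close>, because it kills \<open>df X n\<close> and the corestriction is
    epic.\<close>
  have "rep (df X (n + 1)) * (rep (im_mono C (df X n)) * rep (im_epi C (df X n))) = 0"
    by simp
  then have "rep (Comp C (df X (n + 1)) (im_mono C (df X n))) * rep (im_epi C (df X n)) = 0"
    by (simp add: mult.assoc del: rep_im)
  then have "rep (Comp C (df X (n + 1)) (im_mono C (df X n))) = 0"
    by (intro epicD[OF epic_im_epi]) auto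
  then have *: "rep (df X (n + 1)) * rep (im_mono C (df X n)) = 0" by simp
  consider "i < n" | "i = n" | "i = n + 1" | "n + 1 < i" by linarith
  then have "rep (trunc_incl C n X (i + 1)) * rep (df (trunc C n X) i) = rep (df X i) * rep
    (trunc_incl C n X i)"
    by cases (use * trunc_ob_Obj in \<open>simp_all add: trunc_incl_eq df_trunc\<close>)
  then show "m = i + 1 \<Longrightarrow> rep (trunc_incl C n X m) * rep (df (trunc C n X) i) = rep (df X i) * rep
    (trunc_incl C n X i)"
    "m = i + 1 \<Longrightarrow> rep (trunc_incl C n X m) * (rep (df (trunc C n X) i) * z) = rep (df X i) * (rep
      (trunc_incl C n X i) * z)"
    by (simp_all flip: mult.assoc)
qed

lemma is_complex_trunc: "is_complex C (trunc C n X)"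
proof (rule is_complexI)
  note [simp] = complexD[OF X] df_trunc_Arr trunc_ob_Obj
  show "df (trunc C n X) i \<in> Hom C (ob (trunc C n X) i) (ob (trunc C n X) (i + 1))" for i
    by (simp add: Hom_iff)
  fix i
  have "rep (trunc_incl C n X (i + 1 + 1)) * (rep (df (trunc C n X) (i + 1)) * rep (df (trunc C n
    X) i)) = 0"
    by (subst trunc_incl_comm(2), simp, subst trunc_incl_comm(1), simp) simp
  then have "rep (Comp C (df (trunc C n X) (i + 1)) (df (trunc C n X) i)) = 0"
    by (intro monicD[OF trunc_incl(4)[of n "i + 1 + 1"]]) (simp_all add: trunc_incl)
  then show "rep (df (trunc C n X) (i + 1)) * rep (df (trunc C n X) i) = 0" by simp
qed

lemma chain_map_trunc_incl: "chain_map C (trunc C n X) X (trunc_incl C n X)"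
  by (rule chain_mapI) (simp_all add: X is_complex_trunc Hom_iff trunc_incl trunc_incl_comm)

lemma right_bounded_trunc: "right_bounded C (trunc C n X)"
  unfolding right_bounded_def by (intro exI[of _ "n + 1"]) (auto simp: ob_trunc)

lemma trunc_K_minus: "trunc C n X \<in> K_minus_obj C"
  by (intro right_bounded_K_minus is_complex_trunc right_bounded_trunc)

end

section \<open>Truncation of chain maps and homotopies\<close>

context
  fixes X Y \<phi> assumes X: "is_complex C X" and Y: "is_complex C Y" and f: "chain_map C X Y \<phi>"
begin

lemma trunc_map:
  "arr (trunc_map C n X Y \<phi> i)" "dom (trunc_map C n X Y \<phi> i) = ob (trunc C n X) i"
  "cod (trunc_map C n X Y \<phi> i) = ob (trunc C n Y) i"
  "rep (trunc_incl C n Y i) * rep (trunc_map C n X Y \<phi> i) = rep (\<phi> i) * rep (trunc_incl C n X i)"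
proof -
  note [simp] = complexD[OF X] complexD[OF Y] chain_mapD[OF f X Y]
  have im: "arr (im_map C (df X n) (df Y n) (\<phi> (n + 1)))"
    "dom (im_map C (df X n) (df Y n) (\<phi> (n + 1))) = im_obj C (df X n)"
    "cod (im_map C (df X n) (df Y n) (\<phi> (n + 1))) = im_obj C (df Y n)"
    "rep (im_mono C (df Y n)) * rep (im_map C (df X n) (df Y n) (\<phi> (n + 1))) =
      rep (\<phi> (n + 1)) * rep (im_mono C (df X n))"
    using im_map[of "df X n" "df Y n" "\<phi> (n + 1)" "\<phi> n"] by simp_all
  consider "i \<le> n" | "i = n + 1" | "n + 1 < i" by linarith
  then have "arr (trunc_map C n X Y \<phi> i) \<and> dom (trunc_map C n X Y \<phi> i) = ob (trunc C n X) i \<and>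
    cod (trunc_map C n X Y \<phi> i) = ob (trunc C n Y) i \<and>
    rep (trunc_incl C n Y i) * rep (trunc_map C n X Y \<phi> i) = rep (\<phi> i) * rep (trunc_incl C n X i)"
    by cases (simp_all add: trunc_map_def ob_trunc trunc_incl_eq im)
  then show "arr (trunc_map C n X Y \<phi> i)" "dom (trunc_map C n X Y \<phi> i) = ob (trunc C n X) i"
    "cod (trunc_map C n X Y \<phi> i) = ob (trunc C n Y) i"
    "rep (trunc_incl C n Y i) * rep (trunc_map C n X Y \<phi> i) = rep (\<phi> i) * rep (trunc_incl C n X i)"
    by auto
qed

lemma trunc_incl_map:
  "rep (trunc_incl C n Y i) * (rep (trunc_map C n X Y \<phi> i) * z) = rep (\<phi> i) * (rep (trunc_incl C
    n X i) * z)"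
  using trunc_map(4)[of n i] by (simp flip: mult.assoc)

lemma chain_map_trunc: "chain_map C (trunc C n X) (trunc C n Y) (trunc_map C n X Y \<phi>)"
proof (rule chain_mapI)
  show "is_complex C (trunc C n X)" "is_complex C (trunc C n Y)" using is_complex_trunc X Y by auto
  note [simp] = complexD[OF X] complexD[OF Y] complexD[OF this(1)] complexD[OF this(2)]
    chain_mapD[OF f X Y] trunc_map(1-3)
  show "trunc_map C n X Y \<phi> i \<in> Hom C (ob (trunc C n X) i) (ob (trunc C n Y) i)" for i
    by (simp add: Hom_iff)
  fix i
  have "rep (Comp C (trunc_map C n X Y \<phi> (i + 1)) (df (trunc C n X) i)) =
    rep (Comp C (df (trunc C n Y) i) (trunc_map C n X Y \<phi> i))"
    by (rule trunc_incl_cancel[OF Y, where n = n and i = "i + 1"])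
      (simp_all add: trunc_incl_map trunc_incl_comm[OF X] trunc_incl_comm[OF Y] trunc_map(4))
  then show "rep (trunc_map C n X Y \<phi> (i + 1)) * rep (df (trunc C n X) i) =
    rep (df (trunc C n Y) i) * rep (trunc_map C n X Y \<phi> i)"
    by simp
qed

end

text \<open>As the inclusions are monic, the naturality square determines the truncated map.
  Compatibility with composition and sums follows from this without unfolding the three cases of its
  definition.\<close>

lemma trunc_map_unique:
  assumes X: "is_complex C X" "is_complex C Y" and f: "chain_map C X Y \<phi>"
    and u: "\<And>i. u i \<in> Hom C (ob (trunc C n X) i) (ob (trunc C n Y) i)"
    and "\<And>i. rep (trunc_incl C n Y i) * rep (u i) = rep (\<phi> i) * rep (trunc_incl C n X i)"
  shows "trunc_map C n X Y \<phi> = u"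
proof
  fix i
  show "trunc_map C n X Y \<phi> i = u i"
    using assms(5) u[of i] trunc_map[OF X f, of n i]
    by (intro rep_eqI trunc_incl_cancel[OF X(2), where n = n and i = i]) (auto simp: Hom_iff)
qed

lemma trunc_map_Comp:
  assumes X: "is_complex C X" "is_complex C Y" "is_complex C Z" and f: "chain_map C X Y \<phi>"
    and g: "chain_map C Y Z \<gamma>"
  shows "trunc_map C n X Z (\<lambda>i. Comp C (\<gamma> i) (\<phi> i)) = (\<lambda>i. Comp C (trunc_map C n Y Z \<gamma> i)
    (trunc_map C n X Y \<phi> i))"
  using X f g chain_mapD[OF f X(1,2)] chain_mapD[OF g X(2,3)] trunc_map[OF X(1,2) f]
    trunc_map[OF X(2,3) g]
    trunc_incl_map[OF X(1,2) f] trunc_incl_map[OF X(2,3) g]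
  by (intro trunc_map_unique chain_map_Comp[OF X]) (auto simp: Hom_iff mult.assoc)

lemma trunc_map_Plus:
  assumes X: "is_complex C X" "is_complex C Y" and f: "chain_map C X Y \<phi>" and g: "chain_map C X Y \<gamma>"
  shows "trunc_map C n X Y (\<lambda>i. Plus C (\<phi> i) (\<gamma> i)) = (\<lambda>i. Plus C (trunc_map C n X Y \<phi> i)
    (trunc_map C n X Y \<gamma> i))"
  using X f g chain_mapD[OF f X(1,2)] chain_mapD[OF g X(1,2)] trunc_map[OF X(1,2) f]
    trunc_map[OF X(1,2) g]
  by (intro trunc_map_unique chain_map_Plus[OF X]) (auto simp: Hom_iff algebra_simps)

text \<open>A family of degree \<open>-1\<close> restricts to truncations: for
  \<open>i \<le> n + 1\<close> its values lie in degree at most \<open>n\<close>, where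
  \<open>Y\<close> is unchanged, and for larger \<open>i\<close> the source is the zero object. The
  construction applies to any such family, so it also serves the contraction in
  \<open>contractible_above_trunc\<close>.\<close>

lemma trunc_htpy:
  assumes X: "is_complex C X" "is_complex C Y" and h: "\<And>i. h i \<in> Hom C (ob X i) (ob Y (i - 1))"
  obtains h' where "\<And>i. arr (h' i)" "\<And>i. dom (h' i) = ob (trunc C n X) i"
    "\<And>i. cod (h' i) = ob (trunc C n Y) (i - 1)"
    "\<And>j i. j = i - 1 \<Longrightarrow> rep (trunc_incl C n Y j) * rep (h' i) = rep (h i) * rep (trunc_incl C n X i)"
    "\<And>j i z. j = i - 1 \<Longrightarrow> rep (trunc_incl C n Y j) * (rep (h' i) * z) = rep (h i) * (rep
      (trunc_incl C n X i) * z)"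
proof -
  note [simp] = complexD[OF X(1)] complexD[OF X(2)] trunc_incl(1-3)[OF X(1)]
    trunc_incl(1-3)[OF X(2)]
    trunc_ob_Obj[OF X(1)] trunc_ob_Obj[OF X(2)]
  have hD: "arr (h i)" "dom (h i) = ob X i" "cod (h i) = ob Y (i - 1)" for i
    using h[of i] by (auto simp: Hom_iff)
  define h' where "h' i = (if i \<le> n + 1 then Comp C (h i) (trunc_incl C n X i)
    else Zero C (ob (trunc C n X) i) (ob (trunc C n Y) (i - 1)))" for i
  have *: "arr (h' i) \<and> dom (h' i) = ob (trunc C n X) i \<and>
    cod (h' i) = ob (trunc C n Y) (i - 1)" for i
    using hD by (simp add: h'_def ob_trunc)
  have "rep (trunc_incl C n Y (i - 1)) * rep (h' i) = rep (h i) * rep (trunc_incl C n X i)" for i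
    using hD * by (simp add: h'_def rep_trunc_incl_high[OF X(1)] trunc_incl_eq(1))
  then have "j = i - 1 \<Longrightarrow> rep (trunc_incl C n Y j) * rep (h' i) = rep (h i) * rep (trunc_incl C n
    X i)"
    "j = i - 1 \<Longrightarrow> rep (trunc_incl C n Y j) * (rep (h' i) * z) = rep (h i) * (rep (trunc_incl C n X
      i) * z)" for i j z
    by (simp_all flip: mult.assoc)
  then show thesis using * by (intro that[of h']) auto
qed

lemma trunc_map_homotopic:
  assumes X: "is_complex C X" "is_complex C Y" and f: "chain_map C X Y \<phi>" and g: "chain_map C X Y \<psi>"
    and fg: "homotopic C X Y \<phi> \<psi>"
  shows "homotopic C (trunc C n X) (trunc C n Y) (trunc_map C n X Y \<phi>) (trunc_map C n X Y \<psi>)"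
proof -
  obtain h where "htpy X Y \<phi> \<psi> h"
    by (rule homotopicE[OF fg X g])
  note h = htpyD[OF this]
  have hh: "h i \<in> Hom C (ob X i) (ob Y (i - 1))" for i using h by (simp add: Hom_iff)
  obtain h' where h': "\<And>i. arr (h' i)" "\<And>i. dom (h' i) = ob (trunc C n X) i"
    "\<And>i. cod (h' i) = ob (trunc C n Y) (i - 1)"
    "\<And>j i. j = i - 1 \<Longrightarrow> rep (trunc_incl C n Y j) * rep (h' i) = rep (h i) * rep (trunc_incl C n X i)"
    "\<And>j i z. j = i - 1 \<Longrightarrow> rep (trunc_incl C n Y j) * (rep (h' i) * z) = rep (h i) * (rep
      (trunc_incl C n X i) * z)"
    by (rule trunc_htpy[of X Y h n, OF X hh]) blast
  note cT = is_complex_trunc[OF X(1), of n] is_complex_trunc[OF X(2), of n]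
  note [simp] = complexD[OF X(1)] complexD[OF X(2)] complexD[OF cT(1)] complexD[OF cT(2)]
    trunc_map(1-3)[OF X f] trunc_map(1-3)[OF X g] trunc_incl(1-3)[OF X(1)]
      trunc_incl(1-3)[OF X(2)] h'(1-3)
  show ?thesis
  proof (rule homotopicI[OF cT, where h = h'])
    fix i
    have "rep (trunc_map C n X Y \<phi> i) = rep (Plus C (trunc_map C n X Y \<psi> i)
      (Plus C (Comp C (df (trunc C n Y) (i - 1)) (h' i)) (Comp C (h' (i + 1)) (df (trunc C n X)
        i))))"
      by (rule trunc_incl_cancel[OF X(2), where n = n and i = i])
        (simp_all add: trunc_map(4)[OF X f]
          trunc_map(4)[OF X g] h(4)[of i] h'(4,5) distrib_left distrib_right mult.assoc
          trunc_incl_comm[OF X(1)] trunc_incl_comm[OF X(2)])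
    then show "rep (trunc_map C n X Y \<phi> i) = rep (trunc_map C n X Y \<psi> i) +
         (rep (df (trunc C n Y) (i - 1)) * rep (h' i) + rep (h' (i + 1)) * rep (df (trunc C n X)
           i))"
      by simp
  qed (simp_all add: Hom_iff)
qed

text \<open>An equality on the nose: as \<open>k + 1 \<le> n\<close>, the outer truncation reads
  only degrees in which the inner one has changed neither the map nor, in degree \<open>k\<close>,
  the differentials.\<close>

lemma trunc_map_trunc_map:
  assumes "k < n"
  shows "trunc_map C k (trunc C n X) (trunc C n Y) (trunc_map C n X Y \<phi>) = trunc_map C k X Y \<phi>"
  using assms by (auto simp: trunc_map_def df_trunc)

text \<open>The inclusion consists of identities up to degree \<open>n\<close>, hence up to
  \<open>k + 1\<close>, and an identity induces the identity of the image. Above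
  \<open>k + 1\<close> the truncated map is a zero endomorphism of the zero object, which is its
  identity.\<close>

lemma trunc_map_trunc_incl:
  assumes X: "is_complex C X" and "k < n"
  shows "trunc_map C k (trunc C n X) X (trunc_incl C n X) = (\<lambda>i. Ident C (ob (trunc C k X) i))"
proof
  fix i
  note [simp] = complexD[OF X]
  have "Zero C (zero_obj C) (zero_obj C) = Ident C (zero_obj C)"
    using rep_zero_object(1)[OF zero_object_zero_obj, of "Ident C (zero_obj C)"]
      by (intro rep_eqI) simp_all
  moreover have "im_map C (df X k) (df X k) (Ident C (ob X (k + 1))) = Ident C (im_obj C (df X k))"
    by (rule im_map_unique) simp_all
  ultimately show "trunc_map C k (trunc C n X) X (trunc_incl C n X) i = Ident C (ob (trunc C k X)
    i)"
    using assms(2)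
    by (cases "i \<le> k"; cases "i = k + 1") (simp_all add: trunc_map_def ob_trunc df_trunc
      trunc_incl_eq)
qed

lemma trunc_incl_trunc_incl:
  assumes X: "is_complex C X" and "k < n"
  shows "(\<lambda>i. Comp C (trunc_incl C n X i) (trunc_incl C k (trunc C n X) i)) = trunc_incl C k X"
proof
  fix i
  note [simp] = complexD[OF X] complexD[OF is_complex_trunc[OF X]] trunc_incl[OF X]
    trunc_incl[OF is_complex_trunc[OF X]]
    trunc_ob_Obj[OF X]
  consider "i \<le> k" | "i = k + 1" | "k + 1 < i" by linarith
  then have "rep (Comp C (trunc_incl C n X i) (trunc_incl C k (trunc C n X) i)) = rep (trunc_incl
    C k X i)"
    by cases (use assms(2) in \<open>simp_all add: rep_trunc_incl_high[OF X] rep_trunc_incl_high[OF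
      is_complex_trunc[OF X]]
      trunc_incl_eq ob_trunc df_trunc\<close>)
  then show "Comp C (trunc_incl C n X i) (trunc_incl C k (trunc C n X) i) = trunc_incl C k X i"
    using assms(2) by (intro rep_eqI) (simp_all add: trunc_trunc_less)
qed

lemma trunc_K_htpy:
  assumes X: "is_complex C X" "is_complex C Y" and f: "chain_map C X Y \<phi>"
  shows "on_arr (trunc_K C n) (htpy_arrow C X Y \<phi>) =
    htpy_arrow C (trunc C n X) (trunc C n Y) (trunc_map C n X Y \<phi>)"
proof -
  note cT = is_complex_trunc[OF X(1), of n] is_complex_trunc[OF X(2), of n]
  have "(\<exists>\<phi>'\<in>{\<psi>. chain_map C X Y \<psi> \<and> homotopic C X Y \<phi> \<psi>}.
      homotopic C (trunc C n X) (trunc C n Y) (trunc_map C n X Y \<phi>') \<psi>) \<longleftrightarrow>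
    homotopic C (trunc C n X) (trunc C n Y) (trunc_map C n X Y \<phi>) \<psi>" (is "?L \<psi> \<longleftrightarrow> ?R \<psi>")
    if p: "chain_map C (trunc C n X) (trunc C n Y) \<psi>" for \<psi>
  proof
    assume "?L \<psi>"
    then obtain \<phi>' where a: "chain_map C X Y \<phi>'" "homotopic C X Y \<phi> \<phi>'"
      "homotopic C (trunc C n X) (trunc C n Y) (trunc_map C n X Y \<phi>') \<psi>"
      by auto
    show "?R \<psi>"
      using homotopic_trans[OF cT chain_map_trunc[OF X f] chain_map_trunc[OF X a(1)] p
          trunc_map_homotopic[OF X f a(1,2)] a(3)] .
  next
    assume "?R \<psi>"
    then show "?L \<psi>"
      using f homotopic_refl[OF X f] by blast
  qed
  then show ?thesis by (auto simp: trunc_K_def htpy_arrow_def)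
qed

end

section \<open>Right bounded complexes up to homotopy\<close>

context preadditive_category
begin

lemma inverse_pair_K_iff:
  assumes X: "is_complex C X" "is_complex C Y" and f: "chain_map C X Y f" and g: "chain_map C Y X g"
  shows "inverse_pair (K_cat C) (htpy_arrow C X Y f) (htpy_arrow C Y X g) \<longleftrightarrow>
    homotopic C X X (\<lambda>n. Comp C (g n) (f n)) (\<lambda>n. Ident C (ob X n)) \<and>
    homotopic C Y Y (\<lambda>n. Comp C (f n) (g n)) (\<lambda>n. Ident C (ob Y n))"
proof -
  have a: "htpy_arrow C X Y f \<in> Arr (K_cat C)" "htpy_arrow C Y X g \<in> Arr (K_cat C)"
    unfolding Arr_K using X f g by blast+
  show ?thesis
    unfolding inverse_pair_def Comp_htpy[OF X X(1) f g] Comp_htpy[OF X(2,1,2) g f] Ident_K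
      Dom_htpy Cod_htpy
    using a htpy_arrow_eq_iff[OF X(1,1) chain_map_Comp[OF X X(1) f g] chain_map_Ident[OF X(1)]]
      htpy_arrow_eq_iff[OF X(2,2) chain_map_Comp[OF X(2,1,2) g f] chain_map_Ident[OF X(2)]]
    by simp
qed

lemma isomorphic_K_iff:
  "isomorphic (K_cat C) X Y \<longleftrightarrow> is_complex C X \<and> is_complex C Y \<and>
    (\<exists>f g. chain_map C X Y f \<and> chain_map C Y X g \<and>
      homotopic C X X (\<lambda>n. Comp C (g n) (f n)) (\<lambda>n. Ident C (ob X n)) \<and>
      homotopic C Y Y (\<lambda>n. Comp C (f n) (g n)) (\<lambda>n. Ident C (ob Y n)))" (is "_ \<longleftrightarrow> ?R")
proof
  assume "isomorphic (K_cat C) X Y"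
  then obtain F G where p: "inverse_pair (K_cat C) F G" "Dom (K_cat C) F = X" "Cod (K_cat C) F = Y"
    by (auto simp: isomorphic_def)
  then have "F \<in> Arr (K_cat C)" "G \<in> Arr (K_cat C)" "Dom (K_cat C) G = Y" "Cod (K_cat C) G = X"
    by (auto simp: inverse_pair_def)
  then obtain f g where "is_complex C X" "is_complex C Y" "chain_map C X Y f" "chain_map C Y X g"
    "F = htpy_arrow C X Y f" "G = htpy_arrow C Y X g"
    using p unfolding Arr_K by (auto simp del: split_paired_Ex)
  then show ?R
    using p(1) inverse_pair_K_iff by blast
next
  assume ?R
  then show "isomorphic (K_cat C) X Y"
    unfolding isomorphic_def using inverse_pair_K_iff Dom_htpy Cod_htpy by blast
qed

lemma isomorphic_K_sym: "isomorphic (K_cat C) X Y \<Longrightarrow> isomorphic (K_cat C) Y X"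
  unfolding isomorphic_K_iff by blast

text \<open>The degreewise identities are null-homotopic above degree \<open>N\<close>. In contrast to being homotopy
  equivalent to a right bounded complex, this passes to mapping cones by an explicit formula.\<close>

definition contractible_above :: "('a, 'b) cochain \<Rightarrow> int \<Rightarrow> bool" where
  "contractible_above X N \<longleftrightarrow> (\<exists>h. (\<forall>n. h n \<in> Hom C (ob X n) (ob X (n - 1))) \<and>
     (\<forall>n>N. rep (Ident C (ob X n)) = rep (df X (n - 1)) * rep (h n) + rep (h (n + 1)) * rep (df X
       n)))"

lemma contractible_aboveE:
  assumes "contractible_above X N"
  obtains h where "\<And>n. arr (h n)" "\<And>n. dom (h n) = ob X n" "\<And>n. cod (h n) = ob X (n - 1)"
    "\<And>n. N < n \<Longrightarrow> rep (Ident C (ob X n)) = rep (df X (n - 1)) * rep (h n) + rep (h (n + 1)) * rep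
      (df X n)"
  using assms unfolding contractible_above_def Hom_iff by blast

lemma contractible_above_mono: "contractible_above X N \<Longrightarrow> N \<le> M \<Longrightarrow> contractible_above X M"
  unfolding contractible_above_def by (meson le_less_trans)

text \<open>Above the bound of \<open>Y\<close> the composite \<open>g f\<close> factors through
  zero objects, so the homotopy from \<open>g f\<close> to the identity becomes, up to sign, a
  contraction of \<open>X\<close>.\<close>

lemma isomorphic_right_bounded_contractible:
  assumes "isomorphic (K_cat C) X Y" and "right_bounded C Y"
  shows "\<exists>N. contractible_above X N"
proof -
  obtain f g where X: "is_complex C X" "is_complex C Y" "chain_map C X Y f" "chain_map C Y X g"
    "homotopic C X X (\<lambda>n. Comp C (g n) (f n)) (\<lambda>n. Ident C (ob X n))"
    using assms(1) unfolding isomorphic_K_iff by blast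
  note [simp] = complexD[OF X(1)] complexD[OF X(2)] chain_mapD[OF X(3,1,2)] chain_mapD[OF X(4,2,1)]
  obtain h where "htpy X X (\<lambda>n. Comp C (g n) (f n)) (\<lambda>n. Ident C (ob X n)) h"
    by (rule homotopicE[OF X(5,1,1) chain_map_Ident[OF X(1)]])
  note h = htpyD[OF this]
  obtain N where N: "\<And>n. N < n \<Longrightarrow> zero_object C (ob Y n)"
    using assms(2) unfolding right_bounded_def by blast
  have "contractible_above X N"
    unfolding contractible_above_def
  proof (intro exI[of _ "\<lambda>n. Neg C (h n)"] conjI allI impI)
    fix n assume "N < n"
    then have "rep (f n) = 0" using rep_zero_object(2)[OF N, of n "f n"] by simp
    then have "rep (Ident C (ob X n)) = - (rep (df X (n - 1)) * rep (h n) + rep (h (n + 1)) * rep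
      (df X n))"
      using h(1-3) h(4)[of n] by (simp add: eq_neg_iff_add_eq_0 del: minus_add_distrib)
    then show "rep (Ident C (ob X n)) = rep (df X (n - 1)) * rep (Neg C (h n)) + rep (Neg C (h (n
      + 1))) * rep (df X n)"
      using h(1-3) by simp
  qed (use h in \<open>simp add: Hom_iff\<close>)
  then show ?thesis ..
qed

end

context abelian_category
begin

text \<open>The chain endomorphism \<open>e = 1 - (d h + h d)\<close> is homotopic to the identity
  and vanishes above \<open>N\<close>, so it factors as the inclusion after a map \<open>r\<close>
  to the truncation. The negative of \<open>h\<close> and the negative of its restriction to the
  truncation show that \<open>r\<close> and the inclusion are mutually inverse up to
  homotopy.\<close>

lemma contractible_above_trunc:
  assumes X: "is_complex C X" and c: "contractible_above X N"
  shows "isomorphic (K_cat C) X (trunc C N X)"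
proof -
  obtain h where h: "\<And>n. arr (h n)" "\<And>n. dom (h n) = ob X n" "\<And>n. cod (h n) = ob X (n - 1)"
    "\<And>n. N < n \<Longrightarrow> rep (Ident C (ob X n)) = rep (df X (n - 1)) * rep (h n) + rep (h (n + 1)) * rep
      (df X n)"
    using contractible_aboveE[OF c] by blast
  let ?T = "trunc C N X" and ?i = "trunc_incl C N X"
  note cT = is_complex_trunc[OF X, of N]
  note [simp] = complexD[OF X] complexD[OF cT] trunc_incl(1-3)[OF X] h(1-3)
  define e where "e n = Plus C (Ident C (ob X n))
    (Neg C (Plus C (Comp C (df X (n - 1)) (h n)) (Comp C (h (n + 1)) (df X n))))" for n
  have e [simp]: "arr (e n)" "dom (e n) = ob X n" "cod (e n) = ob X n" for n
    by (simp_all add: e_def)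
  have re: "rep (e n) = rep (Ident C (ob X n)) - (rep (df X (n - 1)) * rep (h n) + rep (h (n +
    1)) * rep (df X n))" for n
    by (simp add: e_def)
  define r where "r n = (if n \<le> N then e n else Zero C (ob X n) (ob ?T n))" for n
  have r [simp]: "arr (r n)" "dom (r n) = ob X n" "cod (r n) = ob ?T n" for n
    by (simp_all add: r_def ob_trunc)
  have ir: "rep (?i n) * rep (r n) = rep (e n)" for n
  proof (cases "n \<le> N")
    case True
    then show ?thesis by (simp add: r_def trunc_incl_eq(1))
  next
    case False
    then show ?thesis using h(4)[of n] by (simp add: r_def re)
  qed
  have ir': "rep (?i n) * (rep (r n) * z) = rep (e n) * z" for n z
    using ir[of n] by (simp flip: mult.assoc)
  have ed: "rep (e (n + 1)) * rep (df X n) = rep (df X n) * rep (e n)" for n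
    by (simp add: re algebra_simps)
  have cr: "chain_map C X ?T r"
  proof (rule chain_mapI[OF X cT])
    fix n
    have "rep (Comp C (r (n + 1)) (df X n)) = rep (Comp C (df ?T n) (r n))"
      by (rule trunc_incl_cancel[OF X, where n = N and i = "n + 1"])
        (simp_all add: ir' trunc_incl_comm[OF X] ir ed)
    then show "rep (r (n + 1)) * rep (df X n) = rep (df ?T n) * rep (r n)" by simp
  qed (simp add: Hom_iff)
  note ci = chain_map_trunc_incl[OF X, of N]
  have "homotopic C X X (\<lambda>n. Comp C (?i n) (r n)) (\<lambda>n. Ident C (ob X n))"
    by (rule homotopicI[OF X X, where h = "\<lambda>n. Neg C (h n)"]) (simp_all add: Hom_iff ir re)
  moreover have "homotopic C ?T ?T (\<lambda>n. Comp C (r n) (?i n)) (\<lambda>n. Ident C (ob ?T n))"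
  proof -
    have hh: "h i \<in> Hom C (ob X i) (ob X (i - 1))" for i by (simp add: Hom_iff)
    obtain h' where h': "\<And>i. arr (h' i)" "\<And>i. dom (h' i) = ob ?T i"
      "\<And>i. cod (h' i) = ob ?T (i - 1)"
      "\<And>j i. j = i - 1 \<Longrightarrow> rep (?i j) * rep (h' i) = rep (h i) * rep (?i i)"
      "\<And>j i z. j = i - 1 \<Longrightarrow> rep (?i j) * (rep (h' i) * z) = rep (h i) * (rep (?i i) * z)"
      by (rule trunc_htpy[of X X h N, OF X X hh]) blast
    note [simp] = h'(1-3)
    show ?thesis
    proof (rule homotopicI[OF cT cT, where h = "\<lambda>n. Neg C (h' n)"])
      fix n
      have "rep (Comp C (r n) (?i n)) = rep (Plus C (Ident C (ob ?T n))
        (Plus C (Comp C (df ?T (n - 1)) (Neg C (h' n))) (Comp C (Neg C (h' (n + 1))) (df ?T n))))"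
        by (rule trunc_incl_cancel[OF X, where n = N and i = n])
          (simp_all add: ir' re h'(4,5) trunc_incl_comm[OF X] distrib_left distrib_right mult.assoc
            left_diff_distrib right_diff_distrib)
      then show "rep (Comp C (r n) (?i n)) = rep (Ident C (ob ?T n)) +
         (rep (df ?T (n - 1)) * rep (Neg C (h' n)) + rep (Neg C (h' (n + 1))) * rep (df ?T n))"
        by simp
    qed (simp_all add: Hom_iff)
  qed
  ultimately show ?thesis
    unfolding isomorphic_K_iff using X cT cr ci by blast
qed

lemma K_minus_obj_iff:
  assumes X: "is_complex C X"
  shows "X \<in> K_minus_obj C \<longleftrightarrow> (\<exists>N. contractible_above X N)"
proof
  assume "X \<in> K_minus_obj C"
  then show "\<exists>N. contractible_above X N"
    unfolding K_minus_obj_def using isomorphic_right_bounded_contractible by blast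
next
  assume "\<exists>N. contractible_above X N"
  then show "X \<in> K_minus_obj C"
    unfolding K_minus_obj_def
    using contractible_above_trunc[OF X] is_complex_trunc[OF X] right_bounded_trunc[OF X] by blast
qed

lemma isomorphic_exact_at:
  assumes "isomorphic (K_cat C) X Y" and "exact_at Y n"
  shows "exact_at X n"
  using assms unfolding isomorphic_K_iff by (metis exact_at_retract)

text \<open>Exactness passes both ways along a homotopy equivalence, so it can be read off
  \<open>X\<close> itself. The filter \<open>top\<close>, for which \<open>eventually\<close> means
  in every degree, gives this the shape of the next characterization.\<close>

lemma K_minus_empty_obj_iff:
  assumes X: "is_complex C X"
  shows "X \<in> K_minus_empty_obj C \<longleftrightarrow> X \<in> K_minus_obj C \<and> eventually (exact_at X) top"
proof
  assume "X \<in> K_minus_empty_obj C"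
  then obtain Y where Y: "is_complex C Y" "right_bounded C Y" "exact_complex C Y"
    "isomorphic (K_cat C) X Y"
    unfolding K_minus_empty_obj_def by blast
  then have "exact_at X n" for n
    using isomorphic_exact_at cohomology_zero_iff[OF Y(1)] by (auto simp: exact_complex_def)
  then show "X \<in> K_minus_obj C \<and> eventually (exact_at X) top"
    using Y unfolding K_minus_obj_def by auto
next
  assume a: "X \<in> K_minus_obj C \<and> eventually (exact_at X) top"
  then obtain Y where Y: "is_complex C Y" "right_bounded C Y" "isomorphic (K_cat C) X Y"
    unfolding K_minus_obj_def by blast
  then have "exact_at Y n" for n using a isomorphic_exact_at[OF isomorphic_K_sym[OF Y(3)]] by auto
  then show "X \<in> K_minus_empty_obj C"
    unfolding K_minus_empty_obj_def exact_complex_def using Y cohomology_zero_iff[OF Y(1)] by blast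
qed

text \<open>A right bounded representative has zero objects, and therefore zero cohomology, in large
  degrees. Boundedness of cohomology is thus a condition near minus infinity only, which explains
  \<open>at_bot\<close>.\<close>

lemma K_minus_b_obj_iff:
  assumes X: "is_complex C X"
  shows "X \<in> K_minus_b_obj C \<longleftrightarrow> X \<in> K_minus_obj C \<and> eventually (exact_at X) at_bot"
proof
  assume "X \<in> K_minus_b_obj C"
  then obtain Y M N where Y: "is_complex C Y" "right_bounded C Y" "isomorphic (K_cat C) X Y"
    "\<And>n. n < M \<or> N < n \<Longrightarrow> cohomology_zero C Y n"
    unfolding K_minus_b_obj_def bounded_cohomology_def by blast
  then have "exact_at X n" if "n < M" for n
    using isomorphic_exact_at cohomology_zero_iff[OF Y(1)] that by blast
  then show "X \<in> K_minus_obj C \<and> eventually (exact_at X) at_bot"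
    using Y unfolding K_minus_obj_def eventually_at_bot_dense by blast
next
  assume a: "X \<in> K_minus_obj C \<and> eventually (exact_at X) at_bot"
  then obtain Y N where Y: "is_complex C Y" "right_bounded C Y" "isomorphic (K_cat C) X Y"
    and N: "\<And>n. N < n \<Longrightarrow> zero_object C (ob Y n)"
    unfolding K_minus_obj_def right_bounded_def by blast
  obtain M where "\<And>n. n < M \<Longrightarrow> exact_at X n"
    using a unfolding eventually_at_bot_dense by blast
  then have "exact_at Y n" if "n < M \<or> N < n" for n
    using that Y(3) isomorphic_exact_at isomorphic_K_sym exact_at_zero_object[OF Y(1)] N by blast
  then show "X \<in> K_minus_b_obj C"
    unfolding K_minus_b_obj_def bounded_cohomology_def using Y cohomology_zero_iff[OF Y(1)] by blast
qed

section \<open>Closure of the right bounded homotopy category under cones and shifts\<close>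

lemma mapping_cone_K_minus:
  assumes Z: "is_mapping_cone C X Y \<phi> Z" and X: "is_complex C X" "is_complex C Y"
    and f: "chain_map C X Y \<phi>"
    and K: "X \<in> K_minus_obj C" "Y \<in> K_minus_obj C"
  shows "Z \<in> K_minus_obj C"
proof -
  obtain N M where NM: "contractible_above X N" "contractible_above Y M"
    using K K_minus_obj_iff X by blast
  then have "contractible_above X (max N M)" "contractible_above Y (max N M)"
    using contractible_above_mono by auto
  then obtain h k where
    h: "\<And>n. arr (h n)" "\<And>n. dom (h n) = ob X n" "\<And>n. cod (h n) = ob X (n - 1)"
    "\<And>n. max N M < n \<Longrightarrow> rep (Ident C (ob X n)) = rep (df X (n - 1)) * rep (h n) + rep (h (n + 1))
      * rep (df X n)"
    and k: "\<And>n. arr (k n)" "\<And>n. dom (k n) = ob Y n" "\<And>n. cod (k n) = ob Y (n - 1)"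
    "\<And>n. max N M < n \<Longrightarrow> rep (Ident C (ob Y n)) = rep (df Y (n - 1)) * rep (k n) + rep (k (n + 1))
      * rep (df Y n)"
    by (elim contractible_aboveE) blast
  obtain i1 i2 p1 p2 where c: "cone_splitting X Y \<phi> Z i1 i2 p1 p2"
    by (rule mapping_coneE[OF Z X f])
  note D = cone_splittingD[OF c X f]
  note cZ = D(1) and b = D(2) and r = D(3) and p = D(4-7)
  note b' = biproductD[OF b[of "n - 1" for n], simplified]
  note [simp] = complexD[OF X(1)] complexD[OF X(2)] complexD[OF cZ] chain_mapD[OF f X]
    biproductD[OF b] h(1-3) k(1-3) b'
  \<comment> \<open>The contraction of the cone is
    \<open>(x, y) \<mapsto> (- h x, k y + k \<phi> h x)\<close>. The off-diagonal term
    \<open>k \<phi> h\<close> compensates for the entry \<open>\<phi>\<close> of the differential;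
    \<open>a\<close> and \<open>c\<close> are the two components.\<close>
  define a where "a n = Neg C (Comp C (h (n + 1)) (p1 n))" for n
  define c where "c n = Plus C (Comp C (k n) (p2 n)) (Comp C (k n) (Comp C (\<phi> n) (Comp C (h (n +
    1)) (p1 n))))" for n
  have [simp]: "arr (a n)" "dom (a n) = ob Z n" "cod (a n) = ob X n"
    "arr (c n)" "dom (c n) = ob Z n" "cod (c n) = ob Y (n - 1)" for n
    by (simp_all add: a_def c_def)
  have ac: "rep (a n) = - (rep (h (n + 1)) * rep (p1 n))"
    "rep (c n) = rep (k n) * rep (p2 n) + rep (k n) * (rep (\<phi> n) * (rep (h (n + 1)) * rep (p1
      n)))" for n
    by (simp_all add: a_def c_def)
  define H where "H n = Plus C (Comp C (i1 (n - 1)) (a n)) (Comp C (i2 (n - 1)) (c n))" for n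
  have H [simp]: "arr (H n)" "dom (H n) = ob Z n" "cod (H n) = ob Z (n - 1)" for n
    by (simp_all add: H_def)
  have pH: "m = n - 1 \<Longrightarrow> rep (p1 m) * rep (H n) = rep (a n)"
    "m = n - 1 \<Longrightarrow> rep (p2 m) * rep (H n) = rep (c n)"
    "m = n - 1 \<Longrightarrow> rep (p1 m) * (rep (H n) * z) = rep (a n) * z"
    "m = n - 1 \<Longrightarrow> rep (p2 m) * (rep (H n) * z) = rep (c n) * z" for m n z
    by (simp_all add: H_def distrib_left distrib_right mult.assoc)
  have "rep (Ident C (ob Z n)) = rep (df Z (n - 1)) * rep (H n) + rep (H (n + 1)) * rep (df Z n)"
    if n: "max N M < n" for n
  proof -
    have hx: "rep (h (n + 1 + 1)) * (rep (df X (n + 1)) * z) = rep (Ident C (ob X (n + 1))) * z -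
      rep (df X n) * (rep (h (n + 1)) * z)" for z
      using arg_cong[OF h(4)[of "n + 1"], of "\<lambda>y. y * z"] n by (simp add: distrib_right mult.assoc)
    have ky: "rep (k (n + 1)) * (rep (df Y n) * z) = rep (Ident C (ob Y n)) * z - rep (df Y (n -
      1)) * (rep (k n) * z)" for z
      using arg_cong[OF k(4)[of n], of "\<lambda>y. y * z"] n by (simp add: distrib_right mult.assoc)
    have "rep (Ident C (ob Z n)) =
      rep (Plus C (Comp C (df Z (n - 1)) (H n)) (Comp C (H (n + 1)) (df Z n)))"
    proof (rule biproduct_eqI[OF b[of n]])
      show "rep (p1 n) * rep (Ident C (ob Z n)) =
        rep (p1 n) * rep (Plus C (Comp C (df Z (n - 1)) (H n)) (Comp C (H (n + 1)) (df Z n)))"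
        using hx by (simp add: distrib_left p pH ac mult.assoc)
      show "rep (p2 n) * rep (Ident C (ob Z n)) =
        rep (p2 n) * rep (Plus C (Comp C (df Z (n - 1)) (H n)) (Comp C (H (n + 1)) (df Z n)))"
        using hx ky by (simp add: distrib_left distrib_right right_diff_distrib p pH ac mult.assoc)
    qed simp_all
    then show ?thesis by simp
  qed
  then have "contractible_above Z (max N M)"
    unfolding contractible_above_def by (intro exI[of _ H]) (simp add: Hom_iff)
  then show ?thesis using K_minus_obj_iff[OF cZ] by blast
qed

text \<open>The translate \<open>X[-1]\<close>, with the sign of the differential changed. Applied
  to a mapping cone it gives the homotopy fibre.\<close>

definition shift :: "('a, 'b) cochain \<Rightarrow> ('a, 'b) cochain" where
  "shift X = \<lparr>ob = (\<lambda>n. ob X (n - 1)), df = (\<lambda>n. Neg C (df X (n - 1)))\<rparr>"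

lemma shift_simps [simp]: "ob (shift X) n = ob X (n - 1)" "df (shift X) n = Neg C (df X (n - 1))"
  by (simp_all add: shift_def)

lemma is_complex_shift:
  assumes X: "is_complex C X"
  shows "is_complex C (shift X)"
proof -
  note [simp] = complexD[OF X]
  show ?thesis by (rule is_complexI) (simp_all add: Hom_iff)
qed

lemma shift_K_minus:
  assumes X: "is_complex C X" and K: "X \<in> K_minus_obj C"
  shows "shift X \<in> K_minus_obj C"
proof -
  note [simp] = complexD[OF X]
  obtain N where "contractible_above X N" using K K_minus_obj_iff X by blast
  then obtain h where
    h: "\<And>n. arr (h n)" "\<And>n. dom (h n) = ob X n" "\<And>n. cod (h n) = ob X (n - 1)"
    "\<And>n. N < n \<Longrightarrow> rep (Ident C (ob X n)) = rep (df X (n - 1)) * rep (h n) + rep (h (n + 1)) * rep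
      (df X n)"
    by (elim contractible_aboveE) blast
  have "contractible_above (shift X) (N + 1)"
    unfolding contractible_above_def
    using h(1-3) h(4)[of "n - 1" for n] by (intro exI[of _ "\<lambda>n. Neg C (h (n - 1))"]) (simp add:
      Hom_iff)
  then show ?thesis using K_minus_obj_iff[OF is_complex_shift[OF X]] by blast
qed

lemma exact_at_shift:
  assumes X: "is_complex C X" and "exact_at X (n - 1)"
  shows "exact_at (shift X) n"
proof (rule exact_atI)
  note [simp] = complexD[OF X]
  fix A a assume a: "arr a" "dom a = A" "cod a = ob (shift X) n" "rep (df (shift X) n) * rep a = 0"
  then have *: "a \<in> Hom C A (ob X (n - 1))" "rep (df X (n - 1)) * rep a = 0"
    by (simp_all add: Hom_iff)
  obtain A' e b where e: "epic C e" "dom e = A'" "cod e = A" "arr b" "dom b = A'"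
    "cod b = ob X (n - 1 - 1)" "rep a * rep e = rep (df X (n - 1 - 1)) * rep b"
    by (rule exact_atE[OF assms(2) *]) blast
  then show "boundary (shift X) n A a"
    by (intro boundaryI[of e A' A "Neg C b"]) (simp_all add: Hom_iff)
qed

end

section \<open>The inverted arrows\<close>

context abelian_category
begin

text \<open>In these degrees the inclusion consists of identities, so \<open>x' = y\<close> and
  \<open>y' = 0\<close> solve the condition on the trivial cover. This makes the inclusion a
  denominator for \<open>at_bot\<close>.\<close>

lemma qis_at_trunc_incl:
  assumes X: "is_complex C X" and "i + 1 < n"
  shows "qis_at (trunc C n X) X (trunc_incl C n X) i"
proof (rule qis_atI)
  note [simp] = complexD[OF X]
  fix A x y assume "arr x" "dom x = A" "cod x = ob (trunc C n X) (i + 1)" "arr y" "dom y = A"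
    "cod y = ob X i" "A \<in> Obj C" "rep (trunc_incl C n X (i + 1)) * rep x = rep (df X i) * rep y"
  then show "cone_boundary (trunc C n X) X (trunc_incl C n X) i A x y"
    using assms(2)
    by (intro cone_boundaryI[of "Ident C A" A A y _ _ "Zero C A (ob X (i - 1))"])
      (simp_all add: Hom_iff mult.assoc ob_trunc df_trunc trunc_incl_eq)
qed

text \<open>Below \<open>n\<close> the condition is the one for \<open>\<phi>\<close>. In degree
  \<open>n\<close> the element \<open>x\<close> lies in the image of \<open>df X n\<close> and is
  first lifted to \<open>X^n\<close>. In degree \<open>n + 1\<close> the element \<open>x\<close>
  vanishes and \<open>y\<close> lies in the image of \<open>df Y n\<close>, so it is a boundary on a
  cover; ending the truncation with the image is what makes this work. Above that everything is
  zero.\<close>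

lemma qis_at_trunc_map:
  assumes X: "is_complex C X" "is_complex C Y" and f: "chain_map C X Y \<phi>"
    and q: "\<And>m. m \<le> n \<Longrightarrow> qis_at X Y \<phi> m"
  shows "qis_at (trunc C n X) (trunc C n Y) (trunc_map C n X Y \<phi>) m"
proof -
  note cT = is_complex_trunc[OF X(1), of n] is_complex_trunc[OF X(2), of n]
  note [simp] = complexD[OF X(1)] complexD[OF X(2)] chain_mapD[OF f X]
    trunc_map(1-3)[OF X f, of n]
  have cTD [simp]: "arr (df (trunc C n X) i)" "arr (df (trunc C n Y) i)"
      "dom (df (trunc C n X) i) = ob (trunc C n X) i"
        "dom (df (trunc C n Y) i) = ob (trunc C n Y) i"
      "cod (df (trunc C n X) i) = ob (trunc C n X) (i + 1)"
        "cod (df (trunc C n Y) i) = ob (trunc C n Y) (i + 1)" for i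
    using complexD[OF cT(1)] complexD[OF cT(2)] by auto
  show ?thesis
  proof (rule qis_atI)
    fix A x y assume a: "arr x" "dom x = A" "cod x = ob (trunc C n X) (m + 1)" "arr y" "dom y = A"
      "cod y = ob (trunc C n Y) m" "rep (df (trunc C n X) (m + 1)) * rep x = 0"
      "rep (trunc_map C n X Y \<phi> (m + 1)) * rep x = rep (df (trunc C n Y) m) * rep y" "A \<in> Obj C"
    consider "m < n" | "m = n" | "m = n + 1" | "n + 1 < m" by linarith
    then show "cone_boundary (trunc C n X) (trunc C n Y) (trunc_map C n X Y \<phi>) m A x y"
    proof cases
      case 1
      have "rep (trunc_incl C n X (m + 1 + 1)) * (rep (df (trunc C n X) (m + 1)) * rep x) = rep
        (df X (m + 1)) * rep x"
        using a(1-6) 1 by (simp only: trunc_incl_comm[OF X(1)]) (simp add: trunc_incl_eq(1)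
          ob_trunc)
      then have 2: "rep (df X (m + 1)) * rep x = 0" by (simp only: a(7) mult_zero_right)
      have 3: "rep (\<phi> (m + 1)) * rep x = rep (df Y m) * rep y"
        using a(8) 1 by (simp add: trunc_map_def df_trunc)
      have 4: "x \<in> Hom C A (ob X (m + 1))" "y \<in> Hom C A (ob Y m)"
        using a 1 by (simp_all add: Hom_iff ob_trunc)
      obtain A' e x' y' where e: "epic C e" "dom e = A'" "cod e = A"
        "arr x'" "dom x' = A'" "cod x' = ob X m" "arr y'" "dom y' = A'" "cod y' = ob Y (m - 1)"
        "rep x * rep e = rep (df X m) * rep x'"
        "rep y * rep e = rep (\<phi> m) * rep x' + rep (df Y (m - 1)) * rep y'"
        by (rule qis_atE[OF q 4 2 3]) (use 1 in simp, blast)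
      then show ?thesis
        using 1 by (intro cone_boundaryI[of e A' A x' _ _ y']) (simp_all add: Hom_iff ob_trunc
          trunc_map_def df_trunc)
    next
      case 2
      have a': "cod x = im_obj C (df X n)" "cod y = ob Y n"
        using a 2 by (simp_all add: ob_trunc)
      have dy: "rep (trunc_map C n X Y \<phi> (n + 1)) * rep x = rep (im_epi C (df Y n)) * rep y"
        using a 2 by (simp add: df_trunc)
      obtain p z where p: "epic C p" "cod p = A" "arr z" "dom z = dom p" "cod z = ob X n"
        "rep (im_epi C (df X n)) * rep z = rep x * rep p"
        using pullback_epic[OF epic_im_epi[of "df X n"] a(1)] a a' by auto
      \<comment> \<open>With \<open>z\<close> a lift of \<open>x\<close> on the cover
        \<open>p\<close>, the difference \<open>w = y p - \<phi> z\<close> is a cycle of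
        \<open>Y\<close>. The hypothesis for \<open>\<phi>\<close> in degree \<open>n\<close> is
        applied to the pair \<open>(0, w)\<close>.\<close>
      define w where "w = Plus C (Comp C y p) (Neg C (Comp C (\<phi> n) z))"
      have w: "arr w" "dom w = dom p" "cod w = ob Y n" using p a a' by (simp_all add: w_def)
      have "rep (df Y n) * rep y = rep (im_mono C (df Y n)) * (rep (im_epi C (df Y n)) * rep y)"
        by (simp flip: mult.assoc)
      also have "\<dots> = rep (trunc_incl C n Y (n + 1)) * (rep (trunc_map C n X Y \<phi> (n + 1)) * rep x)"
        by (simp add: dy trunc_incl_eq)
      also have "\<dots> = rep (\<phi> (n + 1)) * (rep (im_mono C (df X n)) * rep x)"
        by (simp only: trunc_incl_map[OF X f]) (simp add: trunc_incl_eq)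
      finally have dy': "rep (df Y n) * rep y = rep (\<phi> (n + 1)) * (rep (im_mono C (df X n)) * rep
        x)" .
      have dz: "rep (df X n) * rep z = rep (im_mono C (df X n)) * (rep x * rep p)"
        by (simp flip: p(6)) (simp flip: mult.assoc)
      have "rep (df Y n) * rep w = rep (df Y n) * rep y * rep p - rep (\<phi> (n + 1)) * (rep (df X n)
        * rep z)"
        using p(1-5) a(1-6) a' by (simp add: w_def right_diff_distrib mult.assoc)
      also have "\<dots> = 0" by (simp add: dy' dz mult.assoc)
      finally have dw: "rep (df Y n) * rep w = 0" .
      have z0: "Zero C (dom p) (ob X (n + 1)) \<in> Hom C (dom p) (ob X (n + 1))"
        "w \<in> Hom C (dom p) (ob Y n)"
        "rep (df X (n + 1)) * rep (Zero C (dom p) (ob X (n + 1))) = 0"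
        "rep (\<phi> (n + 1)) * rep (Zero C (dom p) (ob X (n + 1))) = rep (df Y n) * rep w"
        using p w dw by (simp_all add: Hom_iff)
      obtain A' e z' y' where e: "epic C e" "dom e = A'" "cod e = dom p"
        "arr z'" "dom z' = A'" "cod z' = ob X n" "arr y'" "dom y' = A'" "cod y' = ob Y (n - 1)"
        "rep (Zero C (dom p) (ob X (n + 1))) * rep e = rep (df X n) * rep z'"
        "rep w * rep e = rep (\<phi> n) * rep z' + rep (df Y (n - 1)) * rep y'"
        by (rule qis_atE[OF q z0, OF order.refl]) blast
      \<comment> \<open>The correction \<open>z'\<close> is a cycle of \<open>X\<close>; as the
        image arrow is monic, \<open>im_epi\<close> already kills it. Hence \<open>z e + z'\<close>
        still lifts \<open>x\<close>, and it accounts for \<open>y\<close> up to a boundary.\<close>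
      have "rep (im_mono C (df X n)) * rep (Comp C (im_epi C (df X n)) z') = 0"
        using e(1-9) e(10)[symmetric] p by (simp flip: mult.assoc)
      then have "rep (Comp C (im_epi C (df X n)) z') = 0"
        using e by (intro monicD[OF monic_im_mono[of "df X n"]]) auto
      then have 1: "rep (im_epi C (df X n)) * rep z' = 0" using e by simp
      have "rep x * rep p * rep e = rep (im_epi C (df X n)) * rep (Plus C (Comp C z e) z')"
        using e p 1 by (simp add: distrib_left flip: mult.assoc)
      moreover have "rep y * rep p * rep e = rep (\<phi> n) * rep (Plus C (Comp C z e) z') + rep (df Y
        (n - 1)) * rep y'"
        using e(1-9) p(1-5) a(1-6) a' e(11)
          by (simp add: w_def distrib_left left_diff_distrib mult.assoc algebra_simps)
      ultimately show ?thesis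
        using 2 e(1-9) p(1-5)
        by (intro cone_boundaryI[of "Comp C p e" A' A "Plus C (Comp C z e) z'" _ _ y'])
          (simp_all add: Hom_iff ob_trunc trunc_map_def df_trunc epic_Comp mult.assoc)
    next
      case 3
      have a': "cod x = zero_obj C" "cod y = im_obj C (df Y n)" "rep x = 0"
        using a 3 rep_zero_object(2)[OF zero_object_zero_obj, of x] by (simp_all add: ob_trunc)
      obtain p z where p: "epic C p" "cod p = A" "arr z" "dom z = dom p" "cod z = ob Y n"
        "rep (im_epi C (df Y n)) * rep z = rep y * rep p"
        using pullback_epic[OF epic_im_epi[of "df Y n"] a(4)] a a' by auto
      then show ?thesis
        using 3 a' by (intro cone_boundaryI[of p "dom p" A "Zero C (dom p) (im_obj C (df X n))" _
          _ z])
          (simp_all add: Hom_iff ob_trunc df_trunc)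
    next
      case 4
      have a': "rep y = 0" "rep x = 0"
        using a 4 rep_zero_object(2)[OF zero_object_zero_obj, of x] rep_zero_object(2)[OF
          zero_object_zero_obj, of y]
        by (simp_all add: ob_trunc)
      then show ?thesis
        using a trunc_ob_Obj[OF X(1)] trunc_ob_Obj[OF X(2)]
        by (intro cone_boundaryI[of "Ident C A" A A "Zero C A (ob (trunc C n X) m)" _ _ "Zero C A
          (ob (trunc C n Y) (m - 1))"])
          (simp_all add: Hom_iff)
    qed
  qed
qed

text \<open>Both Verdier quotients are treated at once: the arrows inverted in \<open>D_minus\<close> are the
  quasi-isomorphisms in all degrees, those inverted in \<open>D_minus_inf\<close> are the quasi-isomorphisms in
  all sufficiently small degrees.\<close>

definition qis_class :: "int filter \<Rightarrow> ('a, 'b) karrow set" where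
  "qis_class F = {htpy_arrow C X Y \<phi> | X Y \<phi>. is_complex C X \<and> is_complex C Y \<and> X \<in> K_minus_obj C \<and>
     Y \<in> K_minus_obj C \<and> chain_map C X Y \<phi> \<and> eventually (qis_at X Y \<phi>) F}"

lemma htpy_arrow_qis_class:
  assumes X: "is_complex C X" "is_complex C Y" and f: "chain_map C X Y \<phi>"
  shows "htpy_arrow C X Y \<phi> \<in> qis_class F \<longleftrightarrow>
    X \<in> K_minus_obj C \<and> Y \<in> K_minus_obj C \<and> eventually (qis_at X Y \<phi>) F"
proof
  assume "htpy_arrow C X Y \<phi> \<in> qis_class F"
  then obtain X' Y' \<psi> where a: "htpy_arrow C X Y \<phi> = htpy_arrow C X' Y' \<psi>" "X' \<in> K_minus_obj C"
    "Y' \<in> K_minus_obj C" "chain_map C X' Y' \<psi>" "eventually (qis_at X' Y' \<psi>) F"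
    unfolding qis_class_def by blast
  have [simp]: "X' = X" "Y' = Y" using htpy_arrow_eqD[OF a(1)] by auto
  have "homotopic C X Y \<psi> \<phi>" using htpy_arrow_eq_iff[OF X _ f] a by auto
  then show "X \<in> K_minus_obj C \<and> Y \<in> K_minus_obj C \<and> eventually (qis_at X Y \<phi>) F"
    using a qis_at_homotopic[OF X _ f] by (auto elim!: eventually_mono)
qed (use assms in \<open>auto simp: qis_class_def\<close>)

text \<open>Every cone of \<open>\<phi>\<close> is exact precisely where \<open>\<phi>\<close>
  satisfies \<open>qis_at\<close>, and it lies in the right bounded homotopy category together with
  source and target. So the particular representative and cone in \<open>cone_in\<close> do not
  affect membership.\<close>

lemma cone_in_eq_qis_class:
  assumes N: "\<And>Z. is_complex C Z \<Longrightarrow> Z \<in> N \<longleftrightarrow> Z \<in> K_minus_obj C \<and> eventually (exact_at Z) F"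
  shows "cone_in C N = qis_class F"
proof (intro equalityI subsetI)
  fix f assume "f \<in> cone_in C N"
  then obtain X Y A \<phi> Z where f: "f = (X, Y, A)" "f \<in> Arr (K_minus C)" "\<phi> \<in> A" "Z \<in> N"
    "is_mapping_cone C X Y \<phi> Z"
    unfolding cone_in_def by auto
  obtain X' Y' \<psi> where p: "f = htpy_arrow C X' Y' \<psi>" "is_complex C X'" "is_complex C Y'"
    "X' \<in> K_minus_obj C" "Y' \<in> K_minus_obj C" "chain_map C X' Y' \<psi>"
    using f(2) by (auto simp: K_minus_simps)
  have [simp]: "X' = X" "Y' = Y" using f(1) p(1) by (auto simp: htpy_arrow_def)
  have A: "chain_map C X Y \<phi>" "homotopic C X Y \<psi> \<phi>" using f(1,3) p(1) by (auto simp: htpy_arrow_def)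
  then have "f = htpy_arrow C X Y \<phi>" using p htpy_arrow_eq_iff by auto
  moreover have "eventually (qis_at X Y \<phi>) F"
  proof -
    have "exact_at Z = qis_at X Y \<phi>" using exact_at_cone_iff[OF f(5) _ _ A(1)] p by auto
    moreover have "is_complex C Z" using f(5) by (simp add: is_mapping_cone_def)
    ultimately show ?thesis using N[of Z] f(4) by simp
  qed
  ultimately show "f \<in> qis_class F" unfolding qis_class_def using p A by auto
next
  fix f assume "f \<in> qis_class F"
  then obtain X Y \<phi> where f: "f = htpy_arrow C X Y \<phi>" "is_complex C X" "is_complex C Y"
    "X \<in> K_minus_obj C"
     "Y \<in> K_minus_obj C" "chain_map C X Y \<phi>" "eventually (qis_at X Y \<phi>) F"
    unfolding qis_class_def by blast
  obtain Z where Z: "is_mapping_cone C X Y \<phi> Z" using mapping_cone_exists f by blast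
  have "Z \<in> N"
  proof -
    have "exact_at Z = qis_at X Y \<phi>" using exact_at_cone_iff[OF Z f(2,3,6)] by auto
    moreover have "is_complex C Z" using Z by (simp add: is_mapping_cone_def)
    ultimately show ?thesis using N[of Z] f(7) mapping_cone_K_minus[OF Z f(2,3,6,4,5)] by simp
  qed
  moreover have "f \<in> Arr (K_minus C)" using f unfolding K_minus_simps by blast
  moreover have "\<phi> \<in> {\<psi>. chain_map C X Y \<psi> \<and> homotopic C X Y \<phi> \<psi>}" using f homotopic_refl by blast
  ultimately show "f \<in> cone_in C N"
    using Z f(1) unfolding cone_in_def htpy_arrow_def by auto
qed

lemma cone_in_empty: "cone_in C (K_minus_empty_obj C) = qis_class top"
  by (rule cone_in_eq_qis_class) (rule K_minus_empty_obj_iff)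

lemma cone_in_b: "cone_in C (K_minus_b_obj C) = qis_class at_bot"
  by (rule cone_in_eq_qis_class) (rule K_minus_b_obj_iff)

text \<open>The homotopy fibre \<open>u : U \<rightarrow> X\<close> of \<open>\<gamma> : X \<rightarrow> V\<close>, with the tautological null-homotopy \<open>v\<close> of
  \<open>\<gamma> u\<close>.\<close>

lemma homotopy_fibre:
  assumes X: "is_complex C X" "is_complex C V" and g: "chain_map C X V \<gamma>"
    and K: "X \<in> K_minus_obj C" "V \<in> K_minus_obj C"
  obtains U u v where "is_complex C U" "U \<in> K_minus_obj C" "chain_map C U X u"
    "\<And>n. arr (v n)" "\<And>n. dom (v n) = ob U n" "\<And>n. cod (v n) = ob V (n - 1)"
    "\<And>n. rep (v (n + 1)) * rep (df U n) = - (rep (\<gamma> n) * rep (u n)) - rep (df V (n - 1)) * rep (v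
      n)"
    "\<And>n. exact_at V n \<Longrightarrow> qis_at U X u n"
proof -
  obtain W where W: "is_mapping_cone C X V \<gamma> W" using mapping_cone_exists[OF X g] by blast
  obtain i1 i2 p1 p2 where c: "cone_splitting X V \<gamma> W i1 i2 p1 p2"
    by (rule mapping_coneE[OF W X g])
  note D = cone_splittingD[OF c X g]
  note cW = D(1) and b = D(2) and r = D(3) and p = D(4-7)
  define U where "U = shift W"
  have cU: "is_complex C U" unfolding U_def by (rule is_complex_shift[OF cW])
  have KU: "U \<in> K_minus_obj C"
    unfolding U_def by (rule shift_K_minus[OF cW mapping_cone_K_minus[OF W X g K]])
  note b' = biproductD[OF b[of "n - 1" for n], simplified]
  note [simp] = complexD[OF X(1)] complexD[OF X(2)] complexD[OF cW]
    chain_mapD[OF g X] b' biproductD[OF b]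
  \<comment> \<open>\<open>U^n\<close> is the biproduct of \<open>X^n\<close> and
    \<open>V^(n-1)\<close>, and \<open>u\<close>, \<open>v\<close> are its projections. The
    differential of the shifted cone makes \<open>v\<close> a null-homotopy of
    \<open>\<gamma> u\<close> up to sign.\<close>
  define u v where "u n = p1 (n - 1)" and "v n = p2 (n - 1)" for n
  have obU: "ob U n = ob W (n - 1)" "df U n = Neg C (df W (n - 1))" for n by (simp_all add: U_def)
  have cu: "chain_map C U X u"
    by (rule chain_mapI[OF cU X(1)]) (simp_all add: obU u_def Hom_iff p)
  have v: "arr (v n)" "dom (v n) = ob U n" "cod (v n) = ob V (n - 1)" for n
    by (simp_all add: v_def obU)
  have vd: "rep (v (n + 1)) * rep (df U n) = - (rep (\<gamma> n) * rep (u n)) - rep (df V (n - 1)) * rep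
    (v n)" for n
    by (simp add: v_def u_def obU p)
  have "qis_at U X u n" if ex: "exact_at V n" for n
  proof (rule qis_atI)
    fix A x y assume a: "arr x" "dom x = A" "cod x = ob U (n + 1)" "arr y" "dom y = A"
      "cod y = ob X n" "A \<in> Obj C" "rep (df U (n + 1)) * rep x = 0"
        "rep (u (n + 1)) * rep x = rep (df X n) * rep y"
    have a': "cod x = ob W n" "rep (p1 n) * rep x = rep (df X n) * rep y" "rep (df W n) * rep x = 0"
      using a by (simp_all add: obU u_def)
    have "rep (\<gamma> (n + 1)) * (rep (p1 n) * rep x) + rep (df V n) * (rep (p2 n) * rep x) =
      rep (p2 (n + 1)) * (rep (df W n) * rep x)" by (simp add: p)
    then have 0: "rep (df V n) * (rep (p2 n) * rep x) + rep (df V n) * (rep (\<gamma> n) * rep y) = 0"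
      by (simp add: a'(2,3) add.commute)
    \<comment> \<open>The premises on \<open>x\<close> and \<open>y\<close> say that
      \<open>z\<close> is a cycle of \<open>V\<close>. By exactness it bounds some \<open>b\<close>
      on a cover \<open>e\<close>, and \<open>(y e, - b)\<close> is then the element of
      \<open>U^n\<close> with image \<open>x e\<close>.\<close>
    define z where "z = Plus C (Comp C (p2 n) x) (Comp C (\<gamma> n) y)"
    have z: "z \<in> Hom C A (ob V n)" using a a' by (simp add: z_def Hom_iff)
    have dz: "rep (df V n) * rep z = 0" using 0 a(1-6) a'(1) by (simp add: z_def distrib_left)
    obtain A' e b where e: "epic C e" "dom e = A'" "cod e = A" "arr b" "dom b = A'"
      "cod b = ob V (n - 1)" "rep z * rep e = rep (df V (n - 1)) * rep b"
      by (rule exact_atE[OF ex z dz]) blast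
    have e7: "rep (p2 n) * (rep x * rep e) = rep (df V (n - 1)) * rep b - rep (\<gamma> n) * (rep y *
      rep e)"
      using e(1-7) a(1-6) a'(1) by (simp add: z_def distrib_right mult.assoc eq_diff_eq)
    define x' where "x' = Plus C (Comp C (i1 (n - 1)) (Comp C y e)) (Neg C (Comp C (i2 (n - 1)) b))"
    have x': "arr x'" "dom x' = A'" "cod x' = ob W (n - 1)" using e a by (simp_all add: x'_def)
    have px: "rep (p1 (n - 1)) * rep x' = rep y * rep e" "rep (p2 (n - 1)) * rep x' = - rep b"
      using e a by (simp_all add: x'_def right_diff_distrib)
    have "rep (Comp C x e) = rep (Comp C (Neg C (df W (n - 1))) x')"
    proof (rule biproduct_eqI[OF b[of n]])
      show "rep (p1 n) * rep (Comp C x e) = rep (p1 n) * rep (Comp C (Neg C (df W (n - 1))) x')"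
        using a(1,2) a' e(1-3) x' by (simp add: p px) (simp add: a'(2) flip: mult.assoc)
      show "rep (p2 n) * rep (Comp C x e) = rep (p2 n) * rep (Comp C (Neg C (df W (n - 1))) x')"
        using a(1,2) a'(1) e(1-3) x' by (simp add: p px e7)
    qed (use a a' e x' in simp_all)
    then have "rep x * rep e = rep (df U n) * rep x'" using a a' e x' by (simp add: obU)
    moreover have "rep (u n) * rep x' = rep y * rep e" using px by (simp add: u_def)
    ultimately show "cone_boundary U X u n A x y"
      using e x' by (intro cone_boundaryI[of e A' A x' _ _ "Zero C A' (ob X (n - 1))"]) (auto
        simp: Hom_iff obU)
  qed
  then show thesis using that[OF cU KU cu v vd] by blast
qed

text \<open>Here \<open>U\<close> is the homotopy fibre of \<open>X \<rightarrow> Y \<rightarrow> V\<close>, where \<open>V\<close> is the mapping cone of \<open>\<tau>\<close>.\<close>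

lemma Ore_square:
  assumes X: "is_complex C X" "is_complex C Y" "is_complex C Z" and f: "chain_map C X Y \<phi>"
    and t: "chain_map C Z Y \<tau>"
    and K: "X \<in> K_minus_obj C" "Y \<in> K_minus_obj C" "Z \<in> K_minus_obj C"
  obtains U u h where "is_complex C U" "U \<in> K_minus_obj C" "chain_map C U X u" "chain_map C U Z h"
    "homotopic C U Y (\<lambda>n. Comp C (\<phi> n) (u n)) (\<lambda>n. Comp C (\<tau> n) (h n))"
    "\<And>n. qis_at Z Y \<tau> n \<Longrightarrow> qis_at U X u n"
proof -
  obtain V where V: "is_mapping_cone C Z Y \<tau> V" using mapping_cone_exists[OF X(3,2) t] by blast
  obtain i1 i2 p1 p2 where c: "cone_splitting Z Y \<tau> V i1 i2 p1 p2"
    by (rule mapping_coneE[OF V X(3,2) t])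
  note D = cone_splittingD[OF c X(3,2) t]
  note cV = D(1) and b = D(2) and r = D(3) and p = D(4-7)
  note b' = biproductD[OF b[of "n - 1" for n], simplified]
  note [simp] = complexD[OF X(1)] complexD[OF X(2)] complexD[OF X(3)] complexD[OF cV]
    chain_mapD[OF f X(1,2)] chain_mapD[OF t X(3,2)] b' biproductD[OF b]
  define \<gamma> where "\<gamma> n = Comp C (i2 n) (\<phi> n)" for n
  have cg: "chain_map C X V \<gamma>"
    by (rule chain_mapI[OF X(1) cV]) (simp_all add: \<gamma>_def Hom_iff mult.assoc r left_diff_distrib
      distrib_left distrib_right)
  obtain U u v where U: "is_complex C U" "U \<in> K_minus_obj C" "chain_map C U X u"
    and v: "\<And>n. arr (v n)" "\<And>n. dom (v n) = ob U n" "\<And>n. cod (v n) = ob V (n - 1)"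
    "\<And>n. rep (v (n + 1)) * rep (df U n) = - (rep (\<gamma> n) * rep (u n)) - rep (df V (n - 1)) * rep (v
      n)"
    "\<And>n. exact_at V n \<Longrightarrow> qis_at U X u n"
    by (rule homotopy_fibre[OF X(1) cV cg K(1) mapping_cone_K_minus[OF V X(3,2) t K(3,2)]]) blast
  note [simp] = complexD[OF U(1)] chain_mapD[OF U(3,1) X(1)] v(1-3)
  \<comment> \<open>The null-homotopy \<open>v\<close> of \<open>i2 \<phi> u\<close> takes values in
    the biproduct of \<open>Z^n\<close> and \<open>Y^(n-1)\<close>. Up to sign, its first component
    is the chain map \<open>h\<close> and its second the homotopy between \<open>\<phi> u\<close>
    and \<open>\<tau> h\<close>.\<close>
  define h where "h n = Neg C (Comp C (p1 (n - 1)) (v n))" for n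
  have ch: "chain_map C U Z h"
    by (rule chain_mapI[OF U(1) X(3)]) (simp_all add: h_def Hom_iff mult.assoc v(4)
      right_diff_distrib p \<gamma>_def)
  have "homotopic C U Y (\<lambda>n. Comp C (\<phi> n) (u n)) (\<lambda>n. Comp C (\<tau> n) (h n))"
  proof (rule homotopicI[OF U(1) X(2), where h = "\<lambda>n. Neg C (Comp C (p2 (n - 1)) (v n))"])
    show "rep (Comp C (\<phi> n) (u n)) = rep (Comp C (\<tau> n) (h n)) +
         (rep (df Y (n - 1)) * rep (Neg C (Comp C (p2 (n - 1)) (v n))) +
          rep (Neg C (Comp C (p2 (n + 1 - 1)) (v (n + 1)))) * rep (df U n))" for n
      by (simp add: h_def mult.assoc v(4) right_diff_distrib p \<gamma>_def)
  qed (use chain_map_Hom[OF ch] in \<open>simp_all add: Hom_iff\<close>)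
  then show thesis
    using that[OF U(1-3) ch] v(5) exact_at_cone_iff[OF V X(3,2) t] by blast
qed

text \<open>The null-homotopy of \<open>\<sigma> \<phi>\<close> lifts \<open>\<phi>\<close> to the homotopy fibre \<open>V\<close> of \<open>\<sigma>\<close>, and \<open>U\<close> is the homotopy
  fibre of this lift.\<close>

lemma null_homotopic_cancel:
  assumes X: "is_complex C X" "is_complex C Y" "is_complex C Z" and f: "chain_map C X Y \<phi>"
    and s: "chain_map C Y Z \<sigma>"
    and K: "X \<in> K_minus_obj C" "Y \<in> K_minus_obj C" "Z \<in> K_minus_obj C"
    and sf: "homotopic C X Z (\<lambda>n. Comp C (\<sigma> n) (\<phi> n)) (\<lambda>n. Zero C (ob X n) (ob Z n))"
  obtains U u where "is_complex C U" "U \<in> K_minus_obj C" "chain_map C U X u"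
    "homotopic C U Y (\<lambda>n. Comp C (\<phi> n) (u n)) (\<lambda>n. Zero C (ob U n) (ob Y n))"
    "\<And>n. qis_at Y Z \<sigma> (n - 1) \<Longrightarrow> qis_at U X u n"
proof -
  obtain W where W: "is_mapping_cone C Y Z \<sigma> W" using mapping_cone_exists[OF X(2,3) s] by blast
  obtain i1 i2 p1 p2 where c: "cone_splitting Y Z \<sigma> W i1 i2 p1 p2"
    by (rule mapping_coneE[OF W X(2,3) s])
  note D = cone_splittingD[OF c X(2,3) s]
  note cW = D(1) and b = D(2) and r = D(3) and p = D(4-7)
  note b' = biproductD[OF b[of "n - 1" for n], simplified]
  note [simp] = complexD[OF X(1)] complexD[OF X(2)] complexD[OF X(3)] complexD[OF cW]
    chain_mapD[OF f X(1,2)] chain_mapD[OF s X(2,3)] b' biproductD[OF b]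
  define V where "V = shift W"
  have cV: "is_complex C V" unfolding V_def by (rule is_complex_shift[OF cW])
  have obV: "ob V n = ob W (n - 1)" "df V n = Neg C (df W (n - 1))" for n by (simp_all add: V_def)
  have KV: "V \<in> K_minus_obj C"
    unfolding V_def by (rule shift_K_minus[OF cW mapping_cone_K_minus[OF W X(2,3) s K(2,3)]])
  obtain k where "htpy X Z (\<lambda>n. Comp C (\<sigma> n) (\<phi> n)) (\<lambda>n. Zero C (ob X n) (ob Z n)) k"
    by (rule homotopicE[OF sf X(1,3) chain_map_Zero[OF X(1,3)]])
  note k = htpyD[OF this]
  note [simp] = k(1-3)
  have kd: "rep (k (n + 1)) * rep (df X n) = rep (\<sigma> n) * rep (\<phi> n) - rep (df Z (n - 1)) * rep (k
    n)" for n
    using k(4)[of n] by simp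
  \<comment> \<open>\<open>V^n\<close> is the biproduct of \<open>Y^n\<close> and
    \<open>Z^(n-1)\<close>, and the lift is \<open>(\<phi>, - k)\<close>. The null-homotopy of
    \<open>\<gamma> u\<close> supplied by the fibre projects to one of
    \<open>\<phi> u\<close>.\<close>
  define \<gamma> where "\<gamma> n = Plus C (Comp C (i1 (n - 1)) (\<phi> n)) (Neg C (Comp C (i2 (n - 1)) (k n)))"
    for n
  have [simp]: "arr (\<gamma> n)" "dom (\<gamma> n) = ob X n" "cod (\<gamma> n) = ob W (n - 1)" for n
    by (simp_all add: \<gamma>_def)
  have rg: "rep (\<gamma> n) = rep (i1 (n - 1)) * rep (\<phi> n) - rep (i2 (n - 1)) * rep (k n)" for n
    by (simp add: \<gamma>_def)
  have r': "rep (df W (n - 1)) = rep (i2 n) * (rep (\<sigma> n) * rep (p1 (n - 1)) + rep (df Z (n - 1))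
    * rep (p2 (n - 1))) -
       rep (i1 n) * (rep (df Y n) * rep (p1 (n - 1)))" for n
    using r[of "n - 1"] by simp
  have cg: "chain_map C X V \<gamma>"
    by (rule chain_mapI[OF X(1) cV])
      (simp_all add: obV Hom_iff rg r' kd mult.assoc left_diff_distrib right_diff_distrib
        distrib_left distrib_right)
  obtain U u v where U: "is_complex C U" "U \<in> K_minus_obj C" "chain_map C U X u"
    and v: "\<And>n. arr (v n)" "\<And>n. dom (v n) = ob U n" "\<And>n. cod (v n) = ob V (n - 1)"
    "\<And>n. rep (v (n + 1)) * rep (df U n) = - (rep (\<gamma> n) * rep (u n)) - rep (df V (n - 1)) * rep (v
      n)"
    "\<And>n. exact_at V n \<Longrightarrow> qis_at U X u n"
    by (rule homotopy_fibre[OF X(1) cV cg K(1) KV]) blast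
  have v3: "cod (v n) = ob W (n - 2)" for n using v(3)[of n] by (simp add: obV)
  note [simp] = complexD[OF U(1)] chain_mapD[OF U(3,1) X(1)] v(1,2) v3
  have p12: "arr (p1 (n - 2))" "dom (p1 (n - 2)) = ob W (n - 2)"
    "cod (p1 (n - 2)) = ob Y (n - 1)" for n
    using biproductD(3,7,11)[OF b[of "n - 2"]] by simp_all
  have pd: "rep (p1 (n - 1)) * (rep (df W (n - 2)) * z) = - (rep (df Y (n - 1)) * (rep (p1 (n -
    2)) * z))" for n z
    by (rule p) simp
  have "homotopic C U Y (\<lambda>n. Comp C (\<phi> n) (u n)) (\<lambda>n. Zero C (ob U n) (ob Y n))"
  proof (rule homotopicI[OF U(1) X(2), where h = "\<lambda>n. Neg C (Comp C (p1 (n - 2)) (v n))"])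
    fix n
    have "rep (Neg C (Comp C (p1 (n + 1 - 2)) (v (n + 1)))) = - (rep (p1 (n - 1)) * rep (v (n +
      1)))"
      using p12[of "n + 1"] by simp
    then show "rep (Comp C (\<phi> n) (u n)) = rep (Zero C (ob U n) (ob Y n)) +
         (rep (df Y (n - 1)) * rep (Neg C (Comp C (p1 (n - 2)) (v n))) +
          rep (Neg C (Comp C (p1 (n + 1 - 2)) (v (n + 1)))) * rep (df U n))"
      using p12[of n] biproductD(18,20,22)[OF b[of "n - 1"]]
      by (simp add: mult.assoc v(4) right_diff_distrib left_diff_distrib distrib_left pd rg obV)
  qed (use p12 in \<open>simp_all add: Hom_iff\<close>)
  \<comment> \<open>Exactness of \<open>V\<close>, a shifted cone, in degree \<open>n\<close> is
    exactness of the cone of \<open>\<sigma>\<close> in degree \<open>n - 1\<close>. This is the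
    origin of the loss of one degree.\<close>
  moreover have "qis_at Y Z \<sigma> (n - 1) \<Longrightarrow> qis_at U X u n" for n
    using v(5) exact_at_shift[OF cW] exact_at_cone_iff[OF W X(2,3) s] by (simp add: V_def)
  ultimately show thesis using that[OF U] by blast
qed

end

section \<open>Calculus of right fractions\<close>

text \<open>The cancellation axiom is stated for an arrow with \<open>s f = 0\<close>; applied to a
  difference it becomes the usual statement about \<open>s f = s g\<close> in
  \<open>cancel\<close>.\<close>

locale right_fractions = preadditive_category +
  fixes S
  assumes S_Arr: "s \<in> S \<Longrightarrow> arr s"
    and Ident_S: "A \<in> Obj C \<Longrightarrow> Ident C A \<in> S"
    and Comp_S: "s \<in> S \<Longrightarrow> t \<in> S \<Longrightarrow> dom t = cod s \<Longrightarrow> Comp C t s \<in> S"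
    and Ore: "arr f \<Longrightarrow> t \<in> S \<Longrightarrow> cod f = cod t \<Longrightarrow>
      \<exists>u h. u \<in> S \<and> arr h \<and> dom u = dom h \<and> cod u = dom f \<and> cod h = dom t \<and>
        Comp C f u = Comp C t h"
    and cancel_Zero: "arr f \<Longrightarrow> s \<in> S \<Longrightarrow> cod f = dom s \<Longrightarrow> Comp C s f = Zero C (dom f) (cod s) \<Longrightarrow>
      \<exists>u\<in>S. cod u = dom f \<and> Comp C f u = Zero C (dom u) (cod f)"
begin

lemmas [simp] = S_Arr

lemma CompD:
  assumes "Comp C g f = Comp C g' f'" and "arr f" "arr g" "dom g = cod f"
    and "arr f'" "arr g'" "dom g' = cod f'"
  shows "rep g * rep f = rep g' * rep f'" "rep g * (rep f * z) = rep g' * (rep f' * z)"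
proof -
  show "rep g * rep f = rep g' * rep f'" using assms by (simp flip: rep_Comp)
  then show "rep g * (rep f * z) = rep g' * (rep f' * z)" by (simp flip: mult.assoc)
qed

lemma cancel:
  assumes "arr f" "arr g" "s \<in> S" "cod f = dom s" "cod g = dom s" "dom f = dom g"
    and "rep s * rep f = rep s * rep g"
  obtains u where "u \<in> S" "cod u = dom f" "rep f * rep u = rep g * rep u"
proof -
  define d where "d = Plus C f (Neg C g)"
  have d: "arr d" "dom d = dom f" "cod d = dom s" using assms by (simp_all add: d_def)
  have "Comp C s d = Zero C (dom d) (cod s)"
    using assms d by (intro rep_eqI) (simp_all add: d_def algebra_simps)
  then obtain u where u: "u \<in> S" "cod u = dom d" "Comp C d u = Zero C (dom u) (cod d)"
    using cancel_Zero[of d s] d assms by auto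
  have "rep (Comp C d u) = rep (Zero C (dom u) (cod d))" by (simp only: u(3))
  then have "rep d * rep u = 0" using u(1,2) d assms by simp
  then show thesis using u d assms by (intro that[of u]) (simp_all add: d_def algebra_simps)
qed

text \<open>An Ore square for \<open>a\<close> although only \<open>s a\<close>, and not
  \<open>a\<close> itself, is known to be in \<open>S\<close>. The Ore condition is used for
  \<open>s x\<close> against \<open>s a\<close>, and the common factor \<open>s\<close> is cancelled
  at the price of a further refinement. This fits \<open>roof_eq\<close>, which asks only the
  composite with the denominator to be in \<open>S\<close>.\<close>

lemma lift:
  assumes "s \<in> S" "arr a" "cod a = dom s" "Comp C s a \<in> S" "arr x" "cod x = dom s"
  obtains z w where "z \<in> S" "arr w" "cod z = dom x" "cod w = dom a" "dom z = dom w"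
    "rep x * rep z = rep a * rep w"
proof -
  obtain z w where z: "z \<in> S" "arr w" "dom z = dom w" "cod z = dom x" "cod w = dom a"
    "Comp C (Comp C s x) z = Comp C (Comp C s a) w"
    using Ore[of "Comp C s x" "Comp C s a"] assms by auto
  have "rep s * rep (Comp C x z) = rep s * rep (Comp C a w)"
    using assms z(1-5) CompD(1)[OF z(6)] by (simp add: mult.assoc)
  then obtain u where u: "u \<in> S" "cod u = dom z"
    "rep (Comp C x z) * rep u = rep (Comp C a w) * rep u"
    using cancel[of "Comp C x z" "Comp C a w" s] assms z by auto
  show thesis
    using assms z(1-5) u
    by (intro that[of "Comp C z u" "Comp C w u"]) (auto simp: Comp_S mult.assoc)
qed

section \<open>Roofs and their equivalence\<close>

lemma roofs_iff: "(s, f) \<in> roofs C S X Y \<longleftrightarrow>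
    s \<in> S \<and> arr f \<and> dom s = dom f \<and> cod s = X \<and> cod f = Y"
  by (auto simp: roofs_def)

lemma roof_eqI:
  assumes "(s, f) \<in> roofs C S X Y" "(t, g) \<in> roofs C S X Y"
    and "arr a" "arr b" "dom a = dom b" "cod a = dom s" "cod b = dom t"
    and "Comp C s a \<in> S" "rep s * rep a = rep t * rep b" "rep f * rep a = rep g * rep b"
  shows "roof_eq C S (s, f) (t, g)"
  unfolding roof_eq_def using assms
  by (intro bexI[of _ a] bexI[of _ b]) (auto simp: roofs_iff intro!: rep_eqI)

definition span where
  "span s f t g a b \<longleftrightarrow> arr a \<and> arr b \<and> dom a = dom b \<and> cod a = dom s \<and> cod b = dom t \<and>
     Comp C s a \<in> S \<and> rep s * rep a = rep t * rep b \<and> rep f * rep a = rep g * rep b"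

lemma spanD:
  assumes "span s f t g a b"
  shows "arr a" "arr b" "dom a = dom b" "cod a = dom s" "cod b = dom t" "Comp C s a \<in> S"
    "rep s * rep a = rep t * rep b" "rep f * rep a = rep g * rep b"
    "rep s * (rep a * z) = rep t * (rep b * z)" "rep f * (rep a * z) = rep g * (rep b * z)"
  using assms by (simp_all add: span_def flip: mult.assoc)

lemma roof_eqE:
  assumes "roof_eq C S (s, f) (t, g)" and "(s, f) \<in> roofs C S X Y" "(t, g) \<in> roofs C S X Y"
  obtains a b where "span s f t g a b"
proof -
  obtain a b where a: "arr a" "arr b" "dom a = dom b" "cod a = dom s" "cod b = dom t"
    "Comp C s a = Comp C t b" "Comp C s a \<in> S" "Comp C f a = Comp C g b"
    using assms(1) unfolding roof_eq_def by auto
  then show thesis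
    using that[of a b] assms(2,3) CompD(1)[OF a(6)] CompD(1)[OF a(8)]
      by (auto simp: roofs_iff span_def)
qed

lemma roof_eq_refl:
  assumes "r \<in> roofs C S X Y"
  shows "roof_eq C S r r"
proof -
  obtain s f where r: "r = (s, f)" by (cases r)
  then show ?thesis
    using assms by (auto simp: roofs_iff intro!: roof_eqI[of s f X Y s f "Ident C (dom f)"
      "Ident C (dom f)"])
qed

lemma roof_eq_sym:
  assumes "roof_eq C S r r'"
  shows "roof_eq C S r' r"
  using assms unfolding roof_eq_def by metis

text \<open>The two spans are merged over the middle roof: \<open>lift\<close> refines their legs
  \<open>b\<close> and \<open>c\<close> into the apex of \<open>r2\<close> until they agree, with a
  refinement \<open>z\<close> in \<open>S\<close> that keeps the outer denominator in
  \<open>S\<close>.\<close>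

lemma roof_eq_trans:
  assumes "roof_eq C S r1 r2" "roof_eq C S r2 r3"
    and "r1 \<in> roofs C S X Y" "r2 \<in> roofs C S X Y" "r3 \<in> roofs C S X Y"
  shows "roof_eq C S r1 r3"
proof -
  obtain s1 f1 s2 f2 s3 f3 where r: "r1 = (s1, f1)" "r2 = (s2, f2)" "r3 = (s3, f3)"
    by (cases r1, cases r2, cases r3)
  note R = assms(3-5)[unfolded r, unfolded roofs_iff]
  obtain a b where "span s1 f1 s2 f2 a b"
    by (rule roof_eqE[OF assms(1)[unfolded r] assms(3,4)[unfolded r]])
  note ab = spanD[OF this]
  obtain c e where "span s2 f2 s3 f3 c e"
    by (rule roof_eqE[OF assms(2)[unfolded r] assms(4,5)[unfolded r]])
  note ce = spanD[OF this]
  obtain z w where z: "z \<in> S" "arr w" "cod z = dom b" "cod w = dom c" "dom z = dom w"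
    "rep b * rep z = rep c * rep w"
    using lift[of s2 c b] R ab ce by auto
  have "Comp C s1 (Comp C a z) = Comp C (Comp C s1 a) z"
    using R ab z by (simp add: Comp_assoc')
  also have "\<dots> \<in> S" using R ab z by (intro Comp_S[OF z(1) ab(6)]) auto
  finally have "Comp C s1 (Comp C a z) \<in> S" .
  then show ?thesis
    unfolding r using assms(3,5) R ab(1-8) ce z
    by (intro roof_eqI[of s1 f1 X Y s3 f3 "Comp C a z" "Comp C e w"]) (auto simp: r ab(9,10))
qed

lemma roof_eq_Comp:
  assumes "(s, f) \<in> roofs C S X Y" and "arr a" "cod a = dom s" and "Comp C s a \<in> S"
  shows "roof_eq C S (s, f) (Comp C s a, Comp C f a)"
  using assms by (intro roof_eqI[of s f X Y _ _ a "Ident C (dom a)"]) (auto simp: roofs_iff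
    mult.assoc)

definition frac where "frac X Y s f = (X, Y, roof_class C S X Y (s, f))"

lemma roof_class_eq_iff:
  assumes "r \<in> roofs C S X Y" "r' \<in> roofs C S X Y"
  shows "roof_class C S X Y r = roof_class C S X Y r' \<longleftrightarrow> roof_eq C S r r'"
proof
  assume "roof_class C S X Y r = roof_class C S X Y r'"
  then have "r' \<in> roof_class C S X Y r"
    using assms roof_eq_refl by (auto simp: roof_class_def)
  then show "roof_eq C S r r'" by (simp add: roof_class_def)
next
  assume "roof_eq C S r r'"
  then show "roof_class C S X Y r = roof_class C S X Y r'"
    unfolding roof_class_def using assms roof_eq_trans roof_eq_sym by blast
qed

lemma frac_eq_iff:
  assumes "(s, f) \<in> roofs C S X Y" "(t, g) \<in> roofs C S X Y"
  shows "frac X Y s f = frac X Y t g \<longleftrightarrow> roof_eq C S (s, f) (t, g)"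
  using roof_class_eq_iff[OF assms] by (simp add: frac_def)

section \<open>Arrows of the localization and their operations\<close>

lemma Hom_localization:
  "Hom (localization C S) X Y = {frac X Y s f | s f. X \<in> Obj C \<and> Y \<in> Obj C \<and>
    (s, f) \<in> roofs C S X Y}"
  by (auto simp: Hom_def localization_def frac_def)

lemma Arr_localization:
  "frac X Y s f \<in> Arr (localization C S)" "Dom (localization C S) (frac X Y s f) = X"
  "Cod (localization C S) (frac X Y s f) = Y"
  if "(s, f) \<in> roofs C S X Y"
proof -
  have "X \<in> Obj C" "Y \<in> Obj C" using that by (auto simp: roofs_iff)
  then show "frac X Y s f \<in> Arr (localization C S)" "Dom (localization C S) (frac X Y s f) = X"
    "Cod (localization C S) (frac X Y s f) = Y"
    using that by (auto simp: localization_def frac_def)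
qed

text \<open>The definition adds representatives with equal denominators. Two equivalences from
  denominator \<open>s\<close> to denominator \<open>t\<close>, one per summand, come with different
  spans; \<open>lift\<close> makes them agree on the side of \<open>s\<close>, and cancelling
  \<open>t\<close> makes them agree on the side of \<open>t\<close> as well. The merged span then
  serves the sum of the numerators.\<close>

lemma Plus_frac:
  assumes sf: "(s, f) \<in> roofs C S X Y" and sg: "(s, g) \<in> roofs C S X Y"
  shows "Plus (localization C S) (frac X Y s f) (frac X Y s g) = frac X Y s (Plus C f g)"
proof -
  note R = assms[unfolded roofs_iff]
  have r: "(s, Plus C f g) \<in> roofs C S X Y" using R by (simp add: roofs_iff)
  have "(\<exists>t f' g'. (t, f') \<in> roof_class C S X Y (s, f) \<and> (t, g') \<in> roof_class C S X Y (s, g) \<and>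
      roof_eq C S (t, Plus C f' g') q) \<longleftrightarrow> roof_eq C S (s, Plus C f g) q" (is "?L q \<longleftrightarrow> _")
    if q: "q \<in> roofs C S X Y" for q
  proof
    assume "roof_eq C S (s, Plus C f g) q"
    then show "?L q"
      using assms roof_eq_refl[OF sf] roof_eq_refl[OF sg] unfolding roof_class_def by blast
  next
    assume "?L q"
    then obtain t f' g' where t: "(t, f') \<in> roofs C S X Y" "(t, g') \<in> roofs C S X Y"
      "roof_eq C S (s, f) (t, f')" "roof_eq C S (s, g) (t, g')" "roof_eq C S (t, Plus C f' g') q"
      by (auto simp: roof_class_def)
    note T = t(1,2)[unfolded roofs_iff]
    obtain a b where "span s f t f' a b"
      by (rule roof_eqE[OF t(3) sf t(1)])
    note ab = spanD[OF this]
    obtain c e where "span s g t g' c e"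
      by (rule roof_eqE[OF t(4) sg t(2)])
    note ce = spanD[OF this]
    obtain z w where z: "z \<in> S" "arr w" "cod z = dom a" "cod w = dom c" "dom z = dom w"
      "rep a * rep z = rep c * rep w"
      using lift[of s c a] R ab ce by auto
    have "rep t * (rep b * rep z) = rep t * (rep e * rep w)"
      using ab(9)[of "rep z"] ce(9)[of "rep w"] z(6) by simp
    then have "rep t * rep (Comp C b z) = rep t * rep (Comp C e w)" using ab ce z by simp
    then obtain y where y: "y \<in> S" "cod y = dom z"
      "rep (Comp C b z) * rep y = rep (Comp C e w) * rep y"
      using cancel[of "Comp C b z" "Comp C e w" t] T ab ce z by auto
    have y': "rep b * (rep z * rep y) = rep e * (rep w * rep y)" using y ab ce z
      by (simp add: mult.assoc)
    have z': "rep a * (rep z * rep y) = rep c * (rep w * rep y)"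
      using arg_cong[OF z(6), of "\<lambda>r. r * rep y"] by (simp add: mult.assoc)
    have "Comp C s (Comp C a (Comp C z y)) = Comp C (Comp C s a) (Comp C z y)"
      using R ab z y by (simp add: Comp_assoc')
    also have "\<dots> \<in> S" using R ab z y by (intro Comp_S[OF Comp_S[OF y(1) z(1)] ab(6)]) auto
    finally have inS: "Comp C s (Comp C a (Comp C z y)) \<in> S" .
    have "rep f * (rep a * (rep z * rep y)) = rep f' * (rep b * (rep z * rep y))" by (rule ab(10))
    moreover have "rep g * (rep a * (rep z * rep y)) = rep g' * (rep b * (rep z * rep y))"
      unfolding z' y' by (rule ce(10))
    ultimately have "roof_eq C S (s, Plus C f g) (t, Plus C f' g')"
      using inS R T ab(1-5) z(1-5) y(1,2) r
      by (intro roof_eqI[of _ _ X Y _ _ "Comp C a (Comp C z y)" "Comp C b (Comp C z y)"])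
        (auto simp: roofs_iff ab(9) distrib_right)
    then show "roof_eq C S (s, Plus C f g) q"
      using roof_eq_trans[OF _ t(5) r _ q] T by (auto simp: roofs_iff)
  qed
  then have "{q \<in> roofs C S X Y. ?L q} = roof_class C S X Y (s, Plus C f g)"
    unfolding roof_class_def[of C S X Y "(s, Plus C f g)"] by blast
  then show ?thesis by (simp add: localization_def loc_plus_def frac_def)
qed

lemma common_denominator:
  assumes sf: "(s, f) \<in> roofs C S X Y" and tg: "(t, g) \<in> roofs C S X Y"
  obtains r f' g' where "(r, f') \<in> roofs C S X Y" "(r, g') \<in> roofs C S X Y"
    "frac X Y s f = frac X Y r f'" "frac X Y t g = frac X Y r g'"
proof -
  note R = assms[unfolded roofs_iff]
  obtain u v where u: "u \<in> S" "arr v" "dom u = dom v" "cod u = dom s" "cod v = dom t"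
    "Comp C s u = Comp C t v"
    using Ore[of s t] R by auto
  have su: "Comp C s u \<in> S" using u R by (intro Comp_S) auto
  have "(Comp C s u, Comp C f u) \<in> roofs C S X Y" "(Comp C s u, Comp C g v) \<in> roofs C S X Y"
    using R u(1-5) su by (simp_all add: roofs_iff)
  then have a: "(Comp C s u, Comp C f u) \<in> roofs C S X Y" "(Comp C t v, Comp C g v) \<in> roofs C S X Y"
    by (simp_all add: u(6))
  show thesis
  proof (rule that)
    show "(Comp C s u, Comp C f u) \<in> roofs C S X Y" "(Comp C s u, Comp C g v) \<in> roofs C S X Y"
      using a unfolding u(6) by auto
    show "frac X Y s f = frac X Y (Comp C s u) (Comp C f u)"
      using frac_eq_iff[OF sf a(1)] roof_eq_Comp[OF sf _ _ su] u by simp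
    show "frac X Y t g = frac X Y (Comp C s u) (Comp C g v)"
      using frac_eq_iff[OF tg a(2)] roof_eq_Comp[OF tg u(2) u(5)] su unfolding u(6) by simp
  qed
qed

text \<open>Independence of the representatives and of the Ore squares. Refinements accumulate:
  \<open>p, q\<close> and \<open>p', r\<close> move the two squares onto the span between
  \<open>s\<close> and \<open>s'\<close>; \<open>y, w\<close> move the result onto the span between
  \<open>t\<close> and \<open>t'\<close>; finally \<open>z\<close> cancels \<open>t'\<close>. The
  total refinements are \<open>k\<close> and \<open>k'\<close>.\<close>

lemma roof_Comp_wd:
  assumes sf: "(s, f) \<in> roofs C S X Y" "(s', f') \<in> roofs C S X Y" "roof_eq C S (s, f) (s', f')"
    and tg: "(t, g) \<in> roofs C S Y Z" "(t', g') \<in> roofs C S Y Z" "roof_eq C S (t, g) (t', g')"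
    and u: "u \<in> S" "arr h" "dom u = dom h" "cod u = dom s" "cod h = dom t"
      "Comp C f u = Comp C t h"
    and u': "u' \<in> S" "arr h'" "dom u' = dom h'" "cod u' = dom s'" "cod h' = dom t'"
      "Comp C f' u' = Comp C t' h'"
  shows "roof_eq C S (Comp C s u, Comp C g h) (Comp C s' u', Comp C g' h')"
proof -
  note R = sf(1,2)[unfolded roofs_iff] tg(1,2)[unfolded roofs_iff]
  have fu: "rep f * (rep u * z) = rep t * (rep h * z)" for z using R u by (intro CompD) auto
  have fu': "rep f' * (rep u' * z) = rep t' * (rep h' * z)" for z using R u' by (intro CompD) auto
  obtain a b where "span s f s' f' a b"
    by (rule roof_eqE[OF sf(3,1,2)])
  note ab = spanD[OF this]
  obtain c e where "span t g t' g' c e"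
    by (rule roof_eqE[OF tg(3,1,2)])
  note ce = spanD[OF this]
  obtain p q where p: "p \<in> S" "arr q" "cod p = dom u" "cod q = dom a" "dom p = dom q"
    "rep u * rep p = rep a * rep q"
    using lift[of s a u] R u ab by auto
  have p6: "rep u * (rep p * z) = rep a * (rep q * z)" for z using p(6) by (simp flip: mult.assoc)
  have "Comp C s' (Comp C b q) = Comp C s (Comp C u p)"
    using R u p(1-5) ab(1-5) p6 by (intro rep_eqI) (simp_all add: p(6) ab(9))
  also have "\<dots> \<in> S" using R u p by (intro Comp_S) auto
  finally have bq: "Comp C s' (Comp C b q) \<in> S" .
  obtain p' r where p': "p' \<in> S" "arr r" "cod p' = dom u'" "cod r = dom q" "dom p' = dom r"
    "rep u' * rep p' = rep (Comp C b q) * rep r"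
    using lift[of s' "Comp C b q" u'] R u' ab bq p by auto
  have p6': "rep u' * (rep p' * z) = rep b * (rep q * (rep r * z))" for z
    using arg_cong[OF p'(6), of "\<lambda>y. y * z"] ab p by (simp add: mult.assoc)
  define x where "x = Comp C h (Comp C p r)"
  have x: "arr x" "dom x = dom r" "cod x = dom t" using u p p' by (simp_all add: x_def)
  have tx: "rep t * (rep x * z) = rep t' * (rep h' * (rep p' * z))" for z
  proof -
    have "rep t * (rep x * z) = rep f * (rep u * (rep p * (rep r * z)))"
      using u p p' by (simp add: x_def mult.assoc fu)
    also have "\<dots> = rep f' * (rep u' * (rep p' * z))" by (simp add: p6 p6' ab(10))
    finally show ?thesis by (simp add: fu')
  qed
  obtain y w where y: "y \<in> S" "arr w" "cod y = dom x" "cod w = dom c" "dom y = dom w"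
    "rep x * rep y = rep c * rep w"
    using lift[of t c x] R x ce by auto
  have "rep t' * (rep h' * (rep p' * rep y)) = rep t' * (rep e * rep w)"
    using tx[of "rep y"] y(6) ce(9)[of "rep w"] by simp
  then have "rep t' * rep (Comp C h' (Comp C p' y)) = rep t' * rep (Comp C e w)"
    using u' p' y ce x by simp
  then obtain z where z: "z \<in> S" "cod z = dom y"
    "rep (Comp C h' (Comp C p' y)) * rep z = rep (Comp C e w) * rep z"
    using cancel[of "Comp C h' (Comp C p' y)" "Comp C e w" t'] R u' p' y ce x by auto
  define k k' where "k = Comp C p (Comp C r (Comp C y z))" and "k' = Comp C p' (Comp C y z)"
  have k: "arr k" "k' \<in> S" "dom k = dom k'" "cod k = dom u" "cod k' = dom u'"
    using p p' y z x by (auto simp: k_def k'_def intro!: Comp_S)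
  have 1: "rep s * (rep u * rep k) = rep s' * (rep u' * rep k')"
    using p p' y z x by (simp add: k_def k'_def p6 p6' ab(9))
  have 2: "rep g * (rep h * rep k) = rep g' * (rep h' * rep k')"
  proof -
    have "rep g * (rep h * rep k) = rep g * (rep x * rep y * rep z)"
      using u(1-5) p(1-5) p'(1-5) y(1-5) z(1,2) x(2) by (simp add: k_def x_def mult.assoc)
    also have "\<dots> = rep g' * (rep e * (rep w * rep z))" unfolding y(6)
      by (simp add: mult.assoc ce(10))
    also have "\<dots> = rep g' * (rep (Comp C h' (Comp C p' y)) * rep z)" unfolding z(3)
      using ce(1-5) y(1-5) by (simp add: mult.assoc)
    also have "\<dots> = rep g' * (rep h' * rep k')" using u'(1-5) p'(1-5) y(1-5) z(1,2) x
      by (simp add: k'_def mult.assoc)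
    finally show ?thesis .
  qed
  have "Comp C (Comp C s u) k = Comp C (Comp C s' u') k'"
    using R u u' k 1 by (intro rep_eqI) (simp_all add: mult.assoc)
  also have "\<dots> \<in> S" using R u' k by (intro Comp_S) auto
  finally show ?thesis
    using R u u' k 1 2
    by (intro roof_eqI[of _ _ X Z _ _ k k']) (auto simp: roofs_iff mult.assoc intro!: Comp_S)
qed

lemma Comp_frac:
  assumes sf: "(s, f) \<in> roofs C S X Y" and tg: "(t, g) \<in> roofs C S Y Z"
    and u: "u \<in> S" "arr h" "dom u = dom h" "cod u = dom s" "cod h = dom t"
      "Comp C f u = Comp C t h"
  shows "Comp (localization C S) (frac Y Z t g) (frac X Y s f) = frac X Z (Comp C s u) (Comp C g h)"
proof -
  note R = sf[unfolded roofs_iff] tg[unfolded roofs_iff]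
  have r: "(Comp C s u, Comp C g h) \<in> roofs C S X Z"
    using R u(1-5) by (auto simp: roofs_iff intro!: Comp_S)
  have "(\<exists>(s', f')\<in>roof_class C S X Y (s, f). \<exists>(t', g')\<in>roof_class C S Y Z (t, g). \<exists>u\<in>S \<inter> Arr C.
    \<exists>h\<in>Arr C.
       dom u = dom h \<and> cod u = dom s' \<and> cod h = dom t' \<and>
       Comp C f' u = Comp C t' h \<and> roof_eq C S (Comp C s' u, Comp C g' h) q) \<longleftrightarrow>
    roof_eq C S (Comp C s u, Comp C g h) q" (is "?L q \<longleftrightarrow> ?R q")
    if q: "q \<in> roofs C S X Z" for q
  proof
    assume "?R q"
    moreover have "(s, f) \<in> roof_class C S X Y (s, f)" "(t, g) \<in> roof_class C S Y Z (t, g)"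
      using sf tg roof_eq_refl by (auto simp: roof_class_def)
    moreover have "u \<in> S \<inter> Arr C" using u by simp
    ultimately show "?L q" using u by blast
  next
    assume "?L q"
    then obtain s' f' t' g' u' h' where a: "(s', f') \<in> roofs C S X Y" "roof_eq C S (s, f) (s', f')"
      "(t', g') \<in> roofs C S Y Z" "roof_eq C S (t, g) (t', g')"
      "u' \<in> S" "arr h'" "dom u' = dom h'" "cod u' = dom s'" "cod h' = dom t'"
      "Comp C f' u' = Comp C t' h'" "roof_eq C S (Comp C s' u', Comp C g' h') q"
      by (auto simp: roof_class_def)
    have "(Comp C s' u', Comp C g' h') \<in> roofs C S X Z"
      using a(1,3,5-9) by (auto simp: roofs_iff intro!: Comp_S)
    then show "?R q"
      using roof_eq_trans[OF roof_Comp_wd[OF sf a(1,2) tg a(3,4) u a(5-10)] a(11) r _ q] by blast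
  qed
  then have "{q \<in> roofs C S X Z. ?L q} = roof_class C S X Z (Comp C s u, Comp C g h)"
    unfolding roof_class_def[of C S X Z "(Comp C s u, Comp C g h)"] by blast
  then show ?thesis by (simp add: localization_def loc_comp_def frac_def)
qed

lemma loc_arrow_eq_frac: "loc_arrow C S f = frac (dom f) (cod f) (Ident C (dom f)) f"
  by (simp add: loc_arrow_def frac_def)

lemma roof_Ident: "arr f \<Longrightarrow> (Ident C (dom f), f) \<in> roofs C S (dom f) (cod f)"
  by (simp add: roofs_iff Ident_S)

lemma Ident_localization: "Ident (localization C S) A = frac A A (Ident C A) (Ident C A)"
  by (simp add: localization_def frac_def)

lemma loc_arrow_Comp_frac:
  assumes sf: "(s, f) \<in> roofs C S X (dom g)" and g: "arr g"
  shows "Comp (localization C S) (loc_arrow C S g) (frac X (dom g) s f) = frac X (cod g) s (Comp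
    C g f)"
proof -
  note R = sf[unfolded roofs_iff]
  show ?thesis
    unfolding loc_arrow_eq_frac
    by (subst Comp_frac[OF sf roof_Ident[OF g], where u = "Ident C (dom s)" and h = f])
      (use R g in \<open>auto simp: Ident_S\<close>)
qed

text \<open>\<open>inv_arr\<close> is a definite description, so uniqueness is checked on roofs. If
  \<open>(s, f)\<close> represents an inverse, a span that witnesses the equivalence of
  \<open>(s, t f)\<close> with the identity roof has a leg \<open>a\<close> with
  \<open>s a = t f a\<close>, and the legs \<open>a\<close> and \<open>f a\<close> identify
  \<open>(s, f)\<close> with \<open>(t, 1)\<close>.\<close>

lemma inv_loc_arrow:
  assumes t: "t \<in> S"
  shows "inv_arr (localization C S) (loc_arrow C S t) = frac (cod t) (dom t) t (Ident C (dom t))"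
  unfolding inv_arr_def
proof (rule the_equality)
  let ?L = "localization C S" and ?g = "frac (cod t) (dom t) t (Ident C (dom t))"
  have rt: "(t, Ident C (dom t)) \<in> roofs C S (cod t) (dom t)" using t by (simp add: roofs_iff)
  have ri: "(Ident C (dom t), t) \<in> roofs C S (dom t) (cod t)" using t by (simp add: roof_Ident)
  have rI: "(Ident C A, Ident C A) \<in> roofs C S A A" if "A \<in> Obj C" for A
    using that roof_Ident[of "Ident C A"] by simp
  have tt: "(t, t) \<in> roofs C S (cod t) (cod t)" using t by (simp add: roofs_iff)
  have "Comp ?L ?g (loc_arrow C S t) = frac (dom t) (dom t) (Ident C (dom t)) (Ident C (dom t))"
    unfolding loc_arrow_eq_frac
    by (subst Comp_frac[OF ri rt, where u = "Ident C (dom t)" and h = "Ident C (dom t)"])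
      (use t in \<open>auto simp: Ident_S\<close>)
  moreover have "Comp ?L (loc_arrow C S t) ?g = frac (cod t) (cod t) (Ident C (cod t)) (Ident C
    (cod t))"
  proof -
    have "Comp ?L (loc_arrow C S t) ?g = frac (cod t) (cod t) t t"
      using loc_arrow_Comp_frac[OF rt] t by simp
    also have "\<dots> = frac (cod t) (cod t) (Ident C (cod t)) (Ident C (cod t))"
      using t frac_eq_iff[OF rI tt, THEN iffD2, OF _ roof_eq_Comp[OF rI, of "cod t" t,
        simplified]] by simp
    finally show ?thesis .
  qed
  ultimately show "inverse_pair ?L (loc_arrow C S t) ?g"
    unfolding inverse_pair_def loc_arrow_eq_frac Ident_localization
    using Arr_localization[OF ri] Arr_localization[OF rt] by simp
  fix g assume "inverse_pair ?L (loc_arrow C S t) g"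
  then have g: "g \<in> Hom ?L (cod t) (dom t)"
    and c: "Comp ?L (loc_arrow C S t) g = frac (cod t) (cod t) (Ident C (cod t)) (Ident C (cod t))"
    unfolding inverse_pair_def loc_arrow_eq_frac Ident_localization
    using Arr_localization[OF ri] by (auto simp: Hom_def)
  obtain s f where sf: "g = frac (cod t) (dom t) s f" "(s, f) \<in> roofs C S (cod t) (dom t)"
    using g unfolding Hom_localization by blast
  note R = sf(2)[unfolded roofs_iff]
  have r1: "(s, Comp C t f) \<in> roofs C S (cod t) (cod t)" using R t by (simp add: roofs_iff)
  have rC: "(Ident C (cod t), Ident C (cod t)) \<in> roofs C S (cod t) (cod t)" using t
    by (intro rI) simp
  have e: "roof_eq C S (s, Comp C t f) (Ident C (cod t), Ident C (cod t))"
    using c loc_arrow_Comp_frac[OF sf(2)] t frac_eq_iff[OF r1 rC] sf(1) by simp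
  obtain a b where "span s (Comp C t f) (Ident C (cod t)) (Ident C (cod t)) a b"
    by (rule roof_eqE[OF e r1 rC])
  note ab = spanD(1-8)[OF this]
  have "roof_eq C S (s, f) (t, Ident C (dom t))"
    using ab R t by (intro roof_eqI[OF sf(2) rt, of a "Comp C f a"]) (simp_all add: mult.assoc)
  then show "g = ?g" using frac_eq_iff[OF sf(2) rt] sf(1) by simp
qed

text \<open>The shape of a component of the natural map: conjugation by denominators and inclusions
  amounts to composing both legs of the roof, with no Ore square left to choose.\<close>

lemma conjugate_frac:
  assumes sf: "(s, f) \<in> roofs C S A B" and i: "i \<in> S" "dom i = A" and j: "arr j" "dom j = B"
  shows "Comp (localization C S) (loc_arrow C S j) (Comp (localization C S) (frac A B s f)
    (inv_arr (localization C S) (loc_arrow C S i))) = frac (cod i) (cod j) (Comp C i s) (Comp C j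
      f)"
proof -
  note R = sf[unfolded roofs_iff]
  have rt: "(i, Ident C A) \<in> roofs C S (cod i) A" using i by (auto simp: roofs_iff)
  have r1: "(Comp C i s, f) \<in> roofs C S (cod i) (dom j)"
    using R i j by (auto simp: roofs_iff intro!: Comp_S)
  have "Comp (localization C S) (frac A B s f) (inv_arr (localization C S) (loc_arrow C S i)) =
    frac (cod i) (dom j) (Comp C i s) f"
    unfolding inv_loc_arrow[OF i(1)] i(2)
    by (subst Comp_frac[OF rt sf, where u = s and h = "Ident C (dom s)"]) (use R i j in auto)
  then show ?thesis using loc_arrow_Comp_frac[OF r1 j(1)] by simp
qed

text \<open>Serves both functors between quotients: the canonical functor \<open>G\<close>, where
  the identity leads to a larger class \<open>S\<close>, and the derived truncation, where both
  classes are the same.\<close>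

lemma loc_functor_frac:
  assumes S0: "right_fractions C S0"
    and F: "\<And>f. arr f \<Longrightarrow> on_arr F f \<in> Hom C (on_obj F (dom f)) (on_obj F (cod f))"
    and F_Comp: "\<And>f g. arr f \<Longrightarrow> arr g \<Longrightarrow> dom g = cod f \<Longrightarrow>
      on_arr F (Comp C g f) = Comp C (on_arr F g) (on_arr F f)"
    and F_S: "\<And>s. s \<in> S0 \<Longrightarrow> on_arr F s \<in> S"
    and sf: "(s, f) \<in> roofs C S0 X Y"
  shows "on_arr (loc_functor F C S) (right_fractions.frac C S0 X Y s f) =
    frac (on_obj F X) (on_obj F Y) (on_arr F s) (on_arr F f)"
proof -
  interpret S0: right_fractions C S0 by fact
  have FR: "(on_arr F s, on_arr F f) \<in> roofs C S (on_obj F X) (on_obj F Y)"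
    if "(s, f) \<in> roofs C S0 X Y" for s f
    using that F[of s] F[of f] F_S by (auto simp: S0.roofs_iff roofs_iff Hom_iff)
  have eq: "roof_eq C S (on_arr F s, on_arr F f) (on_arr F t, on_arr F g)"
    if e: "roof_eq C S0 (s, f) (t, g)" and r: "(s, f) \<in> roofs C S0 X Y"
      "(t, g) \<in> roofs C S0 X Y" for s f t g
  proof -
    obtain a b where ab: "arr a" "arr b" "dom a = dom b" "cod a = dom s" "cod b = dom t"
      "Comp C s a = Comp C t b" "Comp C s a \<in> S0" "Comp C f a = Comp C g b"
      using e unfolding roof_eq_def by auto
    have "on_arr F (Comp C s a) = Comp C (on_arr F s) (on_arr F a)"
      "on_arr F (Comp C t b) = Comp C (on_arr F t) (on_arr F b)"
      "on_arr F (Comp C f a) = Comp C (on_arr F f) (on_arr F a)"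
      "on_arr F (Comp C g b) = Comp C (on_arr F g) (on_arr F b)"
      by (rule F_Comp; use ab(1-5) r in \<open>simp add: S0.roofs_iff\<close>)+
    then have "Comp C (on_arr F s) (on_arr F a) \<in> S"
      "Comp C (on_arr F s) (on_arr F a) = Comp C (on_arr F t) (on_arr F b)"
      "Comp C (on_arr F f) (on_arr F a) = Comp C (on_arr F g) (on_arr F b)"
      using F_S[OF ab(7)] ab(6,8) by auto
    then show ?thesis
      unfolding roof_eq_def using F[OF ab(1)] F[OF ab(2)] F[of s] F[of t] ab r
      by (intro bexI[of _ "on_arr F a"] bexI[of _ "on_arr F b"]) (auto simp: S0.roofs_iff Hom_iff)
  qed
  have "(\<exists>(s', f')\<in>roof_class C S0 X Y (s, f). roof_eq C S (on_arr F s', on_arr F f') q) \<longleftrightarrow>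
    roof_eq C S (on_arr F s, on_arr F f) q" (is "?L q \<longleftrightarrow> ?R q")
    if q: "q \<in> roofs C S (on_obj F X) (on_obj F Y)" for q
  proof
    assume "?R q"
    moreover have "(s, f) \<in> roof_class C S0 X Y (s, f)" using sf S0.roof_eq_refl
      by (auto simp: roof_class_def)
    ultimately show "?L q" by blast
  next
    assume "?L q"
    then obtain s' f' where a: "(s', f') \<in> roofs C S0 X Y" "roof_eq C S0 (s, f) (s', f')"
      "roof_eq C S (on_arr F s', on_arr F f') q"
      by (auto simp: roof_class_def)
    then show "?R q" using roof_eq_trans[OF eq[OF a(2) sf a(1)] a(3) FR[OF sf] FR[OF a(1)] q]
      by blast
  qed
  then have "{q \<in> roofs C S (on_obj F X) (on_obj F Y). ?L q} =
      roof_class C S (on_obj F X) (on_obj F Y) (on_arr F s, on_arr F f)"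
    unfolding roof_class_def[of C S "on_obj F X"] by blast
  then show ?thesis by (simp add: loc_functor_def frac_def S0.frac_def)
qed

end

section \<open>Colimits\<close>

text \<open>Compatibility with the transitions and eventual injectivity make the colimit relation
  coincide with equality of values of \<open>c\<close>. The classes are thus the fibres
  \<open>cls z\<close> of the components, and by surjectivity every element of \<open>H\<close> has
  a nonempty one.\<close>

lemma colim_group_iso:
  fixes A :: "int \<Rightarrow> 'a monoid" and t :: "int \<Rightarrow> 'a \<Rightarrow> 'a" and c :: "int \<Rightarrow> 'a \<Rightarrow> 'b"
    and H :: "'b monoid"
  assumes A: "\<And>n x y. x \<in> carrier (A n) \<Longrightarrow> y \<in> carrier (A n) \<Longrightarrow> x \<otimes>\<^bsub>A n\<^esub> y \<in> carrier (A n)"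
    and t: "\<And>n x. x \<in> carrier (A n) \<Longrightarrow> t n x \<in> carrier (A (n - 1))"
    and t_mult: "\<And>n x y. x \<in> carrier (A n) \<Longrightarrow> y \<in> carrier (A n) \<Longrightarrow>
      t n (x \<otimes>\<^bsub>A n\<^esub> y) = t n x \<otimes>\<^bsub>A (n - 1)\<^esub> t n y"
    and c: "\<And>n x. x \<in> carrier (A n) \<Longrightarrow> c n x \<in> carrier H"
    and c_mult: "\<And>n x y. x \<in> carrier (A n) \<Longrightarrow> y \<in> carrier (A n) \<Longrightarrow>
      c n (x \<otimes>\<^bsub>A n\<^esub> y) = c n x \<otimes>\<^bsub>H\<^esub> c n y"
    and c_t: "\<And>n x. x \<in> carrier (A n) \<Longrightarrow> c (n - 1) (t n x) = c n x"
    and inj: "\<And>n x y. x \<in> carrier (A n) \<Longrightarrow> y \<in> carrier (A n) \<Longrightarrow> c n x = c n y \<Longrightarrow>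
      \<exists>k. steps t n k x = steps t n k y"
    and surj: "\<And>z. z \<in> carrier H \<Longrightarrow> \<exists>n. \<exists>x\<in>carrier (A n). c n x = z"
  shows "(\<lambda>P. the_elem ((\<lambda>(n, f). c n f) ` P)) \<in> iso (colim_group A t) H"
proof -
  have st: "steps t n k x \<in> carrier (A (n - int k)) \<and> c (n - int k) (steps t n k x) = c n x"
    if "x \<in> carrier (A n)" for n k x
  proof (induction k)
    case (Suc k)
    have e: "n - int (Suc k) = n - int k - 1" by simp
    show ?case unfolding e steps.simps
      using Suc t[of "steps t n k x" "n - int k"] c_t[of "steps t n k x" "n - int k"] by simp
  qed (use that in simp)
  have st_add: "steps t n (k + l) x = steps t (n - int k) l (steps t n k x)" for n k l x
    by (induction l) (simp_all add: algebra_simps)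
  have rel: "((n, x), (m, y)) \<in> colim_rel A t \<longleftrightarrow>
    x \<in> carrier (A n) \<and> y \<in> carrier (A m) \<and> c n x = c m y" for n x m y
  proof
    assume "((n, x), (m, y)) \<in> colim_rel A t"
    then obtain k l where "x \<in> carrier (A n)" "y \<in> carrier (A m)" "n - int k = m - int l"
      "steps t n k x = steps t m l y" by (auto simp: colim_rel_def)
    then show "x \<in> carrier (A n) \<and> y \<in> carrier (A m) \<and> c n x = c m y"
      using st[of x n k] st[of y m l] by metis
  next
    assume a: "x \<in> carrier (A n) \<and> y \<in> carrier (A m) \<and> c n x = c m y"
    \<comment> \<open>The hypothesis \<open>inj\<close> compares elements of one and the same group,
      so both are first moved to the lower of the two indices.\<close>
    define p where "p = min n m"
    define k l where "k = nat (n - p)" and "l = nat (m - p)"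
    have kl: "n - int k = p" "m - int l = p" by (simp_all add: k_def l_def p_def)
    have "steps t n k x \<in> carrier (A p)" "steps t m l y \<in> carrier (A p)"
      "c p (steps t n k x) = c p (steps t m l y)"
      using a st[of x n k] st[of y m l] kl by auto
    then obtain j where "steps t p j (steps t n k x) = steps t p j (steps t m l y)" using inj
      by blast
    then have "steps t n (k + j) x = steps t m (l + j) y" by (simp add: st_add kl)
    moreover have "n - int (k + j) = m - int (l + j)" using kl by simp
    ultimately show "((n, x), (m, y)) \<in> colim_rel A t" using a unfolding colim_rel_def by blast
  qed
  define cls where "cls z = {(n, x). x \<in> carrier (A n) \<and> c n x = z}" for z
  have carrier: "carrier (colim_group A t) = cls ` carrier H"
  proof -
    have "colim_rel A t `` {(n, x)} = cls (c n x)" if "x \<in> carrier (A n)" for n x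
      using that by (auto simp: rel cls_def)
    then show ?thesis
      using c surj by (fastforce simp: colim_group_def quotient_def image_iff)
  qed
  have common: "\<exists>p. \<exists>x\<in>carrier (A p). \<exists>y\<in>carrier (A p). c p x = z \<and> c p y = w"
    if zw: "z \<in> carrier H" "w \<in> carrier H" for z w
  proof -
    obtain n x m y where xy: "x \<in> carrier (A n)" "c n x = z" "y \<in> carrier (A m)" "c m y = w"
      using surj zw by metis
    define p where "p = min n m"
    have "n - int (nat (n - p)) = p" "m - int (nat (m - p)) = p" by (simp_all add: p_def)
    then show ?thesis
      using st[OF xy(1), of "nat (n - p)"] st[OF xy(3), of "nat (m - p)"] xy by metis
  qed
  have mult: "cls z \<otimes>\<^bsub>colim_group A t\<^esub> cls w = cls (z \<otimes>\<^bsub>H\<^esub> w)"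
    if zw: "z \<in> carrier H" "w \<in> carrier H" for z w
  proof -
    obtain p x' y' where xy': "x' \<in> carrier (A p)" "c p x' = z" "y' \<in> carrier (A p)" "c p y' = w"
      using common[OF zw] by blast
    have "(\<exists>n x y. (n, x) \<in> cls z \<and> (n, y) \<in> cls w \<and> ((n, x \<otimes>\<^bsub>A n\<^esub> y), r) \<in> colim_rel A t) \<longleftrightarrow>
      r \<in> cls (z \<otimes>\<^bsub>H\<^esub> w)" (is "?L r \<longleftrightarrow> _") for r
    proof -
      obtain l q where r: "r = (l, q)" by (cases r)
      show ?thesis
        unfolding r
      proof
        assume "(l, q) \<in> cls (z \<otimes>\<^bsub>H\<^esub> w)"
        then show "?L (l, q)"
          using xy' A c_mult[OF xy'(1,3)]
          by (intro exI[of _ p] exI[of _ x'] exI[of _ y']) (auto simp: cls_def rel)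
      qed (auto simp: cls_def rel c_mult)
    qed
    then have "{r. ?L r} = cls (z \<otimes>\<^bsub>H\<^esub> w)" by blast
    then show ?thesis by (simp add: colim_group_def)
  qed
  have val: "the_elem ((\<lambda>(n, f). c n f) ` cls z) = z" if "z \<in> carrier H" for z
  proof -
    have "(\<lambda>(n, f). c n f) ` cls z = {z}" using surj[OF that] by (force simp: cls_def image_iff)
    then show ?thesis by simp
  qed
  show ?thesis
  proof (rule isoI)
    show "(\<lambda>P. the_elem ((\<lambda>(n, f). c n f) ` P)) \<in> hom (colim_group A t) H"
    proof (rule homI)
      fix P assume "P \<in> carrier (colim_group A t)"
      then obtain z where "z \<in> carrier H" "P = cls z" by (auto simp: carrier)
      then show "the_elem ((\<lambda>(n, f). c n f) ` P) \<in> carrier H" by (simp add: val)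
    next
      fix P Q assume "P \<in> carrier (colim_group A t)" "Q \<in> carrier (colim_group A t)"
      then obtain z w where zw: "z \<in> carrier H" "P = cls z" "w \<in> carrier H" "Q = cls w"
        by (auto simp: carrier)
      have "z \<otimes>\<^bsub>H\<^esub> w \<in> carrier H" using common[OF zw(1,3)] c[OF A] c_mult by metis
      then show "the_elem ((\<lambda>(n, f). c n f) ` (P \<otimes>\<^bsub>colim_group A t\<^esub> Q)) =
        the_elem ((\<lambda>(n, f). c n f) ` P) \<otimes>\<^bsub>H\<^esub> the_elem ((\<lambda>(n, f). c n f) ` Q)"
        using zw by (simp add: mult val)
    qed
    have "inj_on (\<lambda>P. the_elem ((\<lambda>(n, f). c n f) ` P)) (cls ` carrier H)"
      by (auto simp: inj_on_def val)
    moreover have "(\<lambda>P. the_elem ((\<lambda>(n, f). c n f) ` P)) ` cls ` carrier H = carrier H"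
      by (force simp: val image_image)
    ultimately show "bij_betw (\<lambda>P. the_elem ((\<lambda>(n, f). c n f) ` P)) (carrier (colim_group A t))
      (carrier H)"
      by (simp add: carrier bij_betw_def)
  qed
qed

section \<open>Truncation and the two quotients\<close>

context abelian_category
begin

abbreviation (input) "K \<equiv> K_minus C"

lemma K_minus_ArrE:
  assumes "f \<in> Arr K"
  obtains X Y \<phi> where "f = htpy_arrow C X Y \<phi>" "is_complex C X" "is_complex C Y"
    "X \<in> K_minus_obj C" "Y \<in> K_minus_obj C" "chain_map C X Y \<phi>"
    "Dom K f = X" "Cod K f = Y"
  using assms by (auto simp: K_minus_simps)

lemma htpy_arrow_K_minus:
  assumes "is_complex C X" "is_complex C Y" "X \<in> K_minus_obj C" "Y \<in> K_minus_obj C"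
    "chain_map C X Y \<phi>"
  shows "htpy_arrow C X Y \<phi> \<in> Arr K" "Dom K (htpy_arrow C X Y \<phi>) = X"
    "Cod K (htpy_arrow C X Y \<phi>) = Y"
  using assms by (auto simp: K_minus_simps)

lemma qis_class_Arr: "s \<in> qis_class F \<Longrightarrow> s \<in> Arr K"
  unfolding qis_class_def K_minus_simps by blast

text \<open>Invariance of the filter under a shift by one degree enters in the cancellation axiom,
  through the degree lost in \<open>null_homotopic_cancel\<close>; the Ore square preserves
  degrees.\<close>

lemma right_fractions_qis_class:
  assumes F: "\<And>P. eventually P F \<Longrightarrow> eventually (\<lambda>n::int. P (n - 1)) F"
  shows "right_fractions K (qis_class F)"
proof (intro right_fractions.intro right_fractions_axioms.intro preadditive_K_minus)
  show "s \<in> qis_class F \<Longrightarrow> s \<in> Arr K" for s by (rule qis_class_Arr)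
next
  fix A assume "A \<in> Obj K"
  then show "Ident K A \<in> qis_class F"
    by (auto simp: K_minus_simps Ident_K htpy_arrow_qis_class chain_map_Ident
        intro!: always_eventually qis_at_Ident)
next
  fix s t assume st: "s \<in> qis_class F" "t \<in> qis_class F" "Dom K t = Cod K s"
  obtain X Y \<phi> where s: "s = htpy_arrow C X Y \<phi>" "is_complex C X" "is_complex C Y"
    "X \<in> K_minus_obj C" "Y \<in> K_minus_obj C" "chain_map C X Y \<phi>" "Cod K s = Y"
    using K_minus_ArrE[OF qis_class_Arr[OF st(1)]] by metis
  obtain Y' Z \<gamma> where t: "t = htpy_arrow C Y' Z \<gamma>" "is_complex C Z"
    "Z \<in> K_minus_obj C" "chain_map C Y' Z \<gamma>" "Dom K t = Y'"
    using K_minus_ArrE[OF qis_class_Arr[OF st(2)]] by metis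
  have Y [simp]: "Y' = Y" using st(3) s t by simp
  have "eventually (qis_at X Y \<phi>) F" "eventually (qis_at Y Z \<gamma>) F"
    using st s t htpy_arrow_qis_class by auto
  then have "eventually (qis_at X Z (\<lambda>n. Comp C (\<gamma> n) (\<phi> n))) F"
    by eventually_elim (rule qis_at_Comp[OF s(2,3) t(2) s(6) t(4)[unfolded Y]])
  then show "Comp K t s \<in> qis_class F"
    using s t by (simp add: K_minus_simps Comp_htpy htpy_arrow_qis_class chain_map_Comp[OF s(2,3)])
next
  fix f t assume ft: "f \<in> Arr K" "t \<in> qis_class F" "Cod K f = Cod K t"
  obtain X Y \<phi> where f: "f = htpy_arrow C X Y \<phi>" "is_complex C X" "is_complex C Y"
    "X \<in> K_minus_obj C" "Y \<in> K_minus_obj C" "chain_map C X Y \<phi>" "Dom K f = X" "Cod K f = Y"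
    using K_minus_ArrE[OF ft(1)] by metis
  obtain Z Y' \<tau> where t: "t = htpy_arrow C Z Y' \<tau>" "is_complex C Z"
    "Z \<in> K_minus_obj C" "chain_map C Z Y' \<tau>" "Dom K t = Z" "Cod K t = Y'"
    using K_minus_ArrE[OF qis_class_Arr[OF ft(2)]] by metis
  have Y [simp]: "Y' = Y" using ft(3) f t by simp
  obtain U u h where U: "is_complex C U" "U \<in> K_minus_obj C" "chain_map C U X u" "chain_map C U Z h"
    "homotopic C U Y (\<lambda>n. Comp C (\<phi> n) (u n)) (\<lambda>n. Comp C (\<tau> n) (h n))"
    "\<And>n. qis_at Z Y \<tau> n \<Longrightarrow> qis_at U X u n"
    using Ore_square[OF f(2,3) t(2) f(6) t(4)[unfolded Y] f(4,5) t(3)] by blast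
  have "eventually (qis_at Z Y \<tau>) F" using ft(2) f t htpy_arrow_qis_class by auto
  then have "eventually (qis_at U X u) F" by (rule eventually_mono) (rule U(6))
  then have "htpy_arrow C U X u \<in> qis_class F" using U f htpy_arrow_qis_class by auto
  moreover have "Comp K f (htpy_arrow C U X u) = Comp K t (htpy_arrow C U Z h)"
    using U f t htpy_arrow_eq_iff[OF U(1) f(3) chain_map_Comp[OF U(1) f(2,3) U(3) f(6)]
        chain_map_Comp[OF U(1) t(2) f(3) U(4) t(4)[unfolded Y]]]
    by (simp add: K_minus_simps Comp_htpy)
  ultimately show "\<exists>u h. u \<in> qis_class F \<and> h \<in> Arr K \<and> Dom K u = Dom K h \<and>
      Cod K u = Dom K f \<and> Cod K h = Dom K t \<and>
      Comp K f u = Comp K t h"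
    using htpy_arrow_K_minus[OF U(1) f(2) U(2) f(4) U(3)] htpy_arrow_K_minus[OF U(1) t(2) U(2)
      t(3) U(4)] f(7) t(5)
    by metis
next
  fix f s assume fs: "f \<in> Arr K" "s \<in> qis_class F" "Cod K f = Dom K s"
    "Comp K s f = Zero K (Dom K f) (Cod K s)"
  obtain X Y \<phi> where f: "f = htpy_arrow C X Y \<phi>" "is_complex C X" "is_complex C Y"
    "X \<in> K_minus_obj C" "Y \<in> K_minus_obj C" "chain_map C X Y \<phi>" "Dom K f = X" "Cod K f = Y"
    using K_minus_ArrE[OF fs(1)] by metis
  obtain Y' Z \<sigma> where s: "s = htpy_arrow C Y' Z \<sigma>" "is_complex C Z"
    "Z \<in> K_minus_obj C" "chain_map C Y' Z \<sigma>" "Dom K s = Y'" "Cod K s = Z"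
    using K_minus_ArrE[OF qis_class_Arr[OF fs(2)]] by metis
  have Y [simp]: "Y' = Y" using fs(3) f s by simp
  have "homotopic C X Z (\<lambda>n. Comp C (\<sigma> n) (\<phi> n)) (\<lambda>n. Zero C (ob X n) (ob Z n))"
    using fs(4) f s htpy_arrow_eq_iff[OF f(2) s(2) chain_map_Comp[OF f(2,3) s(2) f(6)
      s(4)[unfolded Y]] chain_map_Zero[OF f(2) s(2)]]
    by (simp add: K_minus_simps Comp_htpy Zero_K)
  then obtain U u where U: "is_complex C U" "U \<in> K_minus_obj C" "chain_map C U X u"
    "homotopic C U Y (\<lambda>n. Comp C (\<phi> n) (u n)) (\<lambda>n. Zero C (ob U n) (ob Y n))"
    "\<And>n. qis_at Y Z \<sigma> (n - 1) \<Longrightarrow> qis_at U X u n"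
    using null_homotopic_cancel[OF f(2,3) s(2) f(6) s(4)[unfolded Y] f(4,5) s(3)] by blast
  have "eventually (qis_at Y Z \<sigma>) F" using fs(2) f s htpy_arrow_qis_class by auto
  then have "eventually (\<lambda>n. qis_at Y Z \<sigma> (n - 1)) F" by (rule F)
  then have "eventually (qis_at U X u) F" by (rule eventually_mono) (rule U(5))
  then have "htpy_arrow C U X u \<in> qis_class F" using U f htpy_arrow_qis_class by auto
  moreover have "Comp K f (htpy_arrow C U X u) = Zero K U Y"
    using U f htpy_arrow_eq_iff[OF U(1) f(3) chain_map_Comp[OF U(1) f(2,3) U(3) f(6)]
      chain_map_Zero[OF U(1) f(3)]]
    by (simp add: K_minus_simps Comp_htpy Zero_K)
  ultimately show "\<exists>u\<in>qis_class F. Cod K u = Dom K f \<and>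
      Comp K f u = Zero K (Dom K u) (Cod K f)"
    using htpy_arrow_K_minus[OF U(1) f(2) U(2) f(4) U(3)] f(7,8) by metis
qed

lemma right_fractions_top: "right_fractions K (qis_class top)"
  by (rule right_fractions_qis_class) simp

lemma right_fractions_at_bot: "right_fractions K (qis_class at_bot)"
proof (rule right_fractions_qis_class)
  fix P :: "int \<Rightarrow> bool" assume "eventually P at_bot"
  then obtain N where "\<And>n. n \<le> N \<Longrightarrow> P n" by (auto simp: eventually_at_bot_linorder)
  then show "\<forall>\<^sub>F n in at_bot. P (n - 1)"
    unfolding eventually_at_bot_linorder by (intro exI[of _ N]) simp
qed

section \<open>Truncation on the right bounded homotopy category\<close>

definition incl_K :: "int \<Rightarrow> ('a, 'b) cochain \<Rightarrow> ('a, 'b) karrow" where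
  "incl_K n X = htpy_arrow C (trunc C n X) X (trunc_incl C n X)"

lemma incl_K:
  assumes "X \<in> Obj K"
  shows "incl_K n X \<in> Arr K" "Dom K (incl_K n X) = trunc C n X"
    "Cod K (incl_K n X) = X" "incl_K n X \<in> qis_class at_bot"
proof -
  have X: "is_complex C X" "X \<in> K_minus_obj C" using assms by (simp_all add: K_minus_simps)
  note i = is_complex_trunc[OF X(1), of n] chain_map_trunc_incl[OF X(1), of n]
    trunc_K_minus[OF X(1), of n]
  show "incl_K n X \<in> Arr K" "Dom K (incl_K n X) = trunc C n X"
    "Cod K (incl_K n X) = X"
    unfolding incl_K_def using htpy_arrow_K_minus[OF i(1) X(1) i(3) X(2) i(2)] by auto
  have "eventually (qis_at (trunc C n X) X (trunc_incl C n X)) at_bot"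
    unfolding eventually_at_bot_linorder using qis_at_trunc_incl[OF X(1), of _ n]
      by (intro exI[of _ "n - 2"]) auto
  then show "incl_K n X \<in> qis_class at_bot"
    unfolding incl_K_def using i X htpy_arrow_qis_class by auto
qed

lemma trunc_K_Arr:
  assumes "f \<in> Arr K"
  shows "on_arr (trunc_K C n) f \<in> Arr K"
    "Dom K (on_arr (trunc_K C n) f) = trunc C n (Dom K f)"
    "Cod K (on_arr (trunc_K C n) f) = trunc C n (Cod K f)"
proof -
  obtain X Y \<phi> where f: "f = htpy_arrow C X Y \<phi>" "is_complex C X" "is_complex C Y"
    "X \<in> K_minus_obj C" "Y \<in> K_minus_obj C" "chain_map C X Y \<phi>" "Dom K f = X" "Cod K f = Y"
    using K_minus_ArrE[OF assms] by metis
  show "on_arr (trunc_K C n) f \<in> Arr K"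
    "Dom K (on_arr (trunc_K C n) f) = trunc C n (Dom K f)"
    "Cod K (on_arr (trunc_K C n) f) = trunc C n (Cod K f)"
    unfolding f(7,8) unfolding f(1) trunc_K_htpy[OF f(2,3,6)]
    using htpy_arrow_K_minus[OF is_complex_trunc[OF f(2)] is_complex_trunc[OF f(3)]
      trunc_K_minus[OF f(2)]
        trunc_K_minus[OF f(3)] chain_map_trunc[OF f(2,3,6)]] by auto
qed

lemma trunc_K_Comp:
  assumes "f \<in> Arr K" "g \<in> Arr K" "Dom K g = Cod K f"
  shows "on_arr (trunc_K C n) (Comp K g f) =
    Comp K (on_arr (trunc_K C n) g) (on_arr (trunc_K C n) f)"
proof -
  obtain X Y \<phi> where f: "f = htpy_arrow C X Y \<phi>" "is_complex C X" "is_complex C Y"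
    "chain_map C X Y \<phi>" "Cod K f = Y"
    using K_minus_ArrE[OF assms(1)] by metis
  obtain Z \<gamma> where g: "g = htpy_arrow C Y Z \<gamma>" "is_complex C Z" "chain_map C Y Z \<gamma>"
    using K_minus_ArrE[OF assms(2)] assms(3) f(5) by metis
  show ?thesis
    unfolding f(1) g(1) K_minus_simps
    by (simp add: Comp_htpy f g trunc_K_htpy chain_map_Comp[OF f(2,3) g(2)] is_complex_trunc
      chain_map_trunc
        trunc_map_Comp[OF f(2,3) g(2)])
qed

lemma trunc_K_Plus:
  assumes "f \<in> Arr K" "g \<in> Arr K" "Dom K g = Dom K f"
    "Cod K g = Cod K f"
  shows "on_arr (trunc_K C n) (Plus K f g) =
    Plus K (on_arr (trunc_K C n) f) (on_arr (trunc_K C n) g)"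
proof -
  obtain X Y \<phi> where f: "f = htpy_arrow C X Y \<phi>" "is_complex C X" "is_complex C Y"
    "chain_map C X Y \<phi>"
    "Dom K f = X" "Cod K f = Y"
    using K_minus_ArrE[OF assms(1)] by metis
  obtain \<gamma> where g: "g = htpy_arrow C X Y \<gamma>" "chain_map C X Y \<gamma>"
    using K_minus_ArrE[OF assms(2)] assms(3,4) f(5,6) by metis
  show ?thesis
    unfolding f(1) g(1) K_minus_simps
    by (simp add: Plus_htpy f g trunc_K_htpy chain_map_Plus is_complex_trunc chain_map_trunc
      trunc_map_Plus)
qed

lemma trunc_K_trunc_K:
  assumes "f \<in> Arr K" "k < n"
  shows "on_arr (trunc_K C k) (on_arr (trunc_K C n) f) = on_arr (trunc_K C k) f"
proof -
  obtain X Y \<phi> where f: "f = htpy_arrow C X Y \<phi>" "is_complex C X" "is_complex C Y"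
    "chain_map C X Y \<phi>"
    using K_minus_ArrE[OF assms(1)] by metis
  show ?thesis
    using assms(2) unfolding f(1)
    by (simp add: f trunc_K_htpy is_complex_trunc chain_map_trunc trunc_map_trunc_map
      trunc_trunc_less)
qed

lemma trunc_K_incl_K:
  assumes "X \<in> Obj K" "k < n"
  shows "on_arr (trunc_K C k) (incl_K n X) = Ident K (trunc C k X)"
proof -
  have X: "is_complex C X" using assms by (simp add: K_minus_simps)
  show ?thesis
    using assms(2) unfolding incl_K_def
    by (simp add: trunc_K_htpy is_complex_trunc chain_map_trunc_incl X trunc_map_trunc_incl
      trunc_trunc_less
        K_minus_simps Ident_K)
qed

lemma incl_K_incl_K:
  assumes "X \<in> Obj K" "k < n"
  shows "Comp K (incl_K n X) (incl_K k (trunc C n X)) = incl_K k X"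
proof -
  have X: "is_complex C X" using assms by (simp add: K_minus_simps)
  show ?thesis
    using assms(2) trunc_incl_trunc_incl[OF X assms(2)]
      chain_map_trunc_incl[OF is_complex_trunc[OF X], of k n]
    unfolding incl_K_def K_minus_simps
    by (simp add: Comp_htpy is_complex_trunc X chain_map_trunc_incl trunc_trunc_less)
qed

lemma incl_K_natural:
  assumes "f \<in> Arr K"
  shows "Comp K (incl_K n (Cod K f)) (on_arr (trunc_K C n) f) =
    Comp K f (incl_K n (Dom K f))"
proof -
  obtain X Y \<phi> where f: "f = htpy_arrow C X Y \<phi>" "is_complex C X" "is_complex C Y"
    "chain_map C X Y \<phi>"
    "Dom K f = X" "Cod K f = Y"
    using K_minus_ArrE[OF assms(1)] by metis
  note T = is_complex_trunc[OF f(2), of n] is_complex_trunc[OF f(3), of n]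
    chain_map_trunc[OF f(2,3,4), of n]
    chain_map_trunc_incl[OF f(2), of n] chain_map_trunc_incl[OF f(3), of n]
  have "homotopic C (trunc C n X) Y (\<lambda>i. Comp C (trunc_incl C n Y i) (trunc_map C n X Y \<phi> i))
    (\<lambda>i. Comp C (\<phi> i) (trunc_incl C n X i))"
    using chain_map_Comp[OF T(1,2) f(3) T(3,5)] chain_map_Comp[OF T(1) f(2,3) T(4) f(4)]
      trunc_incl[OF f(2)] trunc_incl[OF f(3)] trunc_map[OF f(2,3,4)]
        chain_mapD[OF f(4,2,3)] T(1) f(3)
    by (intro homotopicI_eq) simp_all
  then show ?thesis
    unfolding f(5,6) unfolding f(1) incl_K_def trunc_K_htpy[OF f(2,3,4)] K_minus_simps
      Comp_htpy[OF T(1,2) f(3) T(3,5)] Comp_htpy[OF T(1) f(2,3) T(4) f(4)]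
    using htpy_arrow_eq_iff[OF T(1) f(3) chain_map_Comp[OF T(1,2) f(3) T(3,5)]
      chain_map_Comp[OF T(1) f(2,3) T(4) f(4)]]
    by simp
qed

text \<open>The threshold in the second statement is a degree up to which \<open>s\<close> satisfies
  \<open>qis_at\<close>. It works for every lower truncation too, so it can later be combined with
  the demand to lie below a given \<open>n\<close>.\<close>

lemma trunc_K_qis_top: "s \<in> qis_class top \<Longrightarrow> on_arr (trunc_K C n) s \<in> qis_class top"
  and trunc_K_qis_at_bot: "s \<in> qis_class at_bot \<Longrightarrow> \<exists>N. \<forall>n\<le>N. on_arr (trunc_K C n) s \<in> qis_class top"
proof -
  have *: "on_arr (trunc_K C n) (htpy_arrow C X Y \<phi>) \<in> qis_class top"
    if "is_complex C X" "is_complex C Y" "chain_map C X Y \<phi>"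
      "\<And>m. m \<le> n \<Longrightarrow> qis_at X Y \<phi> m" for X Y \<phi> n
    using that qis_at_trunc_map[OF that]
    by (simp add: trunc_K_htpy htpy_arrow_qis_class is_complex_trunc chain_map_trunc trunc_K_minus)
  show "on_arr (trunc_K C n) s \<in> qis_class top" if "s \<in> qis_class top"
    using that * unfolding qis_class_def[of top] by auto
  show "\<exists>N. \<forall>n\<le>N. on_arr (trunc_K C n) s \<in> qis_class top" if s: "s \<in> qis_class at_bot"
  proof -
    obtain X Y \<phi> where f: "s = htpy_arrow C X Y \<phi>" "is_complex C X" "is_complex C Y"
      "chain_map C X Y \<phi>" "eventually (qis_at X Y \<phi>) at_bot"
      using s unfolding qis_class_def by blast
    then obtain N where "\<And>m. m \<le> N \<Longrightarrow> qis_at X Y \<phi> m" by (auto simp: eventually_at_bot_linorder)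
    then show ?thesis unfolding f(1) by (intro exI[of _ N] allI impI *) (use f in auto)
  qed
qed

lemma qis_class_top_subset: "qis_class top \<subseteq> qis_class at_bot"
  unfolding qis_class_def by (auto intro: always_eventually)

section \<open>The natural map in terms of fractions\<close>

context
  fixes X Y
  assumes XK: "X \<in> Obj K" and YK: "Y \<in> Obj K"
begin

interpretation K: preadditive_category "K" by (rule preadditive_K_minus)
interpretation D: right_fractions "K" "qis_class top" by (rule right_fractions_top)
interpretation DI: right_fractions "K" "qis_class at_bot" by (rule right_fractions_at_bot)

abbreviation (input) "R n \<equiv> roofs K (qis_class top) (trunc C n X) (trunc C n Y)"
abbreviation (input) "RI \<equiv> roofs K (qis_class at_bot) X Y"
abbreviation (input) "fr n \<equiv> D.frac (trunc C n X) (trunc C n Y)"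
abbreviation (input) "frI \<equiv> DI.frac X Y"
abbreviation (input) "TK n f \<equiv> on_arr (trunc_K C n) f"

lemma trunc_Obj: "Z \<in> Obj K \<Longrightarrow> trunc C n Z \<in> Obj K"
  by (simp add: K_minus_simps is_complex_trunc trunc_K_minus)

text \<open>The functor \<open>G\<close> keeps the roof and only enlarges the class of denominators;
  conjugation with the inclusions then acts on its two legs.\<close>

lemma natural_component_frac:
  assumes r: "(s, f) \<in> R n"
  shows "natural_component C X Y n (fr n s f) =
      frI (Comp K (incl_K n X) s) (Comp K (incl_K n Y) f)"
    and "(Comp K (incl_K n X) s, Comp K (incl_K n Y) f) \<in> RI"
proof -
  note R = r[unfolded D.roofs_iff] and iX = incl_K[OF XK, of n] and iY = incl_K[OF YK, of n]
  have r': "(s, f) \<in> roofs K (qis_class at_bot) (trunc C n X) (trunc C n Y)"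
    using R qis_class_top_subset by (auto simp: DI.roofs_iff)
  have "on_arr (quot_G C) (fr n s f) = DI.frac (trunc C n X) (trunc C n Y) s f"
    unfolding quot_G_def cone_in_b
    by (subst DI.loc_functor_frac[OF right_fractions_top _ _ _ r])
      (use qis_class_top_subset in \<open>auto intro: K.HomI\<close>)
  then show "natural_component C X Y n (fr n s f) =
      frI (Comp K (incl_K n X) s) (Comp K (incl_K n Y) f)"
    using DI.conjugate_frac[OF r' iX(4,2) iY(1,2)] iX(3) iY(3)
    unfolding natural_component_def incl_inf_def D_minus_inf_def verdier_quotient_def cone_in_b
      incl_K_def
    by simp
  show "(Comp K (incl_K n X) s, Comp K (incl_K n Y) f) \<in> RI"
    using r'[unfolded DI.roofs_iff] iX iY by (auto simp: DI.roofs_iff intro!: DI.Comp_S)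
qed

lemma trunc_roof:
  assumes "(s, f) \<in> R n" and "k < n"
  shows "(TK k s, TK k f) \<in> R k"
  using assms trunc_K_Arr[of s k] trunc_K_Arr[of f k] trunc_K_qis_top[of s k]
  by (auto simp: D.roofs_iff trunc_trunc_less)

lemma trunc_transition_frac:
  assumes r: "(s, f) \<in> R n"
  shows "trunc_transition C n (fr n s f) =
    fr (n - 1) (TK (n - 1) s) (TK (n - 1) f)"
proof -
  have o: "on_obj (trunc_K C k) Z = trunc C k Z" for k Z by (simp add: trunc_K_def)
  show ?thesis
    unfolding trunc_transition_def trunc_D_def cone_in_empty
    by (subst D.loc_functor_frac[OF right_fractions_top _ _ _ r])
      (auto simp: o K.Hom_iff trunc_K_Arr trunc_K_Comp trunc_K_qis_top trunc_trunc)
qed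

text \<open>Iterated truncation collapses to a single one. At least one step is taken, so the target
  index is strictly below \<open>n\<close>, as strict equality of nested truncations
  demands.\<close>

lemma steps_transition_frac:
  assumes r: "(s, f) \<in> R n"
    and "m = n - int (Suc k)"
  shows "steps (trunc_transition C) n (Suc k) (fr n s f) =
    fr m (TK m s) (TK m f)"
  using assms(2)
proof (induction k arbitrary: m)
  case 0
  then show ?case using trunc_transition_frac[OF r] by simp
next
  case (Suc k)
  let ?l = "n - int (Suc k)"
  have m: "m = ?l - 1" using Suc.prems by simp
  have r': "(TK ?l s, TK ?l f) \<in> R ?l"
    by (rule trunc_roof[OF r]) simp
  have "steps (trunc_transition C) n (Suc (Suc k)) (fr n s f) =
    trunc_transition C ?l (steps (trunc_transition C) n (Suc k) (fr n s f))"
    by (rule steps.simps(2))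
  also have "\<dots> = fr m (TK m (TK ?l s)) (TK m (TK ?l f))"
    unfolding Suc.IH[OF refl] m by (rule trunc_transition_frac[OF r'])
  also have "TK m (TK ?l s) = TK m s"
    using r by (intro trunc_K_trunc_K) (auto simp: D.roofs_iff m)
  also have "TK m (TK ?l f) = TK m f"
    using r by (intro trunc_K_trunc_K) (auto simp: D.roofs_iff m)
  finally show ?case .
qed

text \<open>With \<open>Z\<close> the apex of the roof, naturality and transitivity of the
  inclusions give \<open>i_(n-1) (\<sigma>_(n-1) g) = (i_n g) j\<close> for both legs
  \<open>g\<close>, where \<open>j\<close> includes the truncation of \<open>Z\<close> at
  \<open>n - 1\<close>. So the second roof is an expansion of the first along \<open>j\<close>, a
  denominator for \<open>at_bot\<close>.\<close>

lemma natural_component_transition: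
  assumes r: "(s, f) \<in> R n"
  shows "natural_component C X Y (n - 1) (trunc_transition C n (fr n s f)) =
    natural_component C X Y n (fr n s f)"
proof -
  note R = r[unfolded D.roofs_iff]
  let ?Z = "Dom K s"
  have Z: "?Z \<in> Obj K" using R by auto
  note iZ = incl_K[OF Z, of "n - 1"] and iX = incl_K[OF XK, of n] and iY = incl_K[OF YK, of n]
  have r': "(TK (n - 1) s, TK (n - 1) f) \<in> R (n - 1)"
    by (rule trunc_roof[OF r]) simp
  have eq: "Comp K (incl_K (n - 1) W) (TK (n - 1) g) =
      Comp K (Comp K (incl_K n W) g) (incl_K (n - 1) ?Z)"
    if W: "W \<in> Obj K" and g: "g \<in> Arr K" "Dom K g = ?Z" "Cod K g = trunc C n W"
    for W g
  proof -
    note j = incl_K[OF trunc_Obj[OF W], of "n - 1" n] and i = incl_K[OF W, of n]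
    have "Comp K (incl_K (n - 1) W) (TK (n - 1) g) =
      Comp K (Comp K (incl_K n W) (incl_K (n - 1) (trunc C n W))) (TK (n - 1) g)"
      using incl_K_incl_K[OF W, of "n - 1" n] by simp
    also have "\<dots> = Comp K (incl_K n W) (Comp K (incl_K (n - 1) (Cod K g)) (TK (n - 1) g))"
      unfolding g(3) using i j trunc_K_Arr[OF g(1), of "n - 1"] g(3) by (intro K.Comp_assoc') auto
    also have "\<dots> = Comp K (incl_K n W) (Comp K g (incl_K (n - 1) ?Z))"
      unfolding incl_K_natural[OF g(1)] g(2) ..
    also have "\<dots> = Comp K (Comp K (incl_K n W) g) (incl_K (n - 1) ?Z)"
      using i j g iZ by (intro K.Comp_assoc'[symmetric]) auto
    finally show ?thesis .
  qed
  note nr = natural_component_frac[OF r] and nr' = natural_component_frac[OF r']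
  have "roof_eq K (qis_class at_bot) (Comp K (incl_K n X) s, Comp K (incl_K n Y) f)
    (Comp K (incl_K (n - 1) X) (TK (n - 1) s), Comp K (incl_K (n - 1) Y) (TK (n - 1) f))"
    using nr'(2) R eq[OF XK, of s] eq[OF YK, of f] iX iZ
    by (intro DI.roof_eq_Comp[OF nr(2) iZ(1), THEN back_subst[of "\<lambda>q. roof_eq _ _ _ q"]])
      (auto simp: DI.roofs_iff)
  then show ?thesis
    unfolding trunc_transition_frac[OF r] nr(1) nr'(1)
    using DI.frac_eq_iff[OF nr(2) nr'(2)] by simp
qed

lemma natural_component_eventually_injective:
  assumes r: "(s, f) \<in> R n"
    and r': "(t, g) \<in> R n"
    and eq: "natural_component C X Y n (fr n s f) =
      natural_component C X Y n (fr n t g)"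
  shows "\<exists>k. steps (trunc_transition C) n k (fr n s f) =
    steps (trunc_transition C) n k (fr n t g)"
proof -
  note R = r[unfolded D.roofs_iff] r'[unfolded D.roofs_iff]
  note nr = natural_component_frac[OF r] and nr' = natural_component_frac[OF r']
  note iX = incl_K[OF XK, of n] and iY = incl_K[OF YK, of n]
  have "roof_eq K (qis_class at_bot) (Comp K (incl_K n X) s, Comp K (incl_K n Y) f)
    (Comp K (incl_K n X) t, Comp K (incl_K n Y) g)"
    using eq DI.frac_eq_iff[OF nr(2) nr'(2)] unfolding nr(1) nr'(1) by simp
  then obtain a b where ab: "a \<in> Arr K" "b \<in> Arr K" "Dom K a = Dom K b"
    "Cod K a = Dom K s" "Cod K b = Dom K t"
    "Comp K (Comp K (incl_K n X) s) a = Comp K (Comp K (incl_K n X) t) b"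
    "Comp K (Comp K (incl_K n X) s) a \<in> qis_class at_bot"
    "Comp K (Comp K (incl_K n Y) f) a = Comp K (Comp K (incl_K n Y) g) b"
    unfolding roof_eq_def using R iX iY by auto
  obtain N where N: "\<And>k. k \<le> N \<Longrightarrow>
      TK k (Comp K (Comp K (incl_K n X) s) a) \<in> qis_class top"
    using trunc_K_qis_at_bot[OF ab(7)] by blast
  \<comment> \<open>\<open>m \<le> N\<close> makes the truncated denominator a quasi-isomorphism in
    all degrees, and \<open>m < n\<close> makes the truncated inclusions identities.\<close>
  define m where "m = min N (n - 1)"
  have m: "m \<le> N" "m < n" by (simp_all add: m_def)
  have T: "TK m (Comp K (Comp K (incl_K n W) h) c) = Comp K (TK m h) (TK m c)"
    if W: "W \<in> Obj K" and h: "h \<in> Arr K" "Cod K h = trunc C n W"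
      and c: "c \<in> Arr K" "Cod K c = Dom K h" for W h c
    using incl_K[OF W, of n] h c trunc_K_Arr[of h m] m(2)
    by (simp add: trunc_K_Comp trunc_K_incl_K[OF W m(2)] trunc_trunc_less)
  have Ts: "Comp K (TK m s) (TK m a) = Comp K (TK m t) (TK m b)"
    using arg_cong[OF ab(6), of "TK m"] T[OF XK] R ab(1-5) by simp
  have Tf: "Comp K (TK m f) (TK m a) = Comp K (TK m g) (TK m b)"
    using arg_cong[OF ab(8), of "TK m"] T[OF YK] R ab(1-5) by simp
  have TS: "Comp K (TK m s) (TK m a) \<in> qis_class top"
    using N[OF m(1)] T[OF XK] R ab(1-5) by simp
  have "roof_eq K (qis_class top) (TK m s, TK m f) (TK m t, TK m g)"
    unfolding roof_eq_def fst_conv snd_conv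
    using Ts Tf TS ab(1-5) trunc_K_Arr[OF ab(1), of m] trunc_K_Arr[OF ab(2), of m] R
      trunc_K_Arr(2)[of s m] trunc_K_Arr(2)[of t m]
    by (intro bexI[of _ "TK m a"] bexI[of _ "TK m b"]) auto
  then have "fr m (TK m s) (TK m f) = fr m (TK m t) (TK m g)"
    using D.frac_eq_iff[OF trunc_roof[OF r m(2)] trunc_roof[OF r' m(2)]] by simp
  moreover have "m = n - int (Suc (nat (n - m - 1)))" using m(2) by simp
  ultimately show ?thesis
    using steps_transition_frac[OF r] steps_transition_frac[OF r'] by metis
qed

lemma natural_component_surjective:
  assumes r: "(s, f) \<in> RI"
  shows "\<exists>n t g. (t, g) \<in> R n \<and>
    natural_component C X Y n (fr n t g) = frI s f"
proof -
  note R = r[unfolded DI.roofs_iff]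
  obtain n where n: "TK n s \<in> qis_class top" using trunc_K_qis_at_bot R by blast
  have r': "(TK n s, TK n f) \<in> R n"
    using R n trunc_K_Arr[of s n] trunc_K_Arr[of f n] by (simp add: D.roofs_iff)
  have Z: "Dom K s \<in> Obj K" using R by auto
  note iZ = incl_K[OF Z, of n]
  note nr = natural_component_frac[OF r']
  \<comment> \<open>By naturality the image of the truncated roof is the expansion of
    \<open>(s, f)\<close> along the inclusion of the truncated apex, hence an equivalent
    roof.\<close>
  have e: "Comp K (incl_K n X) (TK n s) = Comp K s (incl_K n (Dom K s))"
    "Comp K (incl_K n Y) (TK n f) = Comp K f (incl_K n (Dom K s))"
    using incl_K_natural[of s n] incl_K_natural[of f n] R by auto
  have "roof_eq K (qis_class at_bot) (s, f)
    (Comp K (incl_K n X) (TK n s), Comp K (incl_K n Y) (TK n f))"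
    unfolding e using R iZ by (intro DI.roof_eq_Comp[OF r] DI.Comp_S) auto
  then have "natural_component C X Y n (fr n (TK n s) (TK n f)) = frI s f"
    unfolding nr(1) using DI.frac_eq_iff[OF r nr(2)] by simp
  then show ?thesis using r' by blast
qed

lemma natural_map_iso:
  "natural_map C X Y \<in> iso (colim_group (trunc_hom_system C X Y) (trunc_transition C))
          (hom_group (D_minus_inf C) X Y)"
proof -
  have cA: "carrier (trunc_hom_system C X Y n) = {fr n s f | s f.
     (s, f) \<in> R n}" for n
    using trunc_Obj[OF XK] trunc_Obj[OF YK]
    unfolding trunc_hom_system_def hom_group_def D_minus_def verdier_quotient_def cone_in_empty
    by (simp add: D.Hom_localization)
  have mA: "mult (trunc_hom_system C X Y n) = Plus (localization K (qis_class top))" for n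
    unfolding trunc_hom_system_def hom_group_def D_minus_def verdier_quotient_def cone_in_empty
      by simp
  have cH: "carrier (hom_group (D_minus_inf C) X Y) = {frI s f | s f.
     (s, f) \<in> RI}"
    using XK YK unfolding hom_group_def D_minus_inf_def verdier_quotient_def cone_in_b
    by (simp add: DI.Hom_localization)
  have mH: "mult (hom_group (D_minus_inf C) X Y) = Plus (localization K (qis_class at_bot))"
    unfolding hom_group_def D_minus_inf_def verdier_quotient_def cone_in_b by simp
  \<comment> \<open>Additivity is computed by \<open>Plus_frac\<close>, which expects both summands
    over one denominator.\<close>
  have common: "\<exists>r f g. (r, f) \<in> R n \<and>
      (r, g) \<in> R n \<and>
      x = fr n r f \<and> y = fr n r g"
    if xy: "x \<in> carrier (trunc_hom_system C X Y n)"
      "y \<in> carrier (trunc_hom_system C X Y n)" for n x y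
  proof -
    obtain s f where sf: "(s, f) \<in> R n"
      "x = fr n s f"
      using xy(1) unfolding cA by blast
    obtain t g where tg: "(t, g) \<in> R n"
      "y = fr n t g"
      using xy(2) unfolding cA by blast
    show ?thesis unfolding sf(2) tg(2) by (rule D.common_denominator[OF sf(1) tg(1)]) blast
  qed
  have plus: "(r, Plus K f g) \<in> roofs K (qis_class F) A B"
    if "(r, f) \<in> roofs K (qis_class F) A B" "(r, g) \<in> roofs K (qis_class F) A B" for r f g F A B
    using that by (auto simp: roofs_def)
  show ?thesis
    unfolding natural_map_def[abs_def]
  proof (rule colim_group_iso)
    fix n x y assume xy: "x \<in> carrier (trunc_hom_system C X Y n)"
      "y \<in> carrier (trunc_hom_system C X Y n)"
    obtain r f g where r: "(r, f) \<in> R n"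
      "(r, g) \<in> R n"
      "x = fr n r f" "y = fr n r g"
      using common[OF xy] by blast
    note P = plus[OF r(1,2)] and R = r(1,2)[unfolded D.roofs_iff]
    show "x \<otimes>\<^bsub>trunc_hom_system C X Y n\<^esub> y \<in> carrier (trunc_hom_system C X Y n)"
      unfolding mA r(3,4) D.Plus_frac[OF r(1,2)] cA using P by blast
    have rn: "(TK (n - 1) r, TK (n - 1) f) \<in> R (n - 1)"
      "(TK (n - 1) r, TK (n - 1) g) \<in> R (n - 1)"
      using trunc_roof[OF r(1)] trunc_roof[OF r(2)] by simp_all
    have pt: "TK (n - 1) (Plus K f g) = Plus K (TK (n - 1) f) (TK (n - 1) g)"
      using R by (intro trunc_K_Plus) auto
    show "trunc_transition C n (x \<otimes>\<^bsub>trunc_hom_system C X Y n\<^esub> y) =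
      trunc_transition C n x \<otimes>\<^bsub>trunc_hom_system C X Y (n - 1)\<^esub> trunc_transition C n y"
      unfolding mA r(3,4) D.Plus_frac[OF r(1,2)] trunc_transition_frac[OF P]
        trunc_transition_frac[OF r(1)]
        trunc_transition_frac[OF r(2)] D.Plus_frac[OF rn] pt ..
    have pc: "Comp K (incl_K n Y) (Plus K f g) =
      Plus K (Comp K (incl_K n Y) f) (Comp K (incl_K n Y) g)"
      using R incl_K[OF YK, of n] by (intro K.Comp_Plus_right) (auto simp: K.Hom_iff)
    show "natural_component C X Y n (x \<otimes>\<^bsub>trunc_hom_system C X Y n\<^esub> y) =
      natural_component C X Y n x \<otimes>\<^bsub>hom_group (D_minus_inf C) X Y\<^esub> natural_component C X Y n y"
      unfolding mA mH r(3,4) D.Plus_frac[OF r(1,2)] natural_component_frac(1)[OF P]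
        natural_component_frac(1)[OF r(1)]
        natural_component_frac(1)[OF r(2)]
        DI.Plus_frac[OF natural_component_frac(2)[OF r(1)] natural_component_frac(2)[OF r(2)]] pc ..
  next
    fix n x assume "x \<in> carrier (trunc_hom_system C X Y n)"
    then obtain s f where r: "(s, f) \<in> R n"
      "x = fr n s f"
      unfolding cA by blast
    have "(TK (n - 1) s, TK (n - 1) f) \<in> R (n - 1)"
      by (rule trunc_roof[OF r(1)]) simp
    then show "trunc_transition C n x \<in> carrier (trunc_hom_system C X Y (n - 1))"
      unfolding r(2) trunc_transition_frac[OF r(1)] cA by blast
    show "natural_component C X Y n x \<in> carrier (hom_group (D_minus_inf C) X Y)"
      unfolding r(2) natural_component_frac(1)[OF r(1)] cH
        using natural_component_frac(2)[OF r(1)] by blast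
    show "natural_component C X Y (n - 1) (trunc_transition C n x) = natural_component C X Y n x"
      unfolding r(2) by (rule natural_component_transition[OF r(1)])
  next
    fix n x y assume xy: "x \<in> carrier (trunc_hom_system C X Y n)"
      "y \<in> carrier (trunc_hom_system C X Y n)"
      and eq: "natural_component C X Y n x = natural_component C X Y n y"
    obtain r f g where r: "(r, f) \<in> R n"
      "(r, g) \<in> R n"
      "x = fr n r f" "y = fr n r g"
      using common[OF xy] by blast
    show "\<exists>k. steps (trunc_transition C) n k x = steps (trunc_transition C) n k y"
      unfolding r(3,4) by (rule natural_component_eventually_injective[OF r(1,2) eq[unfolded
        r(3,4)]])
  next
    fix z assume "z \<in> carrier (hom_group (D_minus_inf C) X Y)"
    then obtain s f where r: "(s, f) \<in> RI" "z = frI s f"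
      unfolding cH by blast
    then obtain n t g where "(t, g) \<in> R n"
      "natural_component C X Y n (fr n t g) = z"
      using natural_component_surjective by metis
    then show "\<exists>n. \<exists>x\<in>carrier (trunc_hom_system C X Y n). natural_component C X Y n x = z"
      unfolding cA by blast
  qed
qed

end

end

theorem proposition4p6:
  fixes C :: "('o, 'm) preadd_cat" and X Y :: "('o, 'm) cochain"
  assumes "abelian_category C"
    and "X \<in> Obj (D_minus C)" and "Y \<in> Obj (D_minus C)"
  shows "natural_map C X Y
    \<in> iso (colim_group (trunc_hom_system C X Y) (trunc_transition C))
          (hom_group (D_minus_inf C) (on_obj (quot_G C) X) (on_obj (quot_G C) Y))"
proof -
  have "on_obj (quot_G C) Z = Z" for Z by (simp add: quot_G_def loc_functor_def)
  moreover have "X \<in> Obj (K_minus C)" "Y \<in> Obj (K_minus C)"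
    using assms(2,3) by (simp_all add: D_minus_def verdier_quotient_def localization_def)
  ultimately show ?thesis using abelian_category.natural_map_iso[OF assms(1)] by simp
qed

end
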